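(* Let $H$ be an ordinary Hopf algebra over a field $k$ with a bicovariant first order differential calculus $(\Omega^1,\mathrm{d})$, and let $F$ be a $2$-cochain on $H$. Then $\Omega^1(H_F)$, defined as the vector space $\Omega^1$ with the twisted left and right products $$a\bullet\tau=F(a_{(1)}\otimes\tau_{(1)})\,a_{(2)}\tau_{(2)}\,F^{-1}(a_{(3)}\otimes\tau_{(3)}),\qquad \tau\bullet a=F(\tau_{(1)}\otimes a_{(1)})\,\tau_{(2)}a_{(2)}\,F^{-1}(\tau_{(3)}\otimes a_{(3)})$$ and the same $\mathrm{d}$, is a first order quasi differential calculus on $H_F$.
   Context: Sweedler notation is used: $\Delta a=a_{(1)}\otimes a_{(2)}$, etc. A bicovariant differential calculus on $H$ is an $H$-bimodule $\Omega^1$ with $\mathrm{d}:H\to\Omega^1$ satisfying the Leibniz rule, with $\{a\,\mathrm{d}b\}$ spanning $\Omega^1$, together with commuting left and right coactions $\Delta_L:\Omega^1\to H\otimes\Omega^1$, $\Delta_R:\Omega^1\to\Omega^1\otimes H$ that are bimodule maps (for the tensor product bimodule structures) and for which $\mathrm{d}$ is a comodule map. For $\tau\in\Omega^1$ one writes $(\mathrm{id}\otimes\Delta_R)\Delta_L\tau=(\Delta_L\otimes\mathrm{id})\Delta_R\tau=\tau_{(1)}\otimes\tau_{(2)}\otimes\tau_{(3)}\in H\otimes\Omega^1\otimes H$. A $2$-cochain is a linear map $F:H\otimes H\to k$ which is convolution invertible, $F(a_{(1)}\otimes b_{(1)})F^{-1}(a_{(2)}\otimes b_{(2)})=\epsilon(a)\epsilon(b)$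 (and similarly on the other side), and satisfies $F(1\otimes a)=\epsilon(a)$. $H_F$ is the coalgebra $H$ with modified product $a\bullet b=F(a_{(1)}\otimes b_{(1)})\,a_{(2)}b_{(2)}\,F^{-1}(a_{(3)}\otimes b_{(3)})$; it is a coquasi-Hopf algebra with $$\Phi(a\otimes b\otimes c)=F(b_{(1)}\otimes c_{(1)})F(a_{(1)}\otimes b_{(2)}c_{(2)})F^{-1}(a_{(2)}b_{(3)}\otimes c_{(3)})F^{-1}(a_{(3)}\otimes b_{(4)}),$$ meaning $a\bullet(b\bullet c)=\Phi(a_{(1)}\otimes b_{(1)}\otimes c_{(1)})\,(a_{(2)}\bullet b_{(2)})\bullet c_{(2)}\,\Phi^{-1}(a_{(3)}\otimes b_{(3)}\otimes c_{(3)})$. A first order quasi differential calculus on a coquasi-Hopf algebra $(H,\Phi)$ (with product $\bullet$) is a pair $(\Omega^1,\mathrm{d})$ where $\Omega^1$ (with left and right coactions, notation $\tau_{(1)}\otimes\tau_{(2)}\otimes\tau_{(3)}$ as before) is a quasi-bimodule, i.e. $a\bullet(b\bullet\tau)=\Phi(a_{(1)}\otimes b_{(1)}\otimes\tau_{(1)})(a_{(2)}\bullet b_{(2)})\bullet\tau_{(2)}\Phi^{-1}(a_{(3)}\otimes b_{(3)}\otimes\tau_{(3)})$, $\tau\bullet(b\bullet c)=\Phi(\tau_{(1)}\otimes b_{(1)}\otimes c_{(1)})(\tau_{(2)}\bullet b_{(2)})\bullet c_{(2)}\Phi^{-1}(\tau_{(3)}\otimes b_{(3)}\otimes c_{(3)})$,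 $a\bullet(\tau\bullet c)=\Phi(a_{(1)}\otimes\tau_{(1)}\otimes c_{(1)})(a_{(2)}\bullet\tau_{(2)})\bullet c_{(2)}\Phi^{-1}(a_{(3)}\otimes\tau_{(3)}\otimes c_{(3)})$, and the rest is as usual: $\mathrm{d}(a\bullet b)=a\bullet\mathrm{d}b+(\mathrm{d}a)\bullet b$ and $\{a\bullet\mathrm{d}b\}$ spans $\Omega^1$. *)

theory Defs
  imports Complex_Main "HOL-Library.Multiset"
begin

text \<open>
  Vector spaces over the field \<open>'k\<close> are types with a scalar multiplication (locale
  \<open>vector_space\<close>).  A type of tensors cannot depend on the scalar multiplication, so an element
  of \<open>A \<otimes> B\<close> is written as a finite formal sum of pure tensors, i.e. a multiset of pairs, and
  equality in \<open>A \<otimes> B\<close> is the congruence generated by the defining relations of the tensor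
  product.  A linear map into \<open>A \<otimes> B\<close> is a function choosing a formal sum for each argument
  that is linear up to this congruence.  With this convention Sweedler notation is literal:
  \<open>f(a\<^sub>(\<^sub>1\<^sub>), a\<^sub>(\<^sub>2\<^sub>))\<close> is the sum over \<open>(a1, a2) \<in># \<Delta> a\<close>.  Linear maps out of a tensor product
  are multilinear functions.
\<close>

inductive tensor_eq ::
  "('k::field \<Rightarrow> 'a::ab_group_add \<Rightarrow> 'a) \<Rightarrow> ('k \<Rightarrow> 'b::ab_group_add \<Rightarrow> 'b)
    \<Rightarrow> ('a \<times> 'b) multiset \<Rightarrow> ('a \<times> 'b) multiset \<Rightarrow> bool"
  for sA sB where
  refl: "tensor_eq sA sB M M"
| sym: "tensor_eq sA sB M N \<Longrightarrow> tensor_eq sA sB N M"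
| trans: "tensor_eq sA sB M N \<Longrightarrow> tensor_eq sA sB N P \<Longrightarrow> tensor_eq sA sB M P"
| plus: "tensor_eq sA sB M N \<Longrightarrow> tensor_eq sA sB P Q \<Longrightarrow> tensor_eq sA sB (M + P) (N + Q)"
| zero: "tensor_eq sA sB {#(0, y)#} {#}"
| add_left: "tensor_eq sA sB {#(x + x', y)#} {#(x, y), (x', y)#}"
| add_right: "tensor_eq sA sB {#(x, y + y')#} {#(x, y), (x, y')#}"
| balanced: "tensor_eq sA sB {#(sA c x, y)#} {#(x, sB c y)#}"

inductive tensor3_eq ::
  "('k::field \<Rightarrow> 'a::ab_group_add \<Rightarrow> 'a) \<Rightarrow> ('k \<Rightarrow> 'b::ab_group_add \<Rightarrow> 'b)
    \<Rightarrow> ('k \<Rightarrow> 'c::ab_group_add \<Rightarrow> 'c)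
    \<Rightarrow> ('a \<times> 'b \<times> 'c) multiset \<Rightarrow> ('a \<times> 'b \<times> 'c) multiset \<Rightarrow> bool"
  for sA sB sC where
  refl: "tensor3_eq sA sB sC M M"
| sym: "tensor3_eq sA sB sC M N \<Longrightarrow> tensor3_eq sA sB sC N M"
| trans: "tensor3_eq sA sB sC M N \<Longrightarrow> tensor3_eq sA sB sC N P \<Longrightarrow> tensor3_eq sA sB sC M P"
| plus: "tensor3_eq sA sB sC M N \<Longrightarrow> tensor3_eq sA sB sC P Q
    \<Longrightarrow> tensor3_eq sA sB sC (M + P) (N + Q)"
| zero: "tensor3_eq sA sB sC {#(0, y, z)#} {#}"
| add_1: "tensor3_eq sA sB sC {#(x + x', y, z)#} {#(x, y, z), (x', y, z)#}"
| add_2: "tensor3_eq sA sB sC {#(x, y + y', z)#} {#(x, y, z), (x, y', z)#}"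
| add_3: "tensor3_eq sA sB sC {#(x, y, z + z')#} {#(x, y, z), (x, y, z')#}"
| balanced_12: "tensor3_eq sA sB sC {#(sA c x, y, z)#} {#(x, sB c y, z)#}"
| balanced_23: "tensor3_eq sA sB sC {#(x, sB c y, z)#} {#(x, y, sC c z)#}"

definition linear_to_tensor ::
  "('k::field \<Rightarrow> 'v::ab_group_add \<Rightarrow> 'v) \<Rightarrow> ('k \<Rightarrow> 'a::ab_group_add \<Rightarrow> 'a)
    \<Rightarrow> ('k \<Rightarrow> 'b::ab_group_add \<Rightarrow> 'b) \<Rightarrow> ('v \<Rightarrow> ('a \<times> 'b) multiset) \<Rightarrow> bool" where
  "linear_to_tensor sV sA sB D \<longleftrightarrow>
     (\<forall>v w. tensor_eq sA sB (D (v + w)) (D v + D w)) \<and>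
     (\<forall>c v. tensor_eq sA sB (D (sV c v)) {#(sA c x, y). (x, y) \<in># D v#})"

definition bilinear_map ::
  "('k::field \<Rightarrow> 'a::ab_group_add \<Rightarrow> 'a) \<Rightarrow> ('k \<Rightarrow> 'b::ab_group_add \<Rightarrow> 'b)
    \<Rightarrow> ('k \<Rightarrow> 'c::ab_group_add \<Rightarrow> 'c) \<Rightarrow> ('a \<Rightarrow> 'b \<Rightarrow> 'c) \<Rightarrow> bool" where
  "bilinear_map sA sB sC f \<longleftrightarrow>
     (\<forall>y. Vector_Spaces.linear sA sC (\<lambda>x. f x y)) \<and>
     (\<forall>x. Vector_Spaces.linear sB sC (f x))"

definition trilinear_form ::
  "('k::field \<Rightarrow> 'a::ab_group_add \<Rightarrow> 'a) \<Rightarrow> ('a \<Rightarrow> 'a \<Rightarrow> 'a \<Rightarrow> 'k) \<Rightarrow> bool" where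
  "trilinear_form s f \<longleftrightarrow>
     (\<forall>y z. Vector_Spaces.linear s (*) (\<lambda>x. f x y z)) \<and>
     (\<forall>x z. Vector_Spaces.linear s (*) (\<lambda>y. f x y z)) \<and>
     (\<forall>x y. Vector_Spaces.linear s (*) (\<lambda>z. f x y z))"

definition cop3 :: "('h \<Rightarrow> ('h \<times> 'h) multiset) \<Rightarrow> 'h \<Rightarrow> ('h \<times> 'h \<times> 'h) multiset" where
  "cop3 \<Delta> a = (\<Sum>(a1, a') \<in># \<Delta> a. {#(a1, a2, a3). (a2, a3) \<in># \<Delta> a'#})"

definition cop4 :: "('h \<Rightarrow> ('h \<times> 'h) multiset) \<Rightarrow> 'h \<Rightarrow> ('h \<times> 'h \<times> 'h \<times> 'h) multiset" where
  "cop4 \<Delta> a = (\<Sum>(a1, a') \<in># \<Delta> a. {#(a1, a2, a3, a4). (a2, a3, a4) \<in># cop3 \<Delta> a'#})"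

definition bicoact :: "('o \<Rightarrow> ('h \<times> 'o) multiset) \<Rightarrow> ('o \<Rightarrow> ('o \<times> 'h) multiset)
    \<Rightarrow> 'o \<Rightarrow> ('h \<times> 'o \<times> 'h) multiset" where
  "bicoact \<Delta>L \<Delta>R \<tau> = (\<Sum>(t1, t') \<in># \<Delta>L \<tau>. {#(t1, t2, t3). (t2, t3) \<in># \<Delta>R t'#})"


locale coalgebra = vector_space scale
  for scale :: "'k::field \<Rightarrow> 'h::ab_group_add \<Rightarrow> 'h" +
  fixes comult :: "'h \<Rightarrow> ('h \<times> 'h) multiset" ("\<Delta>")
    and counit :: "'h \<Rightarrow> 'k" ("\<epsilon>")
  assumes comult_linear: "linear_to_tensor scale scale scale \<Delta>"
    and counit_linear: "Vector_Spaces.linear scale (*) \<epsilon>"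
    and coassoc: "tensor3_eq scale scale scale
          (\<Sum>(a', a3) \<in># \<Delta> a. {#(a1, a2, a3). (a1, a2) \<in># \<Delta> a'#})
          (\<Sum>(a1, a') \<in># \<Delta> a. {#(a1, a2, a3). (a2, a3) \<in># \<Delta> a'#})"
    and counit_left: "(\<Sum>(a1, a2) \<in># \<Delta> a. scale (\<epsilon> a1) a2) = a"
    and counit_right: "(\<Sum>(a1, a2) \<in># \<Delta> a. scale (\<epsilon> a2) a1) = a"

locale hopf_algebra = coalgebra scale comult counit
  for scale :: "'k::field \<Rightarrow> 'h::ring_1 \<Rightarrow> 'h"
    and comult :: "'h \<Rightarrow> ('h \<times> 'h) multiset" ("\<Delta>")
    and counit :: "'h \<Rightarrow> 'k" ("\<epsilon>") +
  fixes antipode :: "'h \<Rightarrow> 'h" ("S")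
  assumes mult_bilinear: "bilinear_map scale scale scale (*)"
    and comult_mult: "tensor_eq scale scale (\<Delta> (a * b))
          (\<Sum>(a1, a2) \<in># \<Delta> a. {#(a1 * b1, a2 * b2). (b1, b2) \<in># \<Delta> b#})"
    and comult_one: "tensor_eq scale scale (\<Delta> 1) {#(1, 1)#}"
    and counit_mult: "\<epsilon> (a * b) = \<epsilon> a * \<epsilon> b"
    and counit_one: "\<epsilon> 1 = 1"
    and antipode_linear: "Vector_Spaces.linear scale scale S"
    and antipode_left: "(\<Sum>(a1, a2) \<in># \<Delta> a. S a1 * a2) = scale (\<epsilon> a) 1"
    and antipode_right: "(\<Sum>(a1, a2) \<in># \<Delta> a. a1 * S a2) = scale (\<epsilon> a) 1"

locale bicomodule = coalgebra scaleH comult counit + Omega: vector_space scaleO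
  for scaleH :: "'k::field \<Rightarrow> 'h::ab_group_add \<Rightarrow> 'h"
    and comult :: "'h \<Rightarrow> ('h \<times> 'h) multiset" ("\<Delta>")
    and counit :: "'h \<Rightarrow> 'k" ("\<epsilon>")
    and scaleO :: "'k \<Rightarrow> 'o::ab_group_add \<Rightarrow> 'o" +
  fixes coactL :: "'o \<Rightarrow> ('h \<times> 'o) multiset" ("\<Delta>L")
    and coactR :: "'o \<Rightarrow> ('o \<times> 'h) multiset" ("\<Delta>R")
  assumes coactL_linear: "linear_to_tensor scaleO scaleH scaleO \<Delta>L"
    and coactR_linear: "linear_to_tensor scaleO scaleO scaleH \<Delta>R"
    and coactL_coassoc: "tensor3_eq scaleH scaleH scaleO
          (\<Sum>(h, t) \<in># \<Delta>L \<tau>. {#(h1, h2, t). (h1, h2) \<in># \<Delta> h#})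
          (\<Sum>(h1, t') \<in># \<Delta>L \<tau>. {#(h1, h2, t). (h2, t) \<in># \<Delta>L t'#})"
    and coactR_coassoc: "tensor3_eq scaleO scaleH scaleH
          (\<Sum>(t', h2) \<in># \<Delta>R \<tau>. {#(t, h1, h2). (t, h1) \<in># \<Delta>R t'#})
          (\<Sum>(t, h) \<in># \<Delta>R \<tau>. {#(t, h1, h2). (h1, h2) \<in># \<Delta> h#})"
    and coactL_counit: "(\<Sum>(h, t) \<in># \<Delta>L \<tau>. scaleO (\<epsilon> h) t) = \<tau>"
    and coactR_counit: "(\<Sum>(t, h) \<in># \<Delta>R \<tau>. scaleO (\<epsilon> h) t) = \<tau>"
    and coact_commute: "tensor3_eq scaleH scaleO scaleH
          (\<Sum>(h, t') \<in># \<Delta>L \<tau>. {#(h, t, g). (t, g) \<in># \<Delta>R t'#})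
          (\<Sum>(t', g) \<in># \<Delta>R \<tau>. {#(h, t, g). (h, t) \<in># \<Delta>L t'#})"

locale bicovariant_calculus =
  hopf_algebra scaleH comult counit antipode +
  bicomodule scaleH comult counit scaleO coactL coactR
  for scaleH :: "'k::field \<Rightarrow> 'h::ring_1 \<Rightarrow> 'h"
    and comult :: "'h \<Rightarrow> ('h \<times> 'h) multiset" ("\<Delta>")
    and counit :: "'h \<Rightarrow> 'k" ("\<epsilon>")
    and antipode :: "'h \<Rightarrow> 'h" ("S")
    and scaleO :: "'k \<Rightarrow> 'o::ab_group_add \<Rightarrow> 'o"
    and coactL :: "'o \<Rightarrow> ('h \<times> 'o) multiset" ("\<Delta>L")
    and coactR :: "'o \<Rightarrow> ('o \<times> 'h) multiset" ("\<Delta>R") +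
  fixes actL :: "'h \<Rightarrow> 'o \<Rightarrow> 'o" (infixr "\<rhd>" 75)
    and actR :: "'o \<Rightarrow> 'h \<Rightarrow> 'o" (infixl "\<lhd>" 75)
    and d :: "'h \<Rightarrow> 'o"
  assumes actL_bilinear: "bilinear_map scaleH scaleO scaleO (\<rhd>)"
    and actR_bilinear: "bilinear_map scaleO scaleH scaleO (\<lhd>)"
    and actL_mult: "(a * b) \<rhd> \<tau> = a \<rhd> (b \<rhd> \<tau>)"
    and actR_mult: "\<tau> \<lhd> (a * b) = (\<tau> \<lhd> a) \<lhd> b"
    and actL_one: "1 \<rhd> \<tau> = \<tau>"
    and actR_one: "\<tau> \<lhd> 1 = \<tau>"
    and act_commute: "a \<rhd> (\<tau> \<lhd> b) = (a \<rhd> \<tau>) \<lhd> b"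
    and coactL_actL: "tensor_eq scaleH scaleO (\<Delta>L (a \<rhd> \<tau>))
          (\<Sum>(a1, a2) \<in># \<Delta> a. {#(a1 * h, a2 \<rhd> t). (h, t) \<in># \<Delta>L \<tau>#})"
    and coactL_actR: "tensor_eq scaleH scaleO (\<Delta>L (\<tau> \<lhd> a))
          (\<Sum>(a1, a2) \<in># \<Delta> a. {#(h * a1, t \<lhd> a2). (h, t) \<in># \<Delta>L \<tau>#})"
    and coactR_actL: "tensor_eq scaleO scaleH (\<Delta>R (a \<rhd> \<tau>))
          (\<Sum>(a1, a2) \<in># \<Delta> a. {#(a1 \<rhd> t, a2 * h). (t, h) \<in># \<Delta>R \<tau>#})"
    and coactR_actR: "tensor_eq scaleO scaleH (\<Delta>R (\<tau> \<lhd> a))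
          (\<Sum>(a1, a2) \<in># \<Delta> a. {#(t \<lhd> a1, h * a2). (t, h) \<in># \<Delta>R \<tau>#})"
    and d_linear: "Vector_Spaces.linear scaleH scaleO d"
    and Leibniz: "d (a * b) = a \<rhd> d b + d a \<lhd> b"
    and span_d: "module.span scaleO {a \<rhd> d b | a b. True} = UNIV"
    and coactL_d: "tensor_eq scaleH scaleO (\<Delta>L (d a)) {#(a1, d a2). (a1, a2) \<in># \<Delta> a#}"
    and coactR_d: "tensor_eq scaleO scaleH (\<Delta>R (d a)) {#(d a1, a2). (a1, a2) \<in># \<Delta> a#}"


text \<open>
  \<open>two_cochain s \<Delta> \<epsilon> F F'\<close>: \<open>F\<close> is a 2-cochain and \<open>F'\<close> is its convolution inverse.  Only
  \<open>F(1 \<otimes> a) = \<epsilon>(a)\<close> is required; nothing is assumed about \<open>F(a \<otimes> 1)\<close>.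
\<close>
definition two_cochain ::
  "('k::field \<Rightarrow> 'h::ring_1 \<Rightarrow> 'h) \<Rightarrow> ('h \<Rightarrow> ('h \<times> 'h) multiset) \<Rightarrow> ('h \<Rightarrow> 'k)
    \<Rightarrow> ('h \<Rightarrow> 'h \<Rightarrow> 'k) \<Rightarrow> ('h \<Rightarrow> 'h \<Rightarrow> 'k) \<Rightarrow> bool" where
  "two_cochain s \<Delta> \<epsilon> F F' \<longleftrightarrow>
     bilinear_map s s (*) F \<and> bilinear_map s s (*) F' \<and>
     (\<forall>a b. (\<Sum>(a1, a2) \<in># \<Delta> a. \<Sum>(b1, b2) \<in># \<Delta> b. F a1 b1 * F' a2 b2) = \<epsilon> a * \<epsilon> b) \<and>
     (\<forall>a b. (\<Sum>(a1, a2) \<in># \<Delta> a. \<Sum>(b1, b2) \<in># \<Delta> b. F' a1 b1 * F a2 b2) = \<epsilon> a * \<epsilon> b) \<and>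
     (\<forall>a. F 1 a = \<epsilon> a)"

definition twist_mult ::
  "('k::field \<Rightarrow> 'h::ring_1 \<Rightarrow> 'h) \<Rightarrow> ('h \<Rightarrow> ('h \<times> 'h) multiset)
    \<Rightarrow> ('h \<Rightarrow> 'h \<Rightarrow> 'k) \<Rightarrow> ('h \<Rightarrow> 'h \<Rightarrow> 'k) \<Rightarrow> 'h \<Rightarrow> 'h \<Rightarrow> 'h" where
  "twist_mult s \<Delta> F F' a b =
     (\<Sum>(a1, a2, a3) \<in># cop3 \<Delta> a. \<Sum>(b1, b2, b3) \<in># cop3 \<Delta> b.
        s (F a1 b1 * F' a3 b3) (a2 * b2))"

definition twist_assoc ::
  "('h::ring_1 \<Rightarrow> ('h \<times> 'h) multiset) \<Rightarrow> ('h \<Rightarrow> 'h \<Rightarrow> 'k::field) \<Rightarrow> ('h \<Rightarrow> 'h \<Rightarrow> 'k)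
    \<Rightarrow> 'h \<Rightarrow> 'h \<Rightarrow> 'h \<Rightarrow> 'k" where
  "twist_assoc \<Delta> F F' a b c =
     (\<Sum>(a1, a2, a3) \<in># cop3 \<Delta> a. \<Sum>(b1, b2, b3, b4) \<in># cop4 \<Delta> b. \<Sum>(c1, c2, c3) \<in># cop3 \<Delta> c.
        F b1 c1 * F a1 (b2 * c2) * F' (a2 * b3) c3 * F' a3 b4)"

text \<open>The convolution inverse of \<open>twist_assoc \<Delta> F F'\<close>: the inverted factors in reverse order.\<close>
definition twist_assoc_inv ::
  "('h::ring_1 \<Rightarrow> ('h \<times> 'h) multiset) \<Rightarrow> ('h \<Rightarrow> 'h \<Rightarrow> 'k::field) \<Rightarrow> ('h \<Rightarrow> 'h \<Rightarrow> 'k)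
    \<Rightarrow> 'h \<Rightarrow> 'h \<Rightarrow> 'h \<Rightarrow> 'k" where
  "twist_assoc_inv \<Delta> F F' a b c =
     (\<Sum>(a1, a2, a3) \<in># cop3 \<Delta> a. \<Sum>(b1, b2, b3, b4) \<in># cop4 \<Delta> b. \<Sum>(c1, c2, c3) \<in># cop3 \<Delta> c.
        F a1 b1 * F (a2 * b2) c1 * F' a3 (b3 * c2) * F' b4 c3)"

definition twist_actL ::
  "('h \<Rightarrow> ('h \<times> 'h) multiset) \<Rightarrow> ('k::field \<Rightarrow> 'o::ab_group_add \<Rightarrow> 'o)
    \<Rightarrow> ('o \<Rightarrow> ('h \<times> 'o) multiset) \<Rightarrow> ('o \<Rightarrow> ('o \<times> 'h) multiset) \<Rightarrow> ('h \<Rightarrow> 'o \<Rightarrow> 'o)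
    \<Rightarrow> ('h \<Rightarrow> 'h \<Rightarrow> 'k) \<Rightarrow> ('h \<Rightarrow> 'h \<Rightarrow> 'k) \<Rightarrow> 'h \<Rightarrow> 'o \<Rightarrow> 'o" where
  "twist_actL \<Delta> s \<Delta>L \<Delta>R actL F F' a \<tau> =
     (\<Sum>(a1, a2, a3) \<in># cop3 \<Delta> a. \<Sum>(t1, t2, t3) \<in># bicoact \<Delta>L \<Delta>R \<tau>.
        s (F a1 t1 * F' a3 t3) (actL a2 t2))"

definition twist_actR ::
  "('h \<Rightarrow> ('h \<times> 'h) multiset) \<Rightarrow> ('k::field \<Rightarrow> 'o::ab_group_add \<Rightarrow> 'o)
    \<Rightarrow> ('o \<Rightarrow> ('h \<times> 'o) multiset) \<Rightarrow> ('o \<Rightarrow> ('o \<times> 'h) multiset) \<Rightarrow> ('o \<Rightarrow> 'h \<Rightarrow> 'o)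
    \<Rightarrow> ('h \<Rightarrow> 'h \<Rightarrow> 'k) \<Rightarrow> ('h \<Rightarrow> 'h \<Rightarrow> 'k) \<Rightarrow> 'o \<Rightarrow> 'h \<Rightarrow> 'o" where
  "twist_actR \<Delta> s \<Delta>L \<Delta>R actR F F' \<tau> a =
     (\<Sum>(t1, t2, t3) \<in># bicoact \<Delta>L \<Delta>R \<tau>. \<Sum>(a1, a2, a3) \<in># cop3 \<Delta> a.
        s (F t1 a1 * F' t3 a3) (actR t2 a2))"


text \<open>
  The part of the structure of a coquasi-Hopf algebra that involves neither unit nor antipode:
  the product is a coalgebra map, associative up to conjugation by the convolution invertible
  3-cocycle \<open>\<Phi>\<close>, with inverse \<open>\<Phi>'\<close>.  Unit and antipode axioms are left out: under the one-sided
  normalisation in \<open>two_cochain\<close>, \<open>1\<close> is in general only a left unit of \<open>H\<^sub>F\<close> and of \<open>\<Omega>\<close>,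
  and \<open>\<Phi>(a \<otimes> 1 \<otimes> c)\<close> need not be \<open>\<epsilon>(a)\<epsilon>(c)\<close>.
\<close>
locale coquasi_bialgebra = coalgebra scale comult counit
  for scale :: "'k::field \<Rightarrow> 'h::ab_group_add \<Rightarrow> 'h"
    and comult :: "'h \<Rightarrow> ('h \<times> 'h) multiset" ("\<Delta>")
    and counit :: "'h \<Rightarrow> 'k" ("\<epsilon>") +
  fixes prod :: "'h \<Rightarrow> 'h \<Rightarrow> 'h" (infixl "\<bullet>" 70)
    and \<Phi> :: "'h \<Rightarrow> 'h \<Rightarrow> 'h \<Rightarrow> 'k"
    and \<Phi>' :: "'h \<Rightarrow> 'h \<Rightarrow> 'h \<Rightarrow> 'k"
  assumes prod_bilinear: "bilinear_map scale scale scale (\<bullet>)"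
    and comult_prod: "tensor_eq scale scale (\<Delta> (a \<bullet> b))
          (\<Sum>(a1, a2) \<in># \<Delta> a. {#(a1 \<bullet> b1, a2 \<bullet> b2). (b1, b2) \<in># \<Delta> b#})"
    and counit_prod: "\<epsilon> (a \<bullet> b) = \<epsilon> a * \<epsilon> b"
    and assoc_trilinear: "trilinear_form scale \<Phi>"
    and assoc_inv_trilinear: "trilinear_form scale \<Phi>'"
    and assoc_right_inv:
      "(\<Sum>(a1, a2) \<in># \<Delta> a. \<Sum>(b1, b2) \<in># \<Delta> b. \<Sum>(c1, c2) \<in># \<Delta> c. \<Phi> a1 b1 c1 * \<Phi>' a2 b2 c2)
         = \<epsilon> a * \<epsilon> b * \<epsilon> c"
    and assoc_left_inv:
      "(\<Sum>(a1, a2) \<in># \<Delta> a. \<Sum>(b1, b2) \<in># \<Delta> b. \<Sum>(c1, c2) \<in># \<Delta> c. \<Phi>' a1 b1 c1 * \<Phi> a2 b2 c2)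
         = \<epsilon> a * \<epsilon> b * \<epsilon> c"
    and assoc_cocycle:
      "(\<Sum>(a1, a2) \<in># \<Delta> a. \<Sum>(b1, b2, b3) \<in># cop3 \<Delta> b.
        \<Sum>(c1, c2, c3) \<in># cop3 \<Delta> c. \<Sum>(e1, e2) \<in># \<Delta> e.
          \<Phi> b1 c1 e1 * \<Phi> a1 (b2 \<bullet> c2) e2 * \<Phi> a2 b3 c3) =
       (\<Sum>(a1, a2) \<in># \<Delta> a. \<Sum>(b1, b2) \<in># \<Delta> b. \<Sum>(c1, c2) \<in># \<Delta> c. \<Sum>(e1, e2) \<in># \<Delta> e.
          \<Phi> a1 b1 (c1 \<bullet> e1) * \<Phi> (a2 \<bullet> b2) c2 e2)"
    and quasi_assoc: "a \<bullet> (b \<bullet> c) =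
       (\<Sum>(a1, a2, a3) \<in># cop3 \<Delta> a. \<Sum>(b1, b2, b3) \<in># cop3 \<Delta> b. \<Sum>(c1, c2, c3) \<in># cop3 \<Delta> c.
          scale (\<Phi> a1 b1 c1 * \<Phi>' a3 b3 c3) ((a2 \<bullet> b2) \<bullet> c2))"

locale first_order_quasi_calculus =
  coquasi_bialgebra scaleH comult counit prod \<Phi> \<Phi>' +
  bicomodule scaleH comult counit scaleO coactL coactR
  for scaleH :: "'k::field \<Rightarrow> 'h::ab_group_add \<Rightarrow> 'h"
    and comult :: "'h \<Rightarrow> ('h \<times> 'h) multiset" ("\<Delta>")
    and counit :: "'h \<Rightarrow> 'k" ("\<epsilon>")
    and prod :: "'h \<Rightarrow> 'h \<Rightarrow> 'h" (infixl "\<bullet>" 70)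
    and \<Phi> :: "'h \<Rightarrow> 'h \<Rightarrow> 'h \<Rightarrow> 'k"
    and \<Phi>' :: "'h \<Rightarrow> 'h \<Rightarrow> 'h \<Rightarrow> 'k"
    and scaleO :: "'k \<Rightarrow> 'o::ab_group_add \<Rightarrow> 'o"
    and coactL :: "'o \<Rightarrow> ('h \<times> 'o) multiset" ("\<Delta>L")
    and coactR :: "'o \<Rightarrow> ('o \<times> 'h) multiset" ("\<Delta>R") +
  fixes actL :: "'h \<Rightarrow> 'o \<Rightarrow> 'o" (infixr "\<rhd>" 75)
    and actR :: "'o \<Rightarrow> 'h \<Rightarrow> 'o" (infixl "\<lhd>" 75)
    and d :: "'h \<Rightarrow> 'o"
  assumes actL_bilinear: "bilinear_map scaleH scaleO scaleO (\<rhd>)"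
    and actR_bilinear: "bilinear_map scaleO scaleH scaleO (\<lhd>)"
    and quasi_left: "a \<rhd> (b \<rhd> \<tau>) =
       (\<Sum>(a1, a2, a3) \<in># cop3 \<Delta> a. \<Sum>(b1, b2, b3) \<in># cop3 \<Delta> b.
        \<Sum>(t1, t2, t3) \<in># bicoact \<Delta>L \<Delta>R \<tau>.
          scaleO (\<Phi> a1 b1 t1 * \<Phi>' a3 b3 t3) ((a2 \<bullet> b2) \<rhd> t2))"
    and quasi_right: "\<tau> \<lhd> (b \<bullet> c) =
       (\<Sum>(t1, t2, t3) \<in># bicoact \<Delta>L \<Delta>R \<tau>. \<Sum>(b1, b2, b3) \<in># cop3 \<Delta> b.
        \<Sum>(c1, c2, c3) \<in># cop3 \<Delta> c.
          scaleO (\<Phi> t1 b1 c1 * \<Phi>' t3 b3 c3) ((t2 \<lhd> b2) \<lhd> c2))"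
    and quasi_middle: "a \<rhd> (\<tau> \<lhd> c) =
       (\<Sum>(a1, a2, a3) \<in># cop3 \<Delta> a. \<Sum>(t1, t2, t3) \<in># bicoact \<Delta>L \<Delta>R \<tau>.
        \<Sum>(c1, c2, c3) \<in># cop3 \<Delta> c.
          scaleO (\<Phi> a1 t1 c1 * \<Phi>' a3 t3 c3) ((a2 \<rhd> t2) \<lhd> c2))"
    and d_linear: "Vector_Spaces.linear scaleH scaleO d"
    and Leibniz: "d (a \<bullet> b) = a \<rhd> d b + d a \<lhd> b"
    and span_d: "module.span scaleO {a \<rhd> d b | a b. True} = UNIV"

end

theory Submission
  imports Defs
begin

text \<open>
  Linear forms on \<open>H \<otimes> \<dots> \<otimes> H\<close> constitute an algebra under convolution, and this algebra acts from
  both sides on the linear forms on \<open>M \<otimes> N \<otimes> P\<close> when \<open>M\<close>, \<open>N\<close>, \<open>P\<close> are \<open>H\<close>-bicomodules.  The whole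
  proof is computed in these convolution bimodules, on scalar valued functions: vectors are separated by
  linear functionals, and tensors by products of functionals (\<open>tensor_eqI_functionals\<close>).

  If \<open>\<mu>\<close> is a pairing compatible with the coactions, the twisted pairing is a conjugation:
  \<open>g (m \<bullet> n) = (F * (g \<circ> \<mu>) * F')(m, n)\<close> for every functional \<open>g\<close> (\<open>functional_twist_pairing\<close>).
  Iterating it, \<open>m \<bullet> (n \<bullet> p)\<close> is the conjugate of \<open>X = g (m n p)\<close> by \<open>F\<^sub>2\<^sub>3 * F\<^sub>1\<^sub>,\<^sub>2\<^sub>3\<close>, while
  \<open>(m \<bullet> n) \<bullet> p\<close> is the conjugate of the same \<open>X\<close> by \<open>F\<^sub>1\<^sub>2 * F\<^sub>1\<^sub>2\<^sub>,\<^sub>3\<close>, where \<open>F\<^sub>2\<^sub>3\<close> is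
  \<open>F(b, c)\<close> and \<open>F\<^sub>1\<^sub>,\<^sub>2\<^sub>3\<close> is \<open>F(a, b c)\<close> as a form in \<open>a, b, c\<close>, and so on.  Since \<open>\<Phi>\<close> is precisely the quotient
  \<open>(F\<^sub>2\<^sub>3 * F\<^sub>1\<^sub>,\<^sub>2\<^sub>3) * (F\<^sub>1\<^sub>2 * F\<^sub>1\<^sub>2\<^sub>,\<^sub>3)\<^sup>-\<^sup>1\<close>, conjugation by \<open>\<Phi>\<close> turns one into the other.  This is
  \<open>twist_pairing_quasi_assoc\<close>; stated for arbitrary bicomodules, it yields the associativity of \<open>H\<^sub>F\<close>
  and the three quasi-bimodule laws of \<open>\<Omega>\<^sup>1\<close> as four instances.

  The 3-cocycle identity is a telescoping product of such indexed factors in four arguments.  The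
  differential is a bicomodule map, so functionals of \<open>a \<bullet> d b\<close> and \<open>d a \<bullet> b\<close> are conjugates by \<open>F\<close>
  of those of \<open>a d b\<close> and \<open>(d a) b\<close>: summing them conjugates the ordinary Leibniz rule, and, as \<open>F\<close> is
  invertible, a functional vanishing on every \<open>a \<bullet> d b\<close> vanishes on every \<open>a d b\<close>, hence everywhere.
\<close>

section \<open>Linear functionals and tensors\<close>

definition forms :: "('k::field \<Rightarrow> 'v::ab_group_add \<Rightarrow> 'v) \<Rightarrow> ('v \<Rightarrow> 'k) set" where
  "forms s = {f. (\<forall>x y. f (x + y) = f x + f y) \<and> (\<forall>c x. f (s c x) = c * f x)}"

lemma vector_space_field: "vector_space ((*) :: 'k::field \<Rightarrow> 'k \<Rightarrow> 'k)"
  by unfold_locales (simp_all add: algebra_simps)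

lemma linear_functional_iff:
  "vector_space s \<Longrightarrow> Vector_Spaces.linear s (*) f \<longleftrightarrow> f \<in> forms s"
  by (simp add: Vector_Spaces.linear_iff forms_def vector_space_field)

text \<open>
  A basis of the span stays independent when \<open>v\<close> is added, so a functional may be prescribed on it.
\<close>

lemma functional_vanishing_on_span:
  assumes "vector_space s" "v \<notin> module.span s X"
  obtains f where "f \<in> forms s" "f v = 1" "\<And>x. x \<in> X \<Longrightarrow> f x = 0"
proof -
  interpret V: vector_space s by fact
  interpret VK: vector_space_pair s "(*)"
    by (intro vector_space_pair.intro assms vector_space_field)
  obtain B where B: "B \<subseteq> V.span X" "V.independent B" "V.span X \<subseteq> V.span B"
    using V.maximal_independent_subset by blast
  from B have eq: "V.span B = V.span X"
    by (metis V.span_eq V.span_span subset_antisym V.span_mono)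
  with assms B have "V.independent (insert v B)"
    by (simp add: V.independent_insert)
  then obtain g where g: "Vector_Spaces.linear s (*) g" "\<forall>x\<in>insert v B. g x = (if x = v then 1 else 0)"
    using VK.linear_independent_extend[of "insert v B" "\<lambda>x. if x = v then 1 else 0"] by blast
  from eq assms have vB: "v \<notin> B" using V.span_base by auto
  have "g x = 0" if "x \<in> X" for x
  proof -
    from that eq have "x \<in> V.span B" by (simp add: V.span_base)
    moreover have "\<And>b. b \<in> B \<Longrightarrow> g b = 0" using g(2) vB by auto
    ultimately show ?thesis using VK.linear_eq_0_on_span[OF g(1)] by blast
  qed
  with g show ?thesis using that[of g] linear_functional_iff[OF assms(1)] by simp
qed

lemma vector_eqI_functionals:
  assumes V: "vector_space s" and eq: "\<And>f. f \<in> forms s \<Longrightarrow> f x = f y"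
  shows "x = y"
proof (rule ccontr)
  interpret V: vector_space s by fact
  assume "x \<noteq> y"
  then have "x - y \<notin> V.span {}" by simp
  then obtain f where f: "f \<in> forms s" "f (x - y) = 1"
    using functional_vanishing_on_span[OF V] by metis
  from f(1) have "f (x - y + y) = f (x - y) + f y" unfolding forms_def by blast
  with f eq[OF f(1)] show False by simp
qed

lemma forms_scale: "f \<in> forms s \<Longrightarrow> f (s c x) = c * f x"
  and forms_add: "f \<in> forms s \<Longrightarrow> f (x + y) = f x + f y"
  by (simp_all add: forms_def)

lemma forms_zero: "f \<in> forms s \<Longrightarrow> f 0 = 0"
  by (metis forms_add add_0 add_right_cancel)

lemma forms_sum_mset:
  assumes "f \<in> forms s" shows "f (\<Sum>x\<in>#M. g x) = (\<Sum>x\<in>#M. f (g x))"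
  using assms by (induction M) (simp_all add: forms_zero forms_add)

text \<open>
  Bilinearity of a twisted pairing is obtained from this criterion, since twisted pairings are known
  through their composites with functionals.
\<close>

lemma linearI_functionals:
  assumes "vector_space s" "vector_space t" "\<And>f. f \<in> forms t \<Longrightarrow> (\<lambda>x. f (g x)) \<in> forms s"
  shows "Vector_Spaces.linear s t g"
proof -
  have "g (x + y) = g x + g y" for x y
    using assms(3) by (intro vector_eqI_functionals[OF assms(2)]) (simp add: forms_def)
  moreover have "g (s c x) = t c (g x)" for c x
    using assms(3) by (intro vector_eqI_functionals[OF assms(2)]) (simp add: forms_def)
  ultimately show ?thesis using assms by (simp add: Vector_Spaces.linear_iff)
qed

lemma linear_functional_comp:
  "Vector_Spaces.linear s t g \<Longrightarrow> f \<in> forms t \<Longrightarrow> (\<lambda>x. f (g x)) \<in> forms s"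
  by (simp add: Vector_Spaces.linear_iff forms_def)

text \<open>
  For \<open>A\<close>, \<open>B\<close> the linear forms on two vector spaces these are the bilinear forms on their product.
  Nesting to the right gives the multilinear forms, so statements about pairs cover every arity.
\<close>

definition pair_forms :: "('a \<Rightarrow> 'k) set \<Rightarrow> ('b \<Rightarrow> 'k) set \<Rightarrow> ('a \<times> 'b \<Rightarrow> 'k) set"
    (infixr "\<boxtimes>" 70) where
  "A \<boxtimes> B = {f. (\<forall>y. (\<lambda>x. f (x, y)) \<in> A) \<and> (\<forall>x. (\<lambda>y. f (x, y)) \<in> B)}"

lemma pair_forms_iff:
  "f \<in> A \<boxtimes> B \<longleftrightarrow> (\<forall>y. (\<lambda>x. f (x, y)) \<in> A) \<and> (\<forall>x. (\<lambda>y. f (x, y)) \<in> B)"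
  by (simp add: pair_forms_def)

lemma bilinear_map_functional:
  assumes "bilinear_map sA sB sC \<mu>" "g \<in> forms sC"
  shows "(\<lambda>(a, b). g (\<mu> a b)) \<in> forms sA \<boxtimes> forms sB"
  using assms(1) by (auto simp: bilinear_map_def pair_forms_iff intro!: linear_functional_comp[OF _ assms(2)])

lemma tensor_eq_imp_sum_eq:
  assumes "tensor_eq sA sB M N" "T \<in> forms sA \<boxtimes> forms sB"
  shows "(\<Sum>z\<in>#M. T z) = (\<Sum>z\<in>#N. T z)"
proof -
  have T: "T (0, y) = 0" "T (x + x', y) = T (x, y) + T (x', y)"
     "T (x, y + y') = T (x, y) + T (x, y')" "T (sA c x, y) = c * T (x, y)"
     "T (x, sB c y) = c * T (x, y)" for x x' y y' c
    using assms(2) forms_zero[of "\<lambda>x. T (x, y)" sA] by (simp_all add: pair_forms_iff forms_def)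
  show ?thesis using assms(1)
    by (induction rule: tensor_eq.induct) (simp_all add: T)
qed

lemma tensor3_eq_imp_sum_eq:
  assumes "tensor3_eq sA sB sC M N" "T \<in> forms sA \<boxtimes> forms sB \<boxtimes> forms sC"
  shows "(\<Sum>z\<in>#M. T z) = (\<Sum>z\<in>#N. T z)"
proof -
  have T: "T (0, y, z) = 0" "T (x + x', y, z) = T (x, y, z) + T (x', y, z)"
     "T (x, y + y', z) = T (x, y, z) + T (x, y', z)"
     "T (x, y, z + z') = T (x, y, z) + T (x, y, z')" "T (sA c x, y, z) = c * T (x, y, z)"
     "T (x, sB c y, z) = c * T (x, y, z)" "T (x, y, sC c z) = c * T (x, y, z)"
     for x x' y y' z z' c
    using assms(2) forms_zero[of "\<lambda>x. T (x, y, z)" sA]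
    by (simp_all add: pair_forms_iff forms_def)
  show ?thesis using assms(1)
    by (induction rule: tensor3_eq.induct) (simp_all add: T)
qed

lemma tensor_eq_sum:
  assumes "finite S"
  shows "tensor_eq sA sB {#(\<Sum>b\<in>S. g b, y)#} (\<Sum>b\<in>S. {#(g b, y)#})"
  using assms
proof (induction S)
  case empty show ?case by (simp add: tensor_eq.zero)
next
  case (insert b S)
  have "tensor_eq sA sB {#(g b + sum g S, y)#} ({#(g b, y)#} + {#(sum g S, y)#})"
    using tensor_eq.add_left[of sA sB "g b" "sum g S" y] by (simp add: add_mset_commute)
  moreover have "tensor_eq sA sB ({#(g b, y)#} + {#(sum g S, y)#})
      ({#(g b, y)#} + (\<Sum>b\<in>S. {#(g b, y)#}))"
    by (intro tensor_eq.plus tensor_eq.refl insert.IH)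
  ultimately have "tensor_eq sA sB {#(g b + sum g S, y)#} ({#(g b, y)#} + (\<Sum>b\<in>S. {#(g b, y)#}))"
    by (rule tensor_eq.trans)
  then show ?case using insert.hyps by simp
qed

lemma tensor_eq_sum_cong:
  assumes "finite S" "\<And>b. b \<in> S \<Longrightarrow> tensor_eq sA sB (f b) (g b)"
  shows "tensor_eq sA sB (\<Sum>b\<in>S. f b) (\<Sum>b\<in>S. g b)"
  using assms by (induction S) (auto intro: tensor_eq.refl tensor_eq.plus)

lemma tensor_eq_zero_right:
  assumes "vector_space sA" "vector_space sB"
  shows "tensor_eq sA sB {#(x, 0)#} {#}"
proof -
  interpret A: vector_space sA by fact
  interpret B: vector_space sB by fact
  have "tensor_eq sA sB {#(sA 0 x, 0)#} {#(x, sB 0 0)#}" by (rule tensor_eq.balanced)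
  then have "tensor_eq sA sB {#(0, 0)#} {#(x, 0)#}" by simp
  then show ?thesis by (blast intro: tensor_eq.sym tensor_eq.trans tensor_eq.zero)
qed

text \<open>
  Expanding the first tensor factor in a basis brings every formal sum to the normal form
  \<open>\<Sum>\<^sub>b b \<otimes> y\<^sub>b\<close>.  Its coefficients \<open>y\<^sub>b\<close> are read off by a coordinate functional on the left and an
  arbitrary functional on the right, so products of functionals already separate tensors.
\<close>

lemma tensor_eqI_functionals:
  fixes sA :: "'k::field \<Rightarrow> 'a::ab_group_add \<Rightarrow> 'a" and sB :: "'k \<Rightarrow> 'b::ab_group_add \<Rightarrow> 'b"
  assumes A: "vector_space sA" and B: "vector_space sB"
    and eq: "\<And>f g. f \<in> forms sA \<Longrightarrow> g \<in> forms sB \<Longrightarrow>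
      (\<Sum>(x, y)\<in>#M. f x * g y) = (\<Sum>(x, y)\<in>#N. f x * g y)"
  shows "tensor_eq sA sB M N"
proof -
  note [trans] = tensor_eq.trans
  interpret A: vector_space sA by fact
  interpret B: vector_space sB by fact
  obtain E where E: "A.independent E" "A.span E = UNIV"
    using A.maximal_independent_subset[of UNIV] by (metis top.extremum_uniqueI)
  define co where "co b x = A.representation E x b" for b x
  have co: "co b \<in> forms sA" for b
    using A.linear_representation[OF E, of b]
    by (simp add: linear_functional_iff[OF A] co_def[abs_def])
  define supp where "supp M = (\<Union>(x, y)\<in>set_mset M. {b. co b x \<noteq> 0})" for M :: "('a \<times> 'b) multiset"
  define y where "y M b = (\<Sum>(x, z)\<in>#M. sB (co b x) z)" for M b
  have finsupp: "finite (supp P)" for P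
    unfolding supp_def co_def by (auto intro: A.finite_representation)
  have expand: "x = (\<Sum>b\<in>S. sA (co b x) b)" if "finite S" "{b. co b x \<noteq> 0} \<subseteq> S" for x S
  proof -
    have "(\<Sum>b\<in>S. sA (co b x) b) = (\<Sum>b\<in>{b. co b x \<noteq> 0}. sA (co b x) b)"
      using that by (intro sum.mono_neutral_right) auto
    also have "\<dots> = x"
      using A.sum_nonzero_representation_eq[OF E(1), of x] E(2) by (simp add: co_def)
    finally show ?thesis by simp
  qed
  have nf: "tensor_eq sA sB P (\<Sum>b\<in>S. {#(b, y P b)#})" if "finite S" "supp P \<subseteq> S" for P S
    using that
  proof (induction P)
    case empty
    have "tensor_eq sA sB (\<Sum>b\<in>S. {#(b, y {#} b)#}) (\<Sum>b\<in>S. {#})"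
      using empty by (intro tensor_eq_sum_cong) (simp_all add: y_def tensor_eq_zero_right[OF A B])
    then show ?case by (simp add: tensor_eq.sym)
  next
    case (add p P)
    obtain x z where p: "p = (x, z)" by force
    have sub: "{b. co b x \<noteq> 0} \<subseteq> S" "supp P \<subseteq> S"
      using add.prems by (auto simp: supp_def p)
    have "tensor_eq sA sB {#(x, z)#} (\<Sum>b\<in>S. {#(sA (co b x) b, z)#})"
      using tensor_eq_sum[OF add.prems(1), of sA sB "\<lambda>b. sA (co b x) b" z]
        expand[OF add.prems(1) sub(1)] by simp
    also have "tensor_eq sA sB \<dots> (\<Sum>b\<in>S. {#(b, sB (co b x) z)#})"
      using add.prems(1) by (intro tensor_eq_sum_cong tensor_eq.balanced)
    finally have "tensor_eq sA sB ({#p#} + P)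
        ((\<Sum>b\<in>S. {#(b, sB (co b x) z)#}) + (\<Sum>b\<in>S. {#(b, y P b)#}))"
      unfolding p by (intro tensor_eq.plus add.IH add.prems sub)
    also have "tensor_eq sA sB \<dots> (\<Sum>b\<in>S. {#(b, y (add_mset p P) b)#})"
      unfolding sum.distrib[symmetric]
    proof (intro tensor_eq_sum_cong add.prems)
      fix b
      show "tensor_eq sA sB ({#(b, sB (co b x) z)#} + {#(b, y P b)#}) {#(b, y (add_mset p P) b)#}"
        using tensor_eq.sym[OF tensor_eq.add_right[of sA sB b "sB (co b x) z" "y P b"]]
        by (simp add: y_def p add_mset_commute)
    qed
    finally show ?case by simp
  qed
  have "y M b = y N b" for b
  proof (rule vector_eqI_functionals[OF B])
    fix g assume g: "g \<in> forms sB"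
    have "g (y P b) = (\<Sum>(x, z)\<in>#P. co b x * g z)" for P
      unfolding y_def forms_sum_mset[OF g] using forms_scale[OF g] by (simp add: case_prod_unfold)
    then show "g (y M b) = g (y N b)" using eq[OF co g] by simp
  qed
  then have "tensor_eq sA sB M (\<Sum>b\<in>supp M \<union> supp N. {#(b, y N b)#})"
    using nf[of "supp M \<union> supp N" M] finsupp by simp
  moreover have "tensor_eq sA sB N (\<Sum>b\<in>supp M \<union> supp N. {#(b, y N b)#})"
    using nf[of "supp M \<union> supp N" N] finsupp by simp
  ultimately show ?thesis by (blast intro: tensor_eq.sym tensor_eq.trans)
qed

section \<open>Coactions and convolution of forms\<close>

definition form_space :: "('a \<Rightarrow> 'k::field) set \<Rightarrow> bool" where
  "form_space A \<longleftrightarrow> (\<lambda>x. 0) \<in> A \<and> (\<forall>f\<in>A. \<forall>g\<in>A. (\<lambda>x. f x + g x) \<in> A) \<and>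
     (\<forall>c. \<forall>f\<in>A. (\<lambda>x. c * f x) \<in> A)"

lemma form_space_forms: "form_space (forms s)"
  by (auto simp: form_space_def forms_def algebra_simps)

lemma form_space_pair: "form_space A \<Longrightarrow> form_space B \<Longrightarrow> form_space (A \<boxtimes> B)"
  by (simp add: form_space_def pair_forms_iff)

lemma form_space_scale:
  "form_space A \<Longrightarrow> f \<in> A \<Longrightarrow> (\<lambda>x. c * f x) \<in> A"
  "form_space A \<Longrightarrow> f \<in> A \<Longrightarrow> (\<lambda>x. f x * c) \<in> A"
  by (simp_all add: form_space_def mult.commute)

lemma form_space_sum:
  assumes "form_space A" "\<And>z. (\<lambda>x. T z x) \<in> A"
  shows "(\<lambda>x. \<Sum>z\<in>#M. T z x) \<in> A"
  using assms by (induction M) (simp_all add: form_space_def)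

lemma form_space_sum_pairs:
  assumes "form_space A" "\<And>y z. (\<lambda>x. T y z x) \<in> A"
  shows "(\<lambda>x. \<Sum>(y, z)\<in>#M. T y z x) \<in> A"
  using form_space_sum[of A "\<lambda>p x. T (fst p) (snd p) x" M] assms by (simp add: case_prod_unfold)

lemma sum_mset_swap_pairs:
  "(\<Sum>(a, b)\<in>#M. \<Sum>(c, d)\<in>#N. f a b c d) = (\<Sum>(c, d)\<in>#N. \<Sum>(a, b)\<in>#M. f a b c d)"
  using sum_mset.swap[of "\<lambda>p q. f (fst p) (snd p) (fst q) (snd q)" N M]
  by (simp add: case_prod_unfold)

lemma sum_mset_Union:
  "(\<Sum>z\<in>#(\<Sum>x\<in>#M. f x). T z) = (\<Sum>x\<in>#M. \<Sum>z\<in>#f x. T z)"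
  by (induction M) simp_all

text \<open>
  A coalgebra \<open>(\<delta>, e)\<close> and a bicomodule \<open>(L, R)\<close> over it, known only through the forms \<open>A\<close> on the
  coalgebra and \<open>B\<close> on the bicomodule.  The axioms are the bicomodule axioms, evaluated by
  multilinear forms.  No linear structure on the points is mentioned, so the points may be tuples that
  stand for pure tensors; this is what makes the notion stable under products.
\<close>

locale form_bicomodule =
  fixes A :: "('c \<Rightarrow> 'k::field) set" and \<delta> :: "'c \<Rightarrow> ('c \<times> 'c) multiset" and e :: "'c \<Rightarrow> 'k"
    and B :: "('m \<Rightarrow> 'k) set"
    and L :: "'m \<Rightarrow> ('c \<times> 'm) multiset" and R :: "'m \<Rightarrow> ('m \<times> 'c) multiset"
  assumes A_space: "form_space A" and B_space: "form_space B" and counit_form: "e \<in> A"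
    and coactL_form: "T \<in> A \<boxtimes> B \<Longrightarrow> (\<lambda>m. \<Sum>z\<in>#L m. T z) \<in> B"
    and coactR_form: "T' \<in> B \<boxtimes> A \<Longrightarrow> (\<lambda>m. \<Sum>z\<in>#R m. T' z) \<in> B"
    and coassocL: "T3 \<in> A \<boxtimes> A \<boxtimes> B \<Longrightarrow>
      (\<Sum>(c, m')\<in>#L m. \<Sum>(c1, c2)\<in>#\<delta> c. T3 (c1, c2, m')) =
      (\<Sum>(c1, m')\<in>#L m. \<Sum>(c2, m'')\<in>#L m'. T3 (c1, c2, m''))"
    and coassocR: "T4 \<in> B \<boxtimes> A \<boxtimes> A \<Longrightarrow>
      (\<Sum>(m', c2)\<in>#R m. \<Sum>(m'', c1)\<in>#R m'. T4 (m'', c1, c2)) =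
      (\<Sum>(m', c)\<in>#R m. \<Sum>(c1, c2)\<in>#\<delta> c. T4 (m', c1, c2))"
    and coact_commute: "T5 \<in> A \<boxtimes> B \<boxtimes> A \<Longrightarrow>
      (\<Sum>(c, m')\<in>#L m. \<Sum>(m'', c')\<in>#R m'. T5 (c, m'', c')) =
      (\<Sum>(m', c')\<in>#R m. \<Sum>(c, m'')\<in>#L m'. T5 (c, m'', c'))"
    and counitL: "\<phi> \<in> B \<Longrightarrow> (\<Sum>(c, m')\<in>#L m. e c * \<phi> m') = \<phi> m"
    and counitR: "\<phi> \<in> B \<Longrightarrow> (\<Sum>(m', c)\<in>#R m. \<phi> m' * e c) = \<phi> m"

definition prod_coact :: "('m \<Rightarrow> ('a \<times> 'b) multiset) \<Rightarrow> ('n \<Rightarrow> ('c \<times> 'd) multiset)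
    \<Rightarrow> 'm \<times> 'n \<Rightarrow> (('a \<times> 'c) \<times> ('b \<times> 'd)) multiset" where
  "prod_coact D D' = (\<lambda>(m, n). \<Sum>(a, b)\<in>#D m. {#((a, c), (b, d)). (c, d)\<in>#D' n#})"

definition tens :: "('a \<Rightarrow> 'k::times) \<Rightarrow> ('b \<Rightarrow> 'k) \<Rightarrow> 'a \<times> 'b \<Rightarrow> 'k" where
  "tens f g = (\<lambda>(x, y). f x * g y)"

lemma sum_prod_coact:
  "(\<Sum>z\<in>#prod_coact D D' (m, n). T z) =
   (\<Sum>(a, b)\<in>#D m. \<Sum>(c, d)\<in>#D' n. T ((a, c), (b, d)))"
  by (simp add: prod_coact_def sum_mset_Union case_prod_unfold multiset.map_comp o_def)

lemma sum_prod_coact_pairs: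
  "(\<Sum>(x, y)\<in>#prod_coact D D' (m, n). T x y) =
   (\<Sum>(a, b)\<in>#D m. \<Sum>(c, d)\<in>#D' n. T (a, c) (b, d))"
  using sum_prod_coact[of "\<lambda>(x, y). T x y" D D' m n] by simp

text \<open>
  Tensor products of coalgebras and of bicomodules.  Each axiom follows from the same axiom for both
  factors: summing over the second factor first leaves a multilinear form in the first.
\<close>

lemma form_bicomodule_prod:
  assumes M: "form_bicomodule A \<delta> e B L R" and N: "form_bicomodule A' \<delta>' e' B' L' R'"
  shows "form_bicomodule (A \<boxtimes> A') (prod_coact \<delta> \<delta>') (tens e e') (B \<boxtimes> B')
    (prod_coact L L') (prod_coact R R')"
proof
  interpret M: form_bicomodule A \<delta> e B L R by fact
  interpret N: form_bicomodule A' \<delta>' e' B' L' R' by fact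
  note sums = form_space_sum_pairs[OF M.A_space] form_space_sum_pairs[OF M.B_space]
    form_space_sum_pairs[OF N.A_space] form_space_sum_pairs[OF N.B_space]
  show "form_space (A \<boxtimes> A')" "form_space (B \<boxtimes> B')"
    by (intro form_space_pair M.A_space M.B_space N.A_space N.B_space)+
  show "tens e e' \<in> A \<boxtimes> A'"
    by (simp add: pair_forms_iff tens_def form_space_scale M.A_space N.A_space
        M.counit_form N.counit_form)
  show "(\<lambda>p. \<Sum>z\<in>#prod_coact L L' p. T z) \<in> B \<boxtimes> B'" if T: "T \<in> (A \<boxtimes> A') \<boxtimes> B \<boxtimes> B'" for T
  proof -
    have "(\<lambda>m. \<Sum>(c, m')\<in>#L m. \<Sum>(c', n')\<in>#L' n. T ((c, c'), (m', n'))) \<in> B" for n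
      using M.coactL_form[of "\<lambda>(c, m'). \<Sum>(c', n')\<in>#L' n. T ((c, c'), (m', n'))"] T
      by (simp add: pair_forms_iff sums)
    moreover have "(\<lambda>n. \<Sum>(c, m')\<in>#L m. \<Sum>(c', n')\<in>#L' n. T ((c, c'), (m', n'))) \<in> B'" for m
      using N.coactL_form[of "\<lambda>(c', n'). T ((_, c'), (_, n'))"] T
      by (intro sums) (simp add: pair_forms_iff)
    ultimately show ?thesis by (simp add: pair_forms_iff sum_prod_coact)
  qed
  show "(\<lambda>p. \<Sum>z\<in>#prod_coact R R' p. T z) \<in> B \<boxtimes> B'" if T: "T \<in> (B \<boxtimes> B') \<boxtimes> A \<boxtimes> A'" for T
  proof -
    have "(\<lambda>m. \<Sum>(m', c)\<in>#R m. \<Sum>(n', c')\<in>#R' n. T ((m', n'), (c, c'))) \<in> B" for n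
      using M.coactR_form[of "\<lambda>(m', c). \<Sum>(n', c')\<in>#R' n. T ((m', n'), (c, c'))"] T
      by (simp add: pair_forms_iff sums)
    moreover have "(\<lambda>n. \<Sum>(m', c)\<in>#R m. \<Sum>(n', c')\<in>#R' n. T ((m', n'), (c, c'))) \<in> B'" for m
      using N.coactR_form[of "\<lambda>(n', c'). T ((_, n'), (_, c'))"] T
      by (intro sums) (simp add: pair_forms_iff)
    ultimately show ?thesis by (simp add: pair_forms_iff sum_prod_coact)
  qed
  show "(\<Sum>(c, m')\<in>#prod_coact L L' p. \<Sum>(c1, c2)\<in>#prod_coact \<delta> \<delta>' c. T (c1, c2, m')) =
      (\<Sum>(c1, m')\<in>#prod_coact L L' p. \<Sum>(c2, m'')\<in>#prod_coact L L' m'. T (c1, c2, m''))"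
    if T: "T \<in> (A \<boxtimes> A') \<boxtimes> (A \<boxtimes> A') \<boxtimes> B \<boxtimes> B'" for T p
  proof -
    obtain m n where p: "p = (m, n)" by force
    define U where "U = (\<lambda>(c1, c2, m'). \<Sum>(c', n')\<in>#L' n. \<Sum>(c1', c2')\<in>#\<delta>' c'.
      T ((c1, c1'), (c2, c2'), (m', n')))"
    have U: "U \<in> A \<boxtimes> A \<boxtimes> B"
      using T by (simp add: U_def pair_forms_iff sums)
    have U_eq: "U (c1, c2, m') = (\<Sum>(c1', n')\<in>#L' n. \<Sum>(c2', n'')\<in>#L' n'.
      T ((c1, c1'), (c2, c2'), (m', n'')))" for c1 c2 m'
      using N.coassocL[of "\<lambda>(c1', c2', n'). T ((c1, c1'), (c2, c2'), (m', n'))" n] T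
      by (simp add: U_def pair_forms_iff)
    have "(\<Sum>(c, m')\<in>#prod_coact L L' p. \<Sum>(c1, c2)\<in>#prod_coact \<delta> \<delta>' c. T (c1, c2, m')) =
      (\<Sum>(c, m')\<in>#L m. \<Sum>(c', n')\<in>#L' n. \<Sum>(c1, c2)\<in>#\<delta> c. \<Sum>(c1', c2')\<in>#\<delta>' c'.
        T ((c1, c1'), (c2, c2'), (m', n')))"
      by (simp add: p sum_prod_coact_pairs)
    also have "\<dots> = (\<Sum>(c, m')\<in>#L m. \<Sum>(c1, c2)\<in>#\<delta> c. U (c1, c2, m'))"
      by (subst sum_mset_swap_pairs) (simp add: U_def)
    also have "\<dots> = (\<Sum>(c1, m')\<in>#L m. \<Sum>(c2, m'')\<in>#L m'. U (c1, c2, m''))"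
      by (rule M.coassocL[OF U])
    also have "\<dots> = (\<Sum>(c1, m')\<in>#L m. \<Sum>(c1', n')\<in>#L' n. \<Sum>(c2, m'')\<in>#L m'. \<Sum>(c2', n'')\<in>#L' n'.
        T ((c1, c1'), (c2, c2'), (m'', n'')))"
      by (subst sum_mset_swap_pairs) (simp add: U_eq)
    also have "\<dots> = (\<Sum>(c1, m')\<in>#prod_coact L L' p. \<Sum>(c2, m'')\<in>#prod_coact L L' m'. T (c1, c2, m''))"
      by (simp add: p sum_prod_coact_pairs)
    finally show ?thesis .
  qed
  show "(\<Sum>(m', c2)\<in>#prod_coact R R' p. \<Sum>(m'', c1)\<in>#prod_coact R R' m'. T (m'', c1, c2)) =
      (\<Sum>(m', c)\<in>#prod_coact R R' p. \<Sum>(c1, c2)\<in>#prod_coact \<delta> \<delta>' c. T (m', c1, c2))"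
    if T: "T \<in> (B \<boxtimes> B') \<boxtimes> (A \<boxtimes> A') \<boxtimes> A \<boxtimes> A'" for T p
  proof -
    obtain m n where p: "p = (m, n)" by force
    define U where "U = (\<lambda>(m', c1, c2). \<Sum>(n', c')\<in>#R' n. \<Sum>(c1', c2')\<in>#\<delta>' c'.
      T ((m', n'), (c1, c1'), (c2, c2')))"
    have U: "U \<in> B \<boxtimes> A \<boxtimes> A"
      using T by (simp add: U_def pair_forms_iff sums)
    have U_eq: "U (m', c1, c2) = (\<Sum>(n', c2')\<in>#R' n. \<Sum>(n'', c1')\<in>#R' n'.
      T ((m', n''), (c1, c1'), (c2, c2')))" for c1 c2 m'
      using N.coassocR[of "\<lambda>(n', c1', c2'). T ((m', n'), (c1, c1'), (c2, c2'))" n] T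
      by (simp add: U_def pair_forms_iff)
    have "(\<Sum>(m', c2)\<in>#prod_coact R R' p. \<Sum>(m'', c1)\<in>#prod_coact R R' m'. T (m'', c1, c2)) =
      (\<Sum>(m', c2)\<in>#R m. \<Sum>(n', c2')\<in>#R' n. \<Sum>(m'', c1)\<in>#R m'. \<Sum>(n'', c1')\<in>#R' n'.
        T ((m'', n''), (c1, c1'), (c2, c2')))"
      by (simp add: p sum_prod_coact_pairs)
    also have "\<dots> = (\<Sum>(m', c2)\<in>#R m. \<Sum>(m'', c1)\<in>#R m'. U (m'', c1, c2))"
      by (subst sum_mset_swap_pairs) (simp add: U_eq)
    also have "\<dots> = (\<Sum>(m', c)\<in>#R m. \<Sum>(c1, c2)\<in>#\<delta> c. U (m', c1, c2))"
      by (rule M.coassocR[OF U])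
    also have "\<dots> = (\<Sum>(m', c)\<in>#R m. \<Sum>(n', c')\<in>#R' n. \<Sum>(c1, c2)\<in>#\<delta> c. \<Sum>(c1', c2')\<in>#\<delta>' c'.
        T ((m', n'), (c1, c1'), (c2, c2')))"
      by (subst sum_mset_swap_pairs) (simp add: U_def)
    also have "\<dots> = (\<Sum>(m', c)\<in>#prod_coact R R' p. \<Sum>(c1, c2)\<in>#prod_coact \<delta> \<delta>' c. T (m', c1, c2))"
      by (simp add: p sum_prod_coact_pairs)
    finally show ?thesis .
  qed
  show "(\<Sum>(c, m')\<in>#prod_coact L L' p. \<Sum>(m'', c')\<in>#prod_coact R R' m'. T (c, m'', c')) =
      (\<Sum>(m', c')\<in>#prod_coact R R' p. \<Sum>(c, m'')\<in>#prod_coact L L' m'. T (c, m'', c'))"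
    if T: "T \<in> (A \<boxtimes> A') \<boxtimes> (B \<boxtimes> B') \<boxtimes> A \<boxtimes> A'" for T p
  proof -
    obtain m n where p: "p = (m, n)" by force
    define U where "U = (\<lambda>(c, m', c'). \<Sum>(b, n')\<in>#L' n. \<Sum>(n'', b')\<in>#R' n'.
      T ((c, b), (m', n''), (c', b')))"
    have U: "U \<in> A \<boxtimes> B \<boxtimes> A"
      using T by (simp add: U_def pair_forms_iff sums)
    have U_eq: "U (c, m', c') = (\<Sum>(n', b')\<in>#R' n. \<Sum>(b, n'')\<in>#L' n'.
      T ((c, b), (m', n''), (c', b')))" for c m' c'
      using N.coact_commute[of "\<lambda>(b, n', b'). T ((c, b), (m', n'), (c', b'))" n] T
      by (simp add: U_def pair_forms_iff)
    have "(\<Sum>(c, m')\<in>#prod_coact L L' p. \<Sum>(m'', c')\<in>#prod_coact R R' m'. T (c, m'', c')) =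
      (\<Sum>(c, m')\<in>#L m. \<Sum>(b, n')\<in>#L' n. \<Sum>(m'', c')\<in>#R m'. \<Sum>(n'', b')\<in>#R' n'.
        T ((c, b), (m'', n''), (c', b')))"
      by (simp add: p sum_prod_coact_pairs)
    also have "\<dots> = (\<Sum>(c, m')\<in>#L m. \<Sum>(m'', c')\<in>#R m'. U (c, m'', c'))"
      by (subst sum_mset_swap_pairs) (simp add: U_def)
    also have "\<dots> = (\<Sum>(m', c')\<in>#R m. \<Sum>(c, m'')\<in>#L m'. U (c, m'', c'))"
      by (rule M.coact_commute[OF U])
    also have "\<dots> = (\<Sum>(m', c')\<in>#R m. \<Sum>(n', b')\<in>#R' n. \<Sum>(c, m'')\<in>#L m'. \<Sum>(b, n'')\<in>#L' n'.
        T ((c, b), (m'', n''), (c', b')))"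
      by (subst sum_mset_swap_pairs) (simp add: U_eq)
    also have "\<dots> = (\<Sum>(m', c')\<in>#prod_coact R R' p. \<Sum>(c, m'')\<in>#prod_coact L L' m'. T (c, m'', c'))"
      by (simp add: p sum_prod_coact_pairs)
    finally show ?thesis .
  qed
  show "(\<Sum>(c, m')\<in>#prod_coact L L' p. tens e e' c * \<phi> m') = \<phi> p" if \<phi>: "\<phi> \<in> B \<boxtimes> B'" for \<phi> p
  proof -
    obtain m n where p: "p = (m, n)" by force
    have "(\<Sum>(c, m')\<in>#prod_coact L L' p. tens e e' c * \<phi> m') =
      (\<Sum>(c, m')\<in>#L m. e c * (\<Sum>(c', n')\<in>#L' n. e' c' * \<phi> (m', n')))"
      by (simp only: p sum_prod_coact_pairs)
        (simp add: tens_def sum_mset_distrib_left case_prod_unfold mult.assoc)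
    also have "\<dots> = \<phi> p"
      using \<phi> N.counitL[of "\<lambda>n. \<phi> (_, n)" n] M.counitL[of "\<lambda>m. \<phi> (m, n)" m]
      by (simp add: p pair_forms_iff)
    finally show ?thesis .
  qed
  show "(\<Sum>(m', c)\<in>#prod_coact R R' p. \<phi> m' * tens e e' c) = \<phi> p" if \<phi>: "\<phi> \<in> B \<boxtimes> B'" for \<phi> p
  proof -
    obtain m n where p: "p = (m, n)" by force
    have "(\<Sum>(m', c)\<in>#prod_coact R R' p. \<phi> m' * tens e e' c) =
      (\<Sum>(m', c)\<in>#R m. (\<Sum>(n', c')\<in>#R' n. \<phi> (m', n') * e' c') * e c)"
      by (simp only: p sum_prod_coact_pairs)
        (simp add: tens_def sum_mset_distrib_left case_prod_unfold ac_simps)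
    also have "\<dots> = \<phi> p"
      using \<phi> N.counitR[of "\<lambda>n. \<phi> (_, n)" n] M.counitR[of "\<lambda>m. \<phi> (m, n)" m]
      by (simp add: p pair_forms_iff)
    finally show ?thesis .
  qed
qed

text \<open>
  With a comultiplication for \<open>D\<close> this is the convolution product of forms; with a left or right
  coaction it is the action of the convolution algebra on the forms of the bicomodule.
\<close>

definition conv :: "('x \<Rightarrow> ('y \<times> 'z) multiset) \<Rightarrow> ('y \<Rightarrow> 'k::field) \<Rightarrow> ('z \<Rightarrow> 'k) \<Rightarrow> 'x \<Rightarrow> 'k" where
  "conv D f g x = (\<Sum>(y, z)\<in>#D x. f y * g z)"

lemma conv_scale: "conv D g (\<lambda>x. c * k x) x = c * conv D g k x"
  "conv D g (\<lambda>x. k x * c) x = conv D g k x * c"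
  by (simp_all add: conv_def sum_mset_distrib_left sum_mset_distrib_right case_prod_unfold ac_simps)

lemma conv_add: "conv D g (\<lambda>x. k x + l x) x = conv D g k x + conv D g l x"
  "conv D (\<lambda>x. k x + l x) g x = conv D k g x + conv D l g x"
  by (simp_all add: conv_def case_prod_unfold distrib_left distrib_right sum_mset.distrib)

lemma tens_form: "form_space A \<Longrightarrow> form_space B \<Longrightarrow> f \<in> A \<Longrightarrow> g \<in> B \<Longrightarrow> tens f g \<in> A \<boxtimes> B"
  by (simp add: pair_forms_iff tens_def form_space_scale)

context form_bicomodule
begin

lemma convL_form: "f \<in> A \<Longrightarrow> \<phi> \<in> B \<Longrightarrow> conv L f \<phi> \<in> B"
  using coactL_form[OF tens_form[OF A_space B_space]]
  by (simp add: conv_def[abs_def] tens_def)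

lemma convR_form: "f \<in> A \<Longrightarrow> \<phi> \<in> B \<Longrightarrow> conv R \<phi> f \<in> B"
  using coactR_form[OF tens_form[OF B_space A_space]]
  by (simp add: conv_def[abs_def] tens_def)

lemma convL_assoc:
  assumes "f \<in> A" "g \<in> A" "\<phi> \<in> B"
  shows "conv L (conv \<delta> f g) \<phi> = conv L f (conv L g \<phi>)"
proof
  fix m
  have "tens f (tens g \<phi>) \<in> A \<boxtimes> A \<boxtimes> B"
    by (intro tens_form form_space_pair A_space B_space assms)
  from coassocL[OF this, of m] show "conv L (conv \<delta> f g) \<phi> m = conv L f (conv L g \<phi>) m"
    by (simp add: conv_def tens_def sum_mset_distrib_left sum_mset_distrib_right
        case_prod_unfold mult.assoc)
qed

lemma convR_assoc:
  assumes "f \<in> A" "g \<in> A" "\<phi> \<in> B"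
  shows "conv R (conv R \<phi> f) g = conv R \<phi> (conv \<delta> f g)"
proof
  fix m
  have "tens \<phi> (tens f g) \<in> B \<boxtimes> A \<boxtimes> A"
    by (intro tens_form form_space_pair A_space B_space assms)
  from coassocR[OF this, of m] show "conv R (conv R \<phi> f) g m = conv R \<phi> (conv \<delta> f g) m"
    by (simp add: conv_def tens_def sum_mset_distrib_left sum_mset_distrib_right
        case_prod_unfold mult.assoc)
qed

lemma convL_convR:
  assumes "f \<in> A" "g \<in> A" "\<phi> \<in> B"
  shows "conv R (conv L f \<phi>) g = conv L f (conv R \<phi> g)"
proof
  fix m
  have "tens f (tens \<phi> g) \<in> A \<boxtimes> B \<boxtimes> A"
    by (intro tens_form form_space_pair A_space B_space assms)
  from coact_commute[OF this, of m] show "conv R (conv L f \<phi>) g m = conv L f (conv R \<phi> g) m"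
    by (simp add: conv_def tens_def sum_mset_distrib_left sum_mset_distrib_right
        case_prod_unfold mult.assoc)
qed

lemma convL_counit: "\<phi> \<in> B \<Longrightarrow> conv L e \<phi> = \<phi>"
  by (rule ext) (simp add: conv_def counitL)

lemma convR_counit: "\<phi> \<in> B \<Longrightarrow> conv R \<phi> e = \<phi>"
  by (rule ext) (simp add: conv_def counitR)

end

lemma bicomodule_imp_form_bicomodule:
  assumes "bicomodule sH \<Delta> \<epsilon> sM L R"
  shows "form_bicomodule (forms sH) \<Delta> \<epsilon> (forms sM) L R"
proof -
  interpret bicomodule sH \<Delta> \<epsilon> sM L R by fact
  have L: "linear_to_tensor sM sH sM L" by (rule coactL_linear)
  have R: "linear_to_tensor sM sM sH R" by (rule coactR_linear)
  show ?thesis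
  proof
    show "\<epsilon> \<in> forms sH" using counit_linear linear_functional_iff[OF vector_space_axioms] by blast
    show "(\<lambda>m. \<Sum>z\<in>#L m. T z) \<in> forms sM" if T: "T \<in> forms sH \<boxtimes> forms sM" for T
    proof -
      have sc: "T (sH c x, y) = c * T (x, y)" for c x y
        using T by (simp add: pair_forms_iff forms_def)
      have "(\<Sum>z\<in>#L (v + w). T z) = (\<Sum>z\<in>#L v. T z) + (\<Sum>z\<in>#L w. T z)" for v w
        using L[unfolded linear_to_tensor_def] tensor_eq_imp_sum_eq[OF _ T, of "L (v + w)" "L v + L w"]
        by simp
      moreover have "(\<Sum>z\<in>#L (sM c v). T z) = c * (\<Sum>z\<in>#L v. T z)" for c v
        using tensor_eq_imp_sum_eq[OF L[unfolded linear_to_tensor_def, THEN conjunct2, rule_format] T]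
        by (simp add: sum_mset_distrib_left case_prod_unfold multiset.map_comp o_def sc)
      ultimately show ?thesis by (simp add: forms_def)
    qed
    show "(\<lambda>m. \<Sum>z\<in>#R m. T z) \<in> forms sM" if T: "T \<in> forms sM \<boxtimes> forms sH" for T
    proof -
      have sc: "T (sM c x, y) = c * T (x, y)" for c x y
        using T by (simp add: pair_forms_iff forms_def)
      have "(\<Sum>z\<in>#R (v + w). T z) = (\<Sum>z\<in>#R v. T z) + (\<Sum>z\<in>#R w. T z)" for v w
        using R[unfolded linear_to_tensor_def] tensor_eq_imp_sum_eq[OF _ T, of "R (v + w)" "R v + R w"]
        by simp
      moreover have "(\<Sum>z\<in>#R (sM c v). T z) = c * (\<Sum>z\<in>#R v. T z)" for c v
        using tensor_eq_imp_sum_eq[OF R[unfolded linear_to_tensor_def, THEN conjunct2, rule_format] T]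
        by (simp add: sum_mset_distrib_left case_prod_unfold multiset.map_comp o_def sc)
      ultimately show ?thesis by (simp add: forms_def)
    qed
    show "(\<Sum>(c, m')\<in>#L m. \<Sum>(c1, c2)\<in>#\<Delta> c. T (c1, c2, m')) =
      (\<Sum>(c1, m')\<in>#L m. \<Sum>(c2, m'')\<in>#L m'. T (c1, c2, m''))"
      if T: "T \<in> forms sH \<boxtimes> forms sH \<boxtimes> forms sM" for T m
      using tensor3_eq_imp_sum_eq[OF coactL_coassoc T, of m]
      by (simp add: sum_mset_Union case_prod_unfold multiset.map_comp o_def)
    show "(\<Sum>(m', c2)\<in>#R m. \<Sum>(m'', c1)\<in>#R m'. T (m'', c1, c2)) =
      (\<Sum>(m', c)\<in>#R m. \<Sum>(c1, c2)\<in>#\<Delta> c. T (m', c1, c2))"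
      if T: "T \<in> forms sM \<boxtimes> forms sH \<boxtimes> forms sH" for T m
      using tensor3_eq_imp_sum_eq[OF coactR_coassoc T, of m]
      by (simp add: sum_mset_Union case_prod_unfold multiset.map_comp o_def)
    show "(\<Sum>(c, m')\<in>#L m. \<Sum>(m'', c')\<in>#R m'. T (c, m'', c')) =
      (\<Sum>(m', c')\<in>#R m. \<Sum>(c, m'')\<in>#L m'. T (c, m'', c'))"
      if T: "T \<in> forms sH \<boxtimes> forms sM \<boxtimes> forms sH" for T m
      using tensor3_eq_imp_sum_eq[OF coact_commute T, of m]
      by (simp add: sum_mset_Union case_prod_unfold multiset.map_comp o_def)
    show "(\<Sum>(c, m')\<in>#L m. \<epsilon> c * \<phi> m') = \<phi> m" if "\<phi> \<in> forms sM" for \<phi> m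
      using arg_cong[OF coactL_counit[of m], of \<phi>]
      by (simp add: forms_sum_mset[OF that] forms_scale[OF that] case_prod_unfold)
    show "(\<Sum>(m', c)\<in>#R m. \<phi> m' * \<epsilon> c) = \<phi> m" if "\<phi> \<in> forms sM" for \<phi> m
      using arg_cong[OF coactR_counit[of m], of \<phi>]
      by (simp add: forms_sum_mset[OF that] forms_scale[OF that] case_prod_unfold mult.commute)
  qed (rule form_space_forms)+
qed

lemma bicomodule_self:
  assumes "coalgebra sH \<Delta> \<epsilon>"
  shows "bicomodule sH \<Delta> \<epsilon> sH \<Delta> \<Delta>"
proof -
  interpret coalgebra sH \<Delta> \<epsilon> by fact
  show ?thesis
    by unfold_locales
      (rule comult_linear coassoc counit_left counit_right tensor3_eq.sym[OF coassoc])+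
qed

section \<open>Pulling back convolutions\<close>

text \<open>
  \<open>h\<close> plays the part of a coalgebra map and \<open>u\<close> that of a map of bicomodules along \<open>h\<close>, both expressed
  through their effect on forms.  The two examples of interest are a pairing of bicomodules, with the
  multiplication of \<open>H\<close> for \<open>h\<close>, and the differential, with the identity for \<open>h\<close>.
\<close>

definition form_map where
  "form_map A B L R h u A' B' L' R' \<longleftrightarrow>
     (\<forall>f\<in>A'. (\<lambda>c. f (h c)) \<in> A) \<and> (\<forall>\<phi>\<in>B'. (\<lambda>m. \<phi> (u m)) \<in> B) \<and>
     (\<forall>T\<in>A' \<boxtimes> B'. \<forall>m. (\<Sum>z\<in>#L' (u m). T z) = (\<Sum>(c, m')\<in>#L m. T (h c, u m'))) \<and>
     (\<forall>T\<in>B' \<boxtimes> A'. \<forall>m. (\<Sum>z\<in>#R' (u m). T z) = (\<Sum>(m', c)\<in>#R m. T (u m', h c)))"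

lemma form_mapD:
  assumes "form_map A B L R h u A' B' L' R'"
  shows "f \<in> A' \<Longrightarrow> (\<lambda>c. f (h c)) \<in> A"
    and "\<phi> \<in> B' \<Longrightarrow> (\<lambda>m. \<phi> (u m)) \<in> B"
    and "T \<in> A' \<boxtimes> B' \<Longrightarrow> (\<Sum>z\<in>#L' (u m). T z) = (\<Sum>(c, m')\<in>#L m. T (h c, u m'))"
    and "T' \<in> B' \<boxtimes> A' \<Longrightarrow> (\<Sum>z\<in>#R' (u m). T' z) = (\<Sum>(m', c)\<in>#R m. T' (u m', h c))"
  using assms unfolding form_map_def by blast+

lemma conv_form_map:
  assumes "form_map A B L R h u A' B' L' R'" "form_space A'" "form_space B'" "f \<in> A'" "\<phi> \<in> B'"
  shows "conv L' f \<phi> (u m) = conv L (\<lambda>c. f (h c)) (\<lambda>m. \<phi> (u m)) m"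
    and "conv R' \<phi> f (u m) = conv R (\<lambda>m. \<phi> (u m)) (\<lambda>c. f (h c)) m"
  using form_mapD(3)[OF assms(1) tens_form[OF assms(2,3,4,5)], of m]
    form_mapD(4)[OF assms(1) tens_form[OF assms(3,2,5,4)], of m]
  by (simp_all add: conv_def tens_def)

lemma form_map_second:
  assumes "form_map A B L R h u A' B' L' R'"
  shows "form_map (C \<boxtimes> A) (D \<boxtimes> B) (prod_coact K L) (prod_coact J R)
    (\<lambda>(x, y). (x, h y)) (\<lambda>(x, y). (x, u y))
    (C \<boxtimes> A') (D \<boxtimes> B') (prod_coact K L') (prod_coact J R')"
proof -
  have "(\<Sum>(c', n')\<in>#L' (u n). T ((c, c'), m', n')) = (\<Sum>(c', n')\<in>#L n. T ((c, h c'), m', u n'))"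
    if "T \<in> (C \<boxtimes> A') \<boxtimes> D \<boxtimes> B'" for T c m' n
    using form_mapD(3)[OF assms, of "\<lambda>(c', n'). T ((c, c'), m', n')" n] that
    by (simp add: pair_forms_iff)
  moreover have "(\<Sum>(n', c')\<in>#R' (u n). T ((m', n'), c, c')) = (\<Sum>(n', c')\<in>#R n. T ((m', u n'), c, h c'))"
    if "T \<in> (D \<boxtimes> B') \<boxtimes> C \<boxtimes> A'" for T c m' n
    using form_mapD(4)[OF assms, of "\<lambda>(n', c'). T ((m', n'), c, c')" n] that
    by (simp add: pair_forms_iff)
  moreover have "(\<lambda>(x, y). f (x, h y)) \<in> C \<boxtimes> A" if "f \<in> C \<boxtimes> A'" for f
    using form_mapD(1)[OF assms, of "\<lambda>y. f (_, y)"] that by (simp add: pair_forms_iff)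
  moreover have "(\<lambda>(x, y). f (x, u y)) \<in> D \<boxtimes> B" if "f \<in> D \<boxtimes> B'" for f
    using form_mapD(2)[OF assms, of "\<lambda>y. f (_, y)"] that by (simp add: pair_forms_iff)
  ultimately show ?thesis
    unfolding form_map_def by (simp add: sum_prod_coact sum_prod_coact_pairs case_prod_unfold)
qed

lemma form_map_first:
  assumes map: "form_map A B L R h u A' B' L' R'" and spaces: "form_space A'" "form_space B'"
  shows "form_map (A \<boxtimes> C) (B \<boxtimes> D) (prod_coact L K) (prod_coact R J)
    (\<lambda>(x, z). (h x, z)) (\<lambda>(x, z). (u x, z))
    (A' \<boxtimes> C) (B' \<boxtimes> D) (prod_coact L' K) (prod_coact R' J)"
proof -
  note sums = form_space_sum_pairs[OF spaces(1)] form_space_sum_pairs[OF spaces(2)]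
  have "(\<Sum>(c, m')\<in>#L' (u m). \<Sum>(d, p')\<in>#K p. T ((c, d), m', p')) =
      (\<Sum>(c, m')\<in>#L m. \<Sum>(d, p')\<in>#K p. T ((h c, d), u m', p'))"
    if T: "T \<in> (A' \<boxtimes> C) \<boxtimes> B' \<boxtimes> D" for T m p
    using form_mapD(3)[OF map, of "\<lambda>(c, m'). \<Sum>(d, p')\<in>#K p. T ((c, d), m', p')" m] T
    by (simp add: pair_forms_iff sums)
  moreover have "(\<Sum>(m', c)\<in>#R' (u m). \<Sum>(p', d)\<in>#J p. T ((m', p'), c, d)) =
      (\<Sum>(m', c)\<in>#R m. \<Sum>(p', d)\<in>#J p. T ((u m', p'), h c, d))"
    if T: "T \<in> (B' \<boxtimes> D) \<boxtimes> A' \<boxtimes> C" for T m p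
    using form_mapD(4)[OF map, of "\<lambda>(m', c). \<Sum>(p', d)\<in>#J p. T ((m', p'), c, d)" m] T
    by (simp add: pair_forms_iff sums)
  moreover have "(\<lambda>(x, z). f (h x, z)) \<in> A \<boxtimes> C" if "f \<in> A' \<boxtimes> C" for f
    using form_mapD(1)[OF map, of "\<lambda>y. f (y, _)"] that by (simp add: pair_forms_iff)
  moreover have "(\<lambda>(x, z). f (u x, z)) \<in> B \<boxtimes> D" if "f \<in> B' \<boxtimes> D" for f
    using form_mapD(2)[OF map, of "\<lambda>y. f (y, _)"] that by (simp add: pair_forms_iff)
  ultimately show ?thesis
    unfolding form_map_def
    by (simp add: sum_prod_coact sum_prod_coact_pairs split_paired_all case_prod_unfold)
qed

lemma form_map_leading_pair:
  assumes map: "form_map (A \<boxtimes> A2) (B \<boxtimes> B2) (prod_coact L L2) (prod_coact R R2) h u A' B' L' R'"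
    and spaces: "form_space A'" "form_space B'"
  shows "form_map (A \<boxtimes> A2 \<boxtimes> C) (B \<boxtimes> B2 \<boxtimes> D)
    (prod_coact L (prod_coact L2 K)) (prod_coact R (prod_coact R2 J))
    (\<lambda>(x, y, z). (h (x, y), z)) (\<lambda>(x, y, z). (u (x, y), z))
    (A' \<boxtimes> C) (B' \<boxtimes> D) (prod_coact L' K) (prod_coact R' J)"
proof -
  note sums = form_space_sum_pairs[OF spaces(1)] form_space_sum_pairs[OF spaces(2)]
  have "(\<Sum>(c, m')\<in>#L' (u (m, n)). \<Sum>(d, p')\<in>#K p. T ((c, d), m', p')) =
      (\<Sum>(c, m')\<in>#L m. \<Sum>(c', n')\<in>#L2 n. \<Sum>(d, p')\<in>#K p. T ((h (c, c'), d), u (m', n'), p'))"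
    if T: "T \<in> (A' \<boxtimes> C) \<boxtimes> B' \<boxtimes> D" for T m n p
    using form_mapD(3)[OF map, of "\<lambda>(c, m'). \<Sum>(d, p')\<in>#K p. T ((c, d), m', p')" "(m, n)"] T
    by (simp add: sum_prod_coact_pairs pair_forms_iff sums)
  moreover have "(\<Sum>(m', c)\<in>#R' (u (m, n)). \<Sum>(p', d)\<in>#J p. T ((m', p'), c, d)) =
      (\<Sum>(m', c)\<in>#R m. \<Sum>(n', c')\<in>#R2 n. \<Sum>(p', d)\<in>#J p. T ((u (m', n'), p'), h (c, c'), d))"
    if T: "T \<in> (B' \<boxtimes> D) \<boxtimes> A' \<boxtimes> C" for T m n p
    using form_mapD(4)[OF map, of "\<lambda>(m', c). \<Sum>(p', d)\<in>#J p. T ((m', p'), c, d)" "(m, n)"] T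
    by (simp add: sum_prod_coact_pairs pair_forms_iff sums)
  moreover have "(\<lambda>(x, y, z). f (h (x, y), z)) \<in> A \<boxtimes> A2 \<boxtimes> C" if "f \<in> A' \<boxtimes> C" for f
    using form_mapD(1)[OF map, of "\<lambda>y. f (y, _)"] that by (simp add: pair_forms_iff)
  moreover have "(\<lambda>(x, y, z). f (u (x, y), z)) \<in> B \<boxtimes> B2 \<boxtimes> D" if "f \<in> B' \<boxtimes> D" for f
    using form_mapD(2)[OF map, of "\<lambda>y. f (y, _)"] that by (simp add: pair_forms_iff)
  ultimately show ?thesis
    unfolding form_map_def
    by (simp add: sum_prod_coact sum_prod_coact_pairs split_paired_all case_prod_unfold)
qed

context form_bicomodule
begin

text \<open>
  Arguments on which a factor is the counit drop out of the convolution.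
\<close>

lemma conv_counit_first:
  assumes "\<And>n. (\<lambda>m. \<phi> (m, n)) \<in> B"
  shows "conv (prod_coact L K) (tens e f) \<phi> (m, n) = conv K f (\<lambda>n. \<phi> (m, n)) n"
    and "conv (prod_coact R J) \<phi> (tens e f) (m, n) = conv J (\<lambda>n. \<phi> (m, n)) f n"
proof -
  have "conv (prod_coact L K) (tens e f) \<phi> (m, n) =
    (\<Sum>(c', n')\<in>#K n. \<Sum>(c, m')\<in>#L m. e c * f c' * \<phi> (m', n'))"
    unfolding conv_def sum_prod_coact_pairs by (subst sum_mset_swap_pairs) (simp add: tens_def)
  also have "\<dots> = (\<Sum>(c', n')\<in>#K n. f c' * (\<Sum>(c, m')\<in>#L m. e c * \<phi> (m', n')))"
    by (simp add: sum_mset_distrib_left case_prod_unfold ac_simps)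
  finally show "conv (prod_coact L K) (tens e f) \<phi> (m, n) = conv K f (\<lambda>n. \<phi> (m, n)) n"
    by (simp add: counitL[OF assms] conv_def)
  have "conv (prod_coact R J) \<phi> (tens e f) (m, n) =
    (\<Sum>(n', c')\<in>#J n. \<Sum>(m', c)\<in>#R m. \<phi> (m', n') * (e c * f c'))"
    unfolding conv_def sum_prod_coact_pairs by (subst sum_mset_swap_pairs) (simp add: tens_def)
  also have "\<dots> = (\<Sum>(n', c')\<in>#J n. (\<Sum>(m', c)\<in>#R m. \<phi> (m', n') * e c) * f c')"
    by (simp add: sum_mset_distrib_left case_prod_unfold ac_simps)
  finally show "conv (prod_coact R J) \<phi> (tens e f) (m, n) = conv J (\<lambda>n. \<phi> (m, n)) f n"
    by (simp add: counitR[OF assms] conv_def)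
qed

lemma conv_counit_last:
  assumes "\<And>x y. (\<lambda>m. \<phi> (x, y, m)) \<in> B"
  shows "conv (prod_coact K (prod_coact K' L)) (\<lambda>(a, b, c). f (a, b) * e c) \<phi> (x, y, m) =
      conv (prod_coact K K') f (\<lambda>(x, y). \<phi> (x, y, m)) (x, y)"
    and "conv (prod_coact J (prod_coact J' R)) \<phi> (\<lambda>(a, b, c). f (a, b) * e c) (x, y, m) =
      conv (prod_coact J J') (\<lambda>(x, y). \<phi> (x, y, m)) f (x, y)"
proof -
  have "conv (prod_coact K (prod_coact K' L)) (\<lambda>(a, b, c). f (a, b) * e c) \<phi> (x, y, m) =
    (\<Sum>(a, x')\<in>#K x. \<Sum>(b, y')\<in>#K' y. f (a, b) * (\<Sum>(c, m')\<in>#L m. e c * \<phi> (x', y', m')))"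
    unfolding conv_def sum_prod_coact_pairs
    by (simp add: sum_mset_distrib_left case_prod_unfold mult.assoc)
  then show "conv (prod_coact K (prod_coact K' L)) (\<lambda>(a, b, c). f (a, b) * e c) \<phi> (x, y, m) =
      conv (prod_coact K K') f (\<lambda>(x, y). \<phi> (x, y, m)) (x, y)"
    by (simp add: counitL[OF assms] conv_def sum_prod_coact_pairs)
  have "conv (prod_coact J (prod_coact J' R)) \<phi> (\<lambda>(a, b, c). f (a, b) * e c) (x, y, m) =
    (\<Sum>(x', a)\<in>#J x. \<Sum>(y', b)\<in>#J' y. (\<Sum>(m', c)\<in>#R m. \<phi> (x', y', m') * e c) * f (a, b))"
    unfolding conv_def sum_prod_coact_pairs
    by (simp add: sum_mset_distrib_left case_prod_unfold ac_simps)
  then show "conv (prod_coact J (prod_coact J' R)) \<phi> (\<lambda>(a, b, c). f (a, b) * e c) (x, y, m) =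
      conv (prod_coact J J') (\<lambda>(x, y). \<phi> (x, y, m)) f (x, y)"
    by (simp add: counitR[OF assms] conv_def sum_prod_coact_pairs)
qed

end

section \<open>Twisted pairings\<close>

lemma sum_bicoact:
  "(\<Sum>(t1, t2, t3)\<in>#bicoact L R m. T t1 t2 t3) =
   (\<Sum>(t1, m')\<in>#L m. \<Sum>(t2, t3)\<in>#R m'. T t1 t2 t3)"
  by (simp add: bicoact_def sum_mset_Union case_prod_unfold multiset.map_comp o_def)

lemma cop3_eq_bicoact: "cop3 \<Delta> = bicoact \<Delta> \<Delta>"
  by (simp add: cop3_def[abs_def] bicoact_def[abs_def])

lemma sum_cop3: "(\<Sum>(a1, a2, a3)\<in>#cop3 D a. T a1 a2 a3) =
   (\<Sum>(a1, a')\<in>#D a. \<Sum>(a2, a3)\<in>#D a'. T a1 a2 a3)"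
  by (simp add: cop3_eq_bicoact sum_bicoact)

lemma sum_cop4: "(\<Sum>(a1, a2, a3, a4)\<in>#cop4 D a. T a1 a2 a3 a4) =
   (\<Sum>(a1, a')\<in>#D a. \<Sum>(a2, a'')\<in>#D a'. \<Sum>(a3, a4)\<in>#D a''. T a1 a2 a3 a4)"
proof -
  have "(\<Sum>(a1, a2, a3, a4)\<in>#cop4 D a. T a1 a2 a3 a4) =
      (\<Sum>(a1, a')\<in>#D a. \<Sum>(a2, a3, a4)\<in>#cop3 D a'. T a1 a2 a3 a4)"
    by (simp add: cop4_def sum_mset_Union case_prod_unfold multiset.map_comp o_def)
  then show ?thesis by (simp add: sum_cop3)
qed

text \<open>
  Convolution in several arguments interleaves the sums over their coproducts.  Giving the coproducts of
  different arguments different names directs the exchange of neighbouring sums, so that rewriting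
  sorts the sums by argument.
\<close>

lemma sum_reorder_assoc:
  "(\<Sum>(b1, b')\<in>#D2 b. \<Sum>(c1, c')\<in>#D3 c. \<Sum>(a1, a')\<in>#D1 a.
      \<Sum>(b2, b'')\<in>#D2 b'. \<Sum>(c2, c3)\<in>#D3 c'. \<Sum>(a2, a3)\<in>#D1 a'. \<Sum>(b3, b4)\<in>#D2 b''.
        T a1 a2 a3 b1 b2 b3 b4 c1 c2 c3) =
   (\<Sum>(a1, a')\<in>#D1 a. \<Sum>(a2, a3)\<in>#D1 a'. \<Sum>(b1, b')\<in>#D2 b.
      \<Sum>(b2, b'')\<in>#D2 b'. \<Sum>(b3, b4)\<in>#D2 b''. \<Sum>(c1, c')\<in>#D3 c. \<Sum>(c2, c3)\<in>#D3 c'.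
        T a1 a2 a3 b1 b2 b3 b4 c1 c2 c3)"
  by (simp only: sum_mset_swap_pairs[where M = "D2 _" and N = "D1 _"]
      sum_mset_swap_pairs[where M = "D3 _" and N = "D1 _"]
      sum_mset_swap_pairs[where M = "D3 _" and N = "D2 _"])

lemma sum_reorder_assoc_inv:
  "(\<Sum>(a1, a')\<in>#D1 a. \<Sum>(b1, b')\<in>#D2 b. \<Sum>(a2, a3)\<in>#D1 a'. \<Sum>(b2, b'')\<in>#D2 b'.
      \<Sum>(c1, c')\<in>#D3 c. \<Sum>(b3, b4)\<in>#D2 b''. \<Sum>(c2, c3)\<in>#D3 c'.
        T a1 a2 a3 b1 b2 b3 b4 c1 c2 c3) =
   (\<Sum>(a1, a')\<in>#D1 a. \<Sum>(a2, a3)\<in>#D1 a'. \<Sum>(b1, b')\<in>#D2 b.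
      \<Sum>(b2, b'')\<in>#D2 b'. \<Sum>(b3, b4)\<in>#D2 b''. \<Sum>(c1, c')\<in>#D3 c. \<Sum>(c2, c3)\<in>#D3 c'.
        T a1 a2 a3 b1 b2 b3 b4 c1 c2 c3)"
  by (simp only: sum_mset_swap_pairs[where M = "D2 _" and N = "D1 _"]
      sum_mset_swap_pairs[where M = "D3 _" and N = "D1 _"]
      sum_mset_swap_pairs[where M = "D3 _" and N = "D2 _"])

lemma sum_reorder_cocycle:
  "(\<Sum>(b1, b')\<in>#D2 b. \<Sum>(c1, c')\<in>#D3 c. \<Sum>(d1, d2)\<in>#D4 d. \<Sum>(a1, a2)\<in>#D1 a.
      \<Sum>(b2, b3)\<in>#D2 b'. \<Sum>(c2, c3)\<in>#D3 c'. T a1 a2 b1 b2 b3 c1 c2 c3 d1 d2) =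
   (\<Sum>(a1, a2)\<in>#D1 a. \<Sum>(b1, b')\<in>#D2 b. \<Sum>(b2, b3)\<in>#D2 b'.
      \<Sum>(c1, c')\<in>#D3 c. \<Sum>(c2, c3)\<in>#D3 c'. \<Sum>(d1, d2)\<in>#D4 d. T a1 a2 b1 b2 b3 c1 c2 c3 d1 d2)"
  by (simp only: sum_mset_swap_pairs[where M = "D2 _" and N = "D1 _"]
      sum_mset_swap_pairs[where M = "D3 _" and N = "D1 _"]
      sum_mset_swap_pairs[where M = "D4 _" and N = "D1 _"]
      sum_mset_swap_pairs[where M = "D3 _" and N = "D2 _"]
      sum_mset_swap_pairs[where M = "D4 _" and N = "D2 _"]
      sum_mset_swap_pairs[where M = "D4 _" and N = "D3 _"])

text \<open>
  The common form of \<open>twist_mult\<close>, \<open>twist_actL\<close> and \<open>twist_actR\<close>, which differ only in the bicomodules.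
\<close>

definition twist_pairing ::
  "('k::field \<Rightarrow> 'v::ab_group_add \<Rightarrow> 'v)
    \<Rightarrow> ('m \<Rightarrow> ('h \<times> 'm) multiset) \<Rightarrow> ('m \<Rightarrow> ('m \<times> 'h) multiset)
    \<Rightarrow> ('n \<Rightarrow> ('h \<times> 'n) multiset) \<Rightarrow> ('n \<Rightarrow> ('n \<times> 'h) multiset)
    \<Rightarrow> ('h \<Rightarrow> 'h \<Rightarrow> 'k) \<Rightarrow> ('h \<Rightarrow> 'h \<Rightarrow> 'k) \<Rightarrow> ('m \<Rightarrow> 'n \<Rightarrow> 'v) \<Rightarrow> 'm \<Rightarrow> 'n \<Rightarrow> 'v" where
  "twist_pairing s L R L' R' F F' \<mu> m n =
     (\<Sum>(m1, m2, m3) \<in># bicoact L R m. \<Sum>(n1, n2, n3) \<in># bicoact L' R' n.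
        s (F m1 n1 * F' m3 n3) (\<mu> m2 n2))"

text \<open>
  The outer components of the coactions meet only \<open>F\<close> and \<open>F'\<close>, so a functional sees the twist as a
  conjugation in the convolution bimodule of bilinear forms.
\<close>

lemma functional_twist_pairing:
  assumes "f \<in> forms s"
  shows "f (twist_pairing s L R L' R' F F' \<mu> m n) =
    conv (prod_coact L L') (case_prod F)
      (conv (prod_coact R R') (\<lambda>(m, n). f (\<mu> m n)) (case_prod F')) (m, n)"
proof -
  have "f (twist_pairing s L R L' R' F F' \<mu> m n) =
    (\<Sum>(m1, m')\<in>#L m. \<Sum>(m2, m3)\<in>#R m'. \<Sum>(n1, n')\<in>#L' n. \<Sum>(n2, n3)\<in>#R' n'.
      F m1 n1 * F' m3 n3 * f (\<mu> m2 n2))"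
    unfolding twist_pairing_def sum_bicoact
    by (simp add: forms_sum_mset[OF assms] forms_scale[OF assms] case_prod_unfold)
  also have "\<dots> = (\<Sum>(m1, m')\<in>#L m. \<Sum>(n1, n')\<in>#L' n. \<Sum>(m2, m3)\<in>#R m'. \<Sum>(n2, n3)\<in>#R' n'.
      F m1 n1 * F' m3 n3 * f (\<mu> m2 n2))"
    by (subst sum_mset_swap_pairs) simp
  also have "\<dots> = conv (prod_coact L L') (case_prod F)
      (conv (prod_coact R R') (\<lambda>(m, n). f (\<mu> m n)) (case_prod F')) (m, n)"
    unfolding conv_def sum_prod_coact_pairs
    by (simp add: sum_mset_distrib_left case_prod_unfold ac_simps)
  finally show ?thesis .
qed

lemma functional_bicoact3:
  assumes "f \<in> forms s"
  shows "f (\<Sum>(m1, m2, m3)\<in>#bicoact L R m. \<Sum>(n1, n2, n3)\<in>#bicoact L' R' n.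
      \<Sum>(p1, p2, p3)\<in>#bicoact L'' R'' p. s (\<Phi> m1 n1 p1 * \<Phi>' m3 n3 p3) (\<mu> m2 n2 p2)) =
    conv (prod_coact L (prod_coact L' L'')) (\<lambda>(a, b, c). \<Phi> a b c)
      (conv (prod_coact R (prod_coact R' R'')) (\<lambda>(m, n, p). f (\<mu> m n p)) (\<lambda>(a, b, c). \<Phi>' a b c))
      (m, n, p)"
proof -
  have "f (\<Sum>(m1, m2, m3)\<in>#bicoact L R m. \<Sum>(n1, n2, n3)\<in>#bicoact L' R' n.
      \<Sum>(p1, p2, p3)\<in>#bicoact L'' R'' p. s (\<Phi> m1 n1 p1 * \<Phi>' m3 n3 p3) (\<mu> m2 n2 p2)) =
    (\<Sum>(m1, m')\<in>#L m. \<Sum>(m2, m3)\<in>#R m'. \<Sum>(n1, n')\<in>#L' n. \<Sum>(n2, n3)\<in>#R' n'.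
      \<Sum>(p1, p')\<in>#L'' p. \<Sum>(p2, p3)\<in>#R'' p'. \<Phi> m1 n1 p1 * \<Phi>' m3 n3 p3 * f (\<mu> m2 n2 p2))"
    unfolding sum_bicoact
    by (simp add: forms_sum_mset[OF assms] forms_scale[OF assms] case_prod_unfold)
  also have "\<dots> = (\<Sum>(m1, m')\<in>#L m. \<Sum>(n1, n')\<in>#L' n. \<Sum>(p1, p')\<in>#L'' p. \<Sum>(m2, m3)\<in>#R m'.
      \<Sum>(n2, n3)\<in>#R' n'. \<Sum>(p2, p3)\<in>#R'' p'. \<Phi> m1 n1 p1 * \<Phi>' m3 n3 p3 * f (\<mu> m2 n2 p2))"
    by (simp only: sum_mset_swap_pairs[where M = "R _" and N = "L' _"]
        sum_mset_swap_pairs[where M = "R _" and N = "L'' _"]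
        sum_mset_swap_pairs[where M = "R' _" and N = "L'' _"])
  also have "\<dots> = conv (prod_coact L (prod_coact L' L'')) (\<lambda>(a, b, c). \<Phi> a b c)
      (conv (prod_coact R (prod_coact R' R'')) (\<lambda>(m, n, p). f (\<mu> m n p)) (\<lambda>(a, b, c). \<Phi>' a b c))
      (m, n, p)"
    unfolding conv_def sum_prod_coact_pairs
    by (simp add: sum_mset_distrib_left case_prod_unfold ac_simps)
  finally show ?thesis .
qed

locale twisting = hopf_algebra scale comult counit antipode
  for scale :: "'k::field \<Rightarrow> 'h::ring_1 \<Rightarrow> 'h"
    and comult :: "'h \<Rightarrow> ('h \<times> 'h) multiset" ("\<Delta>")
    and counit :: "'h \<Rightarrow> 'k" ("\<epsilon>")
    and antipode :: "'h \<Rightarrow> 'h" ("S") +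
  fixes F F' :: "'h \<Rightarrow> 'h \<Rightarrow> 'k"
  assumes cochain: "two_cochain scale \<Delta> \<epsilon> F F'"
begin

text \<open>
  \<open>Hn\<close> consists of the \<open>n\<close>-linear forms on \<open>H\<close>; under convolution along \<open>\<Delta>n\<close> it is an algebra with
  unit \<open>\<epsilon>n\<close>.  As elements of the algebra \<open>H2\<close>, the cochain and its inverse are \<open>f\<close> and \<open>f'\<close>.
\<close>

abbreviation "H1 \<equiv> forms scale"
abbreviation "H2 \<equiv> H1 \<boxtimes> H1"
abbreviation "H3 \<equiv> H1 \<boxtimes> H2"
abbreviation "\<Delta>2 \<equiv> prod_coact \<Delta> \<Delta>"
abbreviation "\<Delta>3 \<equiv> prod_coact \<Delta> \<Delta>2"
abbreviation "\<epsilon>2 \<equiv> tens \<epsilon> \<epsilon>"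
abbreviation "\<epsilon>3 \<equiv> tens \<epsilon> \<epsilon>2"
abbreviation "f \<equiv> case_prod F"
abbreviation "f' \<equiv> case_prod F'"

sublocale H1: form_bicomodule H1 \<Delta> \<epsilon> H1 \<Delta> \<Delta>
  by (intro bicomodule_imp_form_bicomodule bicomodule_self coalgebra_axioms)
sublocale H2: form_bicomodule H2 \<Delta>2 \<epsilon>2 H2 \<Delta>2 \<Delta>2
  by (intro form_bicomodule_prod H1.form_bicomodule_axioms)
sublocale H3: form_bicomodule H3 \<Delta>3 \<epsilon>3 H3 \<Delta>3 \<Delta>3
  by (intro form_bicomodule_prod H1.form_bicomodule_axioms H2.form_bicomodule_axioms)

lemma bilinear_form_iff: "bilinear_map scale scale (*) g \<longleftrightarrow> case_prod g \<in> H2"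
  by (auto simp: bilinear_map_def pair_forms_iff linear_functional_iff[OF vector_space_axioms])

lemma f_form: "f \<in> H2" and f'_form: "f' \<in> H2"
  using cochain by (simp_all add: two_cochain_def bilinear_form_iff)

lemma f_inverse: "conv \<Delta>2 f f' = \<epsilon>2" "conv \<Delta>2 f' f = \<epsilon>2"
  using cochain by (auto simp: two_cochain_def fun_eq_iff conv_def sum_prod_coact_pairs tens_def)

text \<open>
  This is the compatibility of product and coproduct; it allows the forms inside a convolution to be
  evaluated at products.
\<close>

lemma mult_form_map: "form_map H2 H2 \<Delta>2 \<Delta>2 (case_prod (*)) (case_prod (*)) H1 H1 \<Delta> \<Delta>"
proof -
  have "(\<lambda>(a, b). g (a * b)) \<in> H2" if "g \<in> H1" for g
    by (rule bilinear_map_functional[OF mult_bilinear that])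
  moreover have "(\<Sum>z\<in>#\<Delta> (a * b). T z) = (\<Sum>((c1, c2), d1, d2)\<in>#\<Delta>2 (a, b). T (c1 * c2, d1 * d2))"
    if "T \<in> H2" for T a b
    using tensor_eq_imp_sum_eq[OF comult_mult that, of a b]
    by (simp add: sum_prod_coact sum_mset_Union multiset.map_comp o_def case_prod_unfold)
  ultimately show ?thesis
    unfolding form_map_def by (simp add: split_paired_all case_prod_unfold)
qed

text \<open>
  Ways of reading a form in two arguments as a form in three.  An underscore between digits separates the
  two arguments of \<open>g\<close>, and the digits on one side of it are multiplied: \<open>leg_1_23 g\<close> evaluates \<open>g\<close> at
  \<open>(a, b c)\<close>.  In \<open>leg_23\<close> and \<open>leg_12\<close> the digits are the arguments of \<open>g\<close> and the remaining argument
  goes into the counit.  All four are algebra maps, so they take \<open>f\<close> and \<open>f'\<close> to mutually inverse forms.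
\<close>

definition "leg_23 g = tens \<epsilon> g" for g :: "'h \<times> 'h \<Rightarrow> 'k"
definition "leg_12 g = (\<lambda>(a, b, c). g (a, b) * \<epsilon> c)" for g :: "'h \<times> 'h \<Rightarrow> 'k"
definition "leg_1_23 g = (\<lambda>(a, b, c). g (a, b * c))" for g :: "'h \<times> 'h \<Rightarrow> 'k"
definition "leg_12_3 g = (\<lambda>(a, b, c). g (a * b, c))" for g :: "'h \<times> 'h \<Rightarrow> 'k"

lemma form_map_1_23: "form_map H3 H3 \<Delta>3 \<Delta>3 (\<lambda>(a, b, c). (a, b * c)) (\<lambda>(a, b, c). (a, b * c)) H2 H2 \<Delta>2 \<Delta>2"
  using form_map_second[OF mult_form_map] by (simp add: case_prod_unfold)

lemma form_map_12_3: "form_map H3 H3 \<Delta>3 \<Delta>3 (\<lambda>(a, b, c). (a * b, c)) (\<lambda>(a, b, c). (a * b, c)) H2 H2 \<Delta>2 \<Delta>2"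
  using form_map_leading_pair[OF mult_form_map H1.A_space H1.A_space] by (simp add: case_prod_unfold)

lemma leg_forms:
  assumes "g \<in> H2"
  shows "leg_23 g \<in> H3" "leg_12 g \<in> H3" "leg_1_23 g \<in> H3" "leg_12_3 g \<in> H3"
proof -
  show "leg_23 g \<in> H3"
    unfolding leg_23_def by (intro tens_form assms H1.A_space H2.A_space H1.counit_form)
  show "leg_12 g \<in> H3"
    using assms H1.counit_form
    by (simp add: leg_12_def pair_forms_iff form_space_scale[OF H1.A_space])
  show "leg_1_23 g \<in> H3" "leg_12_3 g \<in> H3"
    using form_mapD(1)[OF form_map_1_23 assms] form_mapD(1)[OF form_map_12_3 assms]
    by (simp_all add: leg_1_23_def leg_12_3_def case_prod_unfold)
qed

lemma conv_legs:
  assumes "g \<in> H2" "k \<in> H2"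
  shows "conv \<Delta>3 (leg_23 g) (leg_23 k) = leg_23 (conv \<Delta>2 g k)"
    and "conv \<Delta>3 (leg_12 g) (leg_12 k) = leg_12 (conv \<Delta>2 g k)"
    and "conv \<Delta>3 (leg_1_23 g) (leg_1_23 k) = leg_1_23 (conv \<Delta>2 g k)"
    and "conv \<Delta>3 (leg_12_3 g) (leg_12_3 k) = leg_12_3 (conv \<Delta>2 g k)"
proof -
  have "conv \<Delta>3 (leg_23 g) (leg_23 k) (a, b, c) = leg_23 (conv \<Delta>2 g k) (a, b, c)" for a b c
  proof -
    have "conv \<Delta>3 (leg_23 g) (leg_23 k) (a, b, c) = conv \<Delta>2 g (\<lambda>n. leg_23 k (a, n)) (b, c)"
      using leg_forms(1)[OF assms(2)] unfolding leg_23_def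
      by (intro H1.conv_counit_first) (auto simp: pair_forms_iff)
    then show ?thesis by (simp add: leg_23_def tens_def conv_scale)
  qed
  then show "conv \<Delta>3 (leg_23 g) (leg_23 k) = leg_23 (conv \<Delta>2 g k)" by auto
  have "conv \<Delta>3 (leg_12 g) (leg_12 k) (a, b, c) = leg_12 (conv \<Delta>2 g k) (a, b, c)" for a b c
  proof -
    have "conv \<Delta>3 (leg_12 g) (leg_12 k) (a, b, c) = conv \<Delta>2 g (\<lambda>(x, y). leg_12 k (x, y, c)) (a, b)"
      using leg_forms(2)[OF assms(2)] unfolding leg_12_def[of g]
      by (intro H1.conv_counit_last) (simp add: pair_forms_iff)
    then show ?thesis by (simp add: leg_12_def case_prod_unfold conv_scale)
  qed
  then show "conv \<Delta>3 (leg_12 g) (leg_12 k) = leg_12 (conv \<Delta>2 g k)" by auto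
  show "conv \<Delta>3 (leg_1_23 g) (leg_1_23 k) = leg_1_23 (conv \<Delta>2 g k)"
    using conv_form_map(1)[OF form_map_1_23 H2.A_space H2.A_space assms]
    by (simp add: leg_1_23_def fun_eq_iff case_prod_unfold)
  show "conv \<Delta>3 (leg_12_3 g) (leg_12_3 k) = leg_12_3 (conv \<Delta>2 g k)"
    using conv_form_map(1)[OF form_map_12_3 H2.A_space H2.A_space assms]
    by (simp add: leg_12_3_def fun_eq_iff case_prod_unfold)
qed

lemma leg_counit: "leg_23 \<epsilon>2 = \<epsilon>3" "leg_12 \<epsilon>2 = \<epsilon>3" "leg_1_23 \<epsilon>2 = \<epsilon>3" "leg_12_3 \<epsilon>2 = \<epsilon>3"
  by (auto simp: leg_23_def leg_12_def leg_1_23_def leg_12_3_def tens_def counit_mult)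

end

section \<open>Associativity of twisted pairings\<close>

text \<open>
  For \<open>q = p\<^sup>-\<^sup>1\<close> and \<open>v = w\<^sup>-\<^sup>1\<close> this is the composition law of conjugations: the one by \<open>p\<close> followed
  by the one by \<open>w * p\<^sup>-\<^sup>1\<close> is the one by \<open>w\<close>.
\<close>

lemma (in form_bicomodule) conv_conjugate:
  assumes C: "form_bicomodule A \<delta> e A \<delta> \<delta>"
    and forms: "p \<in> A" "q \<in> A" "v \<in> A" "w \<in> A" "\<phi> \<in> B"
    and inv: "conv \<delta> q p = e"
  shows "conv L (conv \<delta> w q) (conv R (conv L p (conv R \<phi> q)) (conv \<delta> p v)) = conv L w (conv R \<phi> v)"
proof -
  interpret C: form_bicomodule A \<delta> e A \<delta> \<delta> by fact
  note [simp] = forms C.convL_form convL_form convR_form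
  have "conv L (conv \<delta> w q) (conv R (conv L p (conv R \<phi> q)) (conv \<delta> p v)) =
      conv L w (conv L q (conv L p (conv R (conv R \<phi> q) (conv \<delta> p v))))"
    by (simp add: convL_assoc convL_convR)
  also have "\<dots> = conv L w (conv R (conv R \<phi> q) (conv \<delta> p v))"
    by (simp add: convL_assoc[symmetric] inv convL_counit)
  also have "\<dots> = conv L w (conv R (conv R (conv R \<phi> q) p) v)"
    by (simp add: convR_assoc[of p v "conv R \<phi> q"])
  also have "\<dots> = conv L w (conv R \<phi> v)"
    by (simp add: convR_assoc[of q p \<phi>] inv convR_counit)
  finally show ?thesis .
qed

context twisting
begin

text \<open>
  Tested on forms: \<open>\<mu>\<close> is bilinear, and each coaction of \<open>\<mu> m n\<close> is the product of those of \<open>m\<close> and \<open>n\<close>.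
\<close>

abbreviation (input) "pairing sM LM RM sN LN RN sV LV RV \<mu> \<equiv>
  form_map H2 (forms sM \<boxtimes> forms sN) (prod_coact LM LN) (prod_coact RM RN)
    (case_prod (*)) (case_prod \<mu>) H1 (forms sV) LV RV"

lemma twist_pairing_form:
  assumes M: "bicomodule scale \<Delta> \<epsilon> sM LM RM" and N: "bicomodule scale \<Delta> \<epsilon> sN LN RN"
    and \<mu>: "pairing sM LM RM sN LN RN sV LV RV \<mu>" and g: "g \<in> forms sV"
  shows "(\<lambda>(m, n). g (twist_pairing sV LM RM LN RN F F' \<mu> m n)) \<in> forms sM \<boxtimes> forms sN"
proof -
  interpret MN: form_bicomodule H2 \<Delta>2 \<epsilon>2 "forms sM \<boxtimes> forms sN" "prod_coact LM LN" "prod_coact RM RN"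
    by (intro form_bicomodule_prod bicomodule_imp_form_bicomodule M N)
  have "(\<lambda>(m, n). g (\<mu> m n)) \<in> forms sM \<boxtimes> forms sN"
    using form_mapD(2)[OF \<mu> g] by (simp add: case_prod_unfold)
  then show ?thesis
    unfolding functional_twist_pairing[OF g] by (simp add: MN.convL_form MN.convR_form f_form f'_form)
qed

text \<open>
  The outer product contributes \<open>F\<close> evaluated at \<open>(m, n \<bullet> p)\<close>.  Its conjugate is linear in the second
  argument, so the inner twist acts on it as a conjugation by \<open>F\<^sub>2\<^sub>3\<close>, and what remains is evaluated at the
  untwisted product of \<open>n\<close> and \<open>p\<close>, which gives \<open>F\<^sub>1\<^sub>,\<^sub>2\<^sub>3\<close>.
\<close>

lemma twist_pairing_nested_right:
  assumes M: "bicomodule scale \<Delta> \<epsilon> sM LM RM" and N: "bicomodule scale \<Delta> \<epsilon> sN LN RN"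
    and P: "bicomodule scale \<Delta> \<epsilon> sP LP RP" and NP: "bicomodule scale \<Delta> \<epsilon> sNP LNP RNP"
    and \<mu>: "pairing sN LN RN sP LP RP sNP LNP RNP \<mu>"
    and \<nu>: "pairing sM LM RM sNP LNP RNP sV LV RV \<nu>"
    and g: "g \<in> forms sV"
  defines "L3 \<equiv> prod_coact LM (prod_coact LN LP)" and "R3 \<equiv> prod_coact RM (prod_coact RN RP)"
  shows "(\<lambda>(m, n, p). g (twist_pairing sV LM RM LNP RNP F F' \<nu> m
      (twist_pairing sNP LN RN LP RP F F' \<mu> n p))) =
    conv L3 (conv \<Delta>3 (leg_23 f) (leg_1_23 f)) (conv R3 (\<lambda>(m, n, p). g (\<nu> m (\<mu> n p)))
      (conv \<Delta>3 (leg_1_23 f') (leg_23 f')))"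
proof -
  interpret M: form_bicomodule H1 \<Delta> \<epsilon> "forms sM" LM RM by (intro bicomodule_imp_form_bicomodule M)
  interpret MNP: form_bicomodule H3 \<Delta>3 \<epsilon>3 "forms sM \<boxtimes> forms sN \<boxtimes> forms sP" L3 R3
    unfolding L3_def R3_def by (intro form_bicomodule_prod bicomodule_imp_form_bicomodule M N P)
  interpret M_NP: form_bicomodule H2 \<Delta>2 \<epsilon>2 "forms sM \<boxtimes> forms sNP" "prod_coact LM LNP" "prod_coact RM RNP"
    by (intro form_bicomodule_prod bicomodule_imp_form_bicomodule M NP)
  note [simp] = leg_forms[OF f_form] leg_forms[OF f'_form]
  \<comment> \<open>\<open>\<psi>\<close> carries the outer twist, \<open>\<Psi>\<close> evaluates it at the untwisted inner product.\<close>
  define \<psi> where "\<psi> = (\<lambda>(m, q). g (twist_pairing sV LM RM LNP RNP F F' \<nu> m q))"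
  have \<psi>: "\<psi> \<in> forms sM \<boxtimes> forms sNP"
    unfolding \<psi>_def by (rule twist_pairing_form[OF M NP \<nu> g])
  have \<psi>_eq: "\<psi> = conv (prod_coact LM LNP) f (conv (prod_coact RM RNP) (\<lambda>(m, q). g (\<nu> m q)) f')"
    by (auto simp: \<psi>_def functional_twist_pairing[OF g])
  have g\<nu>: "(\<lambda>(m, q). g (\<nu> m q)) \<in> forms sM \<boxtimes> forms sNP"
    using form_mapD(2)[OF \<nu> g] by (simp add: case_prod_unfold)
  have map: "form_map H3 (forms sM \<boxtimes> forms sN \<boxtimes> forms sP) L3 R3
      (\<lambda>(a, b, c). (a, b * c)) (\<lambda>(m, n, p). (m, \<mu> n p))
      H2 (forms sM \<boxtimes> forms sNP) (prod_coact LM LNP) (prod_coact RM RNP)"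
    using form_map_second[OF \<mu>] by (simp add: case_prod_unfold L3_def R3_def)
  define X where "X = (\<lambda>(m, n, p). g (\<nu> m (\<mu> n p)))"
  define \<Psi> where "\<Psi> = (\<lambda>(m, n, p). \<psi> (m, \<mu> n p))"
  have X: "X \<in> forms sM \<boxtimes> forms sN \<boxtimes> forms sP" and \<Psi>: "\<Psi> \<in> forms sM \<boxtimes> forms sN \<boxtimes> forms sP"
    using form_mapD(2)[OF map g\<nu>] form_mapD(2)[OF map \<psi>] by (simp_all add: X_def \<Psi>_def case_prod_unfold)
  have \<Psi>_eq: "\<Psi> = conv L3 (leg_1_23 f) (conv R3 X (leg_1_23 f'))"
  proof -
    have in_RM: "conv (prod_coact RM RNP) (\<lambda>(m, q). g (\<nu> m q)) f' \<in> forms sM \<boxtimes> forms sNP"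
      by (intro M_NP.convR_form g\<nu> f'_form)
    have "\<Psi> = conv L3 (leg_1_23 f)
        (\<lambda>(m, n, p). conv (prod_coact RM RNP) (\<lambda>(m, q). g (\<nu> m q)) f' (m, \<mu> n p))"
      using conv_form_map(1)[OF map H2.A_space M_NP.B_space f_form in_RM]
      by (auto simp: \<Psi>_def \<psi>_eq leg_1_23_def case_prod_unfold)
    also have "(\<lambda>(m, n, p). conv (prod_coact RM RNP) (\<lambda>(m, q). g (\<nu> m q)) f' (m, \<mu> n p)) =
        conv R3 X (leg_1_23 f')"
      using conv_form_map(2)[OF map H2.A_space M_NP.B_space f'_form g\<nu>]
      by (auto simp: leg_1_23_def case_prod_unfold X_def)
    finally show ?thesis .
  qed
  have "g (twist_pairing sV LM RM LNP RNP F F' \<nu> m (twist_pairing sNP LN RN LP RP F F' \<mu> n p)) =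
      conv L3 (leg_23 f) (conv R3 \<Psi> (leg_23 f')) (m, n, p)" for m n p
  proof -
    have \<psi>m: "(\<lambda>q. \<psi> (m, q)) \<in> forms sNP" using \<psi> by (simp add: pair_forms_iff)
    have in_R: "conv R3 \<Psi> (leg_23 f') \<in> forms sM \<boxtimes> forms sN \<boxtimes> forms sP"
      using \<Psi> by (simp add: MNP.convR_form)
    have "g (twist_pairing sV LM RM LNP RNP F F' \<nu> m (twist_pairing sNP LN RN LP RP F F' \<mu> n p)) =
        \<psi> (m, twist_pairing sNP LN RN LP RP F F' \<mu> n p)"
      by (simp add: \<psi>_def)
    also have "\<dots> = conv (prod_coact LN LP) f
      (conv (prod_coact RN RP) (\<lambda>r. \<Psi> (m, r)) f') (n, p)"
      unfolding functional_twist_pairing[OF \<psi>m] by (simp add: \<Psi>_def case_prod_unfold)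
    also have "conv (prod_coact RN RP) (\<lambda>r. \<Psi> (m, r)) f' = (\<lambda>r. conv R3 \<Psi> (leg_23 f') (m, r))"
      unfolding R3_def leg_23_def using \<Psi>
      by (intro ext M.conv_counit_first(2)[symmetric]) (auto simp: pair_forms_iff)
    also have "conv (prod_coact LN LP) f \<dots> (n, p) = conv L3 (leg_23 f) (conv R3 \<Psi> (leg_23 f')) (m, n, p)"
      unfolding L3_def leg_23_def[of f] using in_R
      by (intro M.conv_counit_first(1)[symmetric]) (auto simp: pair_forms_iff)
    finally show ?thesis .
  qed
  then have "(\<lambda>(m, n, p). g (twist_pairing sV LM RM LNP RNP F F' \<nu> m
      (twist_pairing sNP LN RN LP RP F F' \<mu> n p))) = conv L3 (leg_23 f) (conv R3 \<Psi> (leg_23 f'))"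
    by auto
  also have "\<dots> = conv L3 (conv \<Delta>3 (leg_23 f) (leg_1_23 f)) (conv R3 X
      (conv \<Delta>3 (leg_1_23 f') (leg_23 f')))"
    by (simp add: \<Psi>_eq X MNP.convL_convR MNP.convL_assoc MNP.convR_assoc
        MNP.convL_form MNP.convR_form H3.convL_form)
  finally show ?thesis by (simp add: X_def)
qed

lemma twist_pairing_nested_left:
  assumes M: "bicomodule scale \<Delta> \<epsilon> sM LM RM" and N: "bicomodule scale \<Delta> \<epsilon> sN LN RN"
    and P: "bicomodule scale \<Delta> \<epsilon> sP LP RP" and MN: "bicomodule scale \<Delta> \<epsilon> sMN LMN RMN"
    and \<mu>: "pairing sM LM RM sN LN RN sMN LMN RMN \<mu>"
    and \<nu>: "pairing sMN LMN RMN sP LP RP sV LV RV \<nu>"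
    and g: "g \<in> forms sV"
  defines "L3 \<equiv> prod_coact LM (prod_coact LN LP)" and "R3 \<equiv> prod_coact RM (prod_coact RN RP)"
  shows "(\<lambda>(m, n, p). g (twist_pairing sV LMN RMN LP RP F F' \<nu>
      (twist_pairing sMN LM RM LN RN F F' \<mu> m n) p)) =
    conv L3 (conv \<Delta>3 (leg_12 f) (leg_12_3 f)) (conv R3 (\<lambda>(m, n, p). g (\<nu> (\<mu> m n) p))
      (conv \<Delta>3 (leg_12_3 f') (leg_12 f')))"
proof -
  interpret P: form_bicomodule H1 \<Delta> \<epsilon> "forms sP" LP RP by (intro bicomodule_imp_form_bicomodule P)
  interpret MNP: form_bicomodule H3 \<Delta>3 \<epsilon>3 "forms sM \<boxtimes> forms sN \<boxtimes> forms sP" L3 R3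
    unfolding L3_def R3_def by (intro form_bicomodule_prod bicomodule_imp_form_bicomodule M N P)
  interpret MN_P: form_bicomodule H2 \<Delta>2 \<epsilon>2 "forms sMN \<boxtimes> forms sP" "prod_coact LMN LP" "prod_coact RMN RP"
    by (intro form_bicomodule_prod bicomodule_imp_form_bicomodule MN P)
  note [simp] = leg_forms[OF f_form] leg_forms[OF f'_form]
  define \<psi> where "\<psi> = (\<lambda>(q, p). g (twist_pairing sV LMN RMN LP RP F F' \<nu> q p))"
  have \<psi>: "\<psi> \<in> forms sMN \<boxtimes> forms sP"
    unfolding \<psi>_def by (rule twist_pairing_form[OF MN P \<nu> g])
  have \<psi>_eq: "\<psi> = conv (prod_coact LMN LP) f (conv (prod_coact RMN RP) (\<lambda>(q, p). g (\<nu> q p)) f')"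
    by (auto simp: \<psi>_def functional_twist_pairing[OF g])
  have g\<nu>: "(\<lambda>(q, p). g (\<nu> q p)) \<in> forms sMN \<boxtimes> forms sP"
    using form_mapD(2)[OF \<nu> g] by (simp add: case_prod_unfold)
  have map: "form_map H3 (forms sM \<boxtimes> forms sN \<boxtimes> forms sP) L3 R3
      (\<lambda>(a, b, c). (a * b, c)) (\<lambda>(m, n, p). (\<mu> m n, p))
      H2 (forms sMN \<boxtimes> forms sP) (prod_coact LMN LP) (prod_coact RMN RP)"
    using form_map_leading_pair[OF \<mu> H1.A_space form_space_forms] by (simp add: case_prod_unfold L3_def R3_def)
  define X where "X = (\<lambda>(m, n, p). g (\<nu> (\<mu> m n) p))"
  define \<Psi> where "\<Psi> = (\<lambda>(m, n, p). \<psi> (\<mu> m n, p))"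
  have X: "X \<in> forms sM \<boxtimes> forms sN \<boxtimes> forms sP" and \<Psi>: "\<Psi> \<in> forms sM \<boxtimes> forms sN \<boxtimes> forms sP"
    using form_mapD(2)[OF map g\<nu>] form_mapD(2)[OF map \<psi>] by (simp_all add: X_def \<Psi>_def case_prod_unfold)
  have \<Psi>_eq: "\<Psi> = conv L3 (leg_12_3 f) (conv R3 X (leg_12_3 f'))"
  proof -
    have in_RM: "conv (prod_coact RMN RP) (\<lambda>(q, p). g (\<nu> q p)) f' \<in> forms sMN \<boxtimes> forms sP"
      by (intro MN_P.convR_form g\<nu> f'_form)
    have "\<Psi> = conv L3 (leg_12_3 f)
        (\<lambda>(m, n, p). conv (prod_coact RMN RP) (\<lambda>(q, p). g (\<nu> q p)) f' (\<mu> m n, p))"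
      using conv_form_map(1)[OF map H2.A_space MN_P.B_space f_form in_RM]
      by (auto simp: \<Psi>_def \<psi>_eq leg_12_3_def case_prod_unfold)
    also have "(\<lambda>(m, n, p). conv (prod_coact RMN RP) (\<lambda>(q, p). g (\<nu> q p)) f' (\<mu> m n, p)) =
        conv R3 X (leg_12_3 f')"
      using conv_form_map(2)[OF map H2.A_space MN_P.B_space f'_form g\<nu>]
      by (auto simp: leg_12_3_def case_prod_unfold X_def)
    finally show ?thesis .
  qed
  have "g (twist_pairing sV LMN RMN LP RP F F' \<nu> (twist_pairing sMN LM RM LN RN F F' \<mu> m n) p) =
      conv L3 (leg_12 f) (conv R3 \<Psi> (leg_12 f')) (m, n, p)" for m n p
  proof -
    have \<psi>p: "(\<lambda>q. \<psi> (q, p)) \<in> forms sMN" using \<psi> by (simp add: pair_forms_iff)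
    have in_R: "conv R3 \<Psi> (leg_12 f') \<in> forms sM \<boxtimes> forms sN \<boxtimes> forms sP"
      using \<Psi> by (simp add: MNP.convR_form)
    have "g (twist_pairing sV LMN RMN LP RP F F' \<nu> (twist_pairing sMN LM RM LN RN F F' \<mu> m n) p) =
        \<psi> (twist_pairing sMN LM RM LN RN F F' \<mu> m n, p)"
      by (simp add: \<psi>_def)
    also have "\<dots> = conv (prod_coact LM LN) f
      (conv (prod_coact RM RN) (\<lambda>(m, n). \<Psi> (m, n, p)) f') (m, n)"
      unfolding functional_twist_pairing[OF \<psi>p] by (simp add: \<Psi>_def case_prod_unfold)
    also have "conv (prod_coact RM RN) (\<lambda>(m, n). \<Psi> (m, n, p)) f' =
        (\<lambda>(m, n). conv R3 \<Psi> (leg_12 f') (m, n, p))"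
    proof -
      have "conv (prod_coact RM RN) (\<lambda>(m, n). \<Psi> (m, n, p)) f' (m, n) =
          conv R3 \<Psi> (leg_12 f') (m, n, p)" for m n
        unfolding R3_def leg_12_def using \<Psi>
        by (intro P.conv_counit_last(2)[symmetric]) (auto simp: pair_forms_iff)
      then show ?thesis by auto
    qed
    also have "conv (prod_coact LM LN) f \<dots> (m, n) = conv L3 (leg_12 f) (conv R3 \<Psi> (leg_12 f')) (m, n, p)"
      unfolding L3_def leg_12_def[of f] using in_R
      by (intro P.conv_counit_last(1)[symmetric]) (auto simp: pair_forms_iff)
    finally show ?thesis .
  qed
  then have "(\<lambda>(m, n, p). g (twist_pairing sV LMN RMN LP RP F F' \<nu>
      (twist_pairing sMN LM RM LN RN F F' \<mu> m n) p)) = conv L3 (leg_12 f) (conv R3 \<Psi> (leg_12 f'))"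
    by auto
  also have "\<dots> = conv L3 (conv \<Delta>3 (leg_12 f) (leg_12_3 f)) (conv R3 X
      (conv \<Delta>3 (leg_12_3 f') (leg_12 f')))"
    by (simp add: \<Psi>_eq X MNP.convL_convR MNP.convL_assoc MNP.convR_assoc
        MNP.convL_form MNP.convR_form H3.convL_form)
  finally show ?thesis by (simp add: X_def)
qed

abbreviation "\<Phi> \<equiv> twist_assoc \<Delta> F F'"
abbreviation "\<Phi>' \<equiv> twist_assoc_inv \<Delta> F F'"

text \<open>
  \<open>\<Phi>\<close> is the quotient of the conjugating factors of the two bracketings.  In the first
  and the last factor one argument meets only the counit, which accounts for the three, four and three
  coproduct components in the definition of \<open>\<Phi>\<close>.
\<close>

lemma twist_assoc_eq:
  "(\<lambda>(a, b, c). \<Phi> a b c) =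
    conv \<Delta>3 (conv \<Delta>3 (leg_23 f) (leg_1_23 f)) (conv \<Delta>3 (leg_12_3 f') (leg_12 f'))"
proof -
  note [simp] = leg_forms[OF f_form] leg_forms[OF f'_form] H3.convL_form
  have "\<Phi> a b c = conv \<Delta>3 (leg_23 f) (conv \<Delta>3 (leg_1_23 f) (conv \<Delta>3 (leg_12_3 f') (leg_12 f'))) (a, b, c)"
    for a b c
  proof -
    have last: "conv \<Delta>3 (leg_12_3 f') (leg_12 f') (a, b, c) =
      (\<Sum>(a1, a2)\<in>#\<Delta> a. \<Sum>(b1, b2)\<in>#\<Delta> b. F' (a1 * b1) c * F' a2 b2)" for a b c
      unfolding leg_12_def
      using leg_forms(4)[OF f'_form]
      by (subst H1.conv_counit_last(2)) (auto simp: pair_forms_iff conv_def sum_prod_coact_pairs leg_12_3_def)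
    have "conv \<Delta>3 (leg_23 f) (conv \<Delta>3 (leg_1_23 f) (conv \<Delta>3 (leg_12_3 f') (leg_12 f'))) (a, b, c) =
      conv \<Delta>2 f (\<lambda>q. conv \<Delta>3 (leg_1_23 f) (conv \<Delta>3 (leg_12_3 f') (leg_12 f')) (a, q)) (b, c)"
    proof -
      have "conv \<Delta>3 (leg_1_23 f) (conv \<Delta>3 (leg_12_3 f') (leg_12 f')) \<in> H3" by simp
      then show ?thesis unfolding leg_23_def
        by (intro H1.conv_counit_first) (auto simp: pair_forms_iff)
    qed
    also have "\<dots> = (\<Sum>(b1, b')\<in>#\<Delta> b. \<Sum>(c1, c')\<in>#\<Delta> c. \<Sum>(a1, a')\<in>#\<Delta> a.
      \<Sum>(b2, b'')\<in>#\<Delta> b'. \<Sum>(c2, c3)\<in>#\<Delta> c'. \<Sum>(a2, a3)\<in>#\<Delta> a'. \<Sum>(b3, b4)\<in>#\<Delta> b''.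
        F b1 c1 * F a1 (b2 * c2) * F' (a2 * b3) c3 * F' a3 b4)"
      unfolding conv_def[of \<Delta>2] conv_def[of \<Delta>3 "leg_1_23 f"] sum_prod_coact_pairs last
      by (simp add: leg_1_23_def sum_mset_distrib_left case_prod_unfold mult.assoc)
    also have "\<dots> = (\<Sum>(a1, a')\<in>#\<Delta> a. \<Sum>(a2, a3)\<in>#\<Delta> a'. \<Sum>(b1, b')\<in>#\<Delta> b.
      \<Sum>(b2, b'')\<in>#\<Delta> b'. \<Sum>(b3, b4)\<in>#\<Delta> b''. \<Sum>(c1, c')\<in>#\<Delta> c. \<Sum>(c2, c3)\<in>#\<Delta> c'.
        F b1 c1 * F a1 (b2 * c2) * F' (a2 * b3) c3 * F' a3 b4)"
      by (rule sum_reorder_assoc)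
    also have "\<dots> = \<Phi> a b c"
      by (simp add: twist_assoc_def sum_cop3 sum_cop4)
    finally show ?thesis by simp
  qed
  then have "(\<lambda>(a, b, c). \<Phi> a b c) =
      conv \<Delta>3 (leg_23 f) (conv \<Delta>3 (leg_1_23 f) (conv \<Delta>3 (leg_12_3 f') (leg_12 f')))" by auto
  then show ?thesis by (simp add: H3.convL_assoc)
qed


lemma twist_assoc_inv_eq:
  "(\<lambda>(a, b, c). \<Phi>' a b c) =
    conv \<Delta>3 (conv \<Delta>3 (leg_12 f) (leg_12_3 f)) (conv \<Delta>3 (leg_1_23 f') (leg_23 f'))"
proof -
  note [simp] = leg_forms[OF f_form] leg_forms[OF f'_form] H3.convL_form
  have "\<Phi>' a b c = conv \<Delta>3 (leg_12 f) (conv \<Delta>3 (leg_12_3 f) (conv \<Delta>3 (leg_1_23 f') (leg_23 f'))) (a, b, c)"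
    for a b c
  proof -
    have last: "conv \<Delta>3 (leg_1_23 f') (leg_23 f') (a, b, c) =
      (\<Sum>(b1, b2)\<in>#\<Delta> b. \<Sum>(c1, c2)\<in>#\<Delta> c. F' a (b1 * c1) * F' b2 c2)" for a b c
      unfolding leg_23_def
      using leg_forms(3)[OF f'_form]
      by (subst H1.conv_counit_first(2)) (auto simp: pair_forms_iff conv_def sum_prod_coact_pairs leg_1_23_def)
    have "conv \<Delta>3 (leg_12 f) (conv \<Delta>3 (leg_12_3 f) (conv \<Delta>3 (leg_1_23 f') (leg_23 f'))) (a, b, c) =
      conv \<Delta>2 f (\<lambda>(a, b). conv \<Delta>3 (leg_12_3 f) (conv \<Delta>3 (leg_1_23 f') (leg_23 f')) (a, b, c)) (a, b)"
    proof -
      have "conv \<Delta>3 (leg_12_3 f) (conv \<Delta>3 (leg_1_23 f') (leg_23 f')) \<in> H3" by simp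
      then show ?thesis unfolding leg_12_def
        by (intro H1.conv_counit_last) (auto simp: pair_forms_iff)
    qed
    also have "\<dots> = (\<Sum>(a1, a')\<in>#\<Delta> a. \<Sum>(b1, b')\<in>#\<Delta> b. \<Sum>(a2, a3)\<in>#\<Delta> a'. \<Sum>(b2, b'')\<in>#\<Delta> b'.
      \<Sum>(c1, c')\<in>#\<Delta> c. \<Sum>(b3, b4)\<in>#\<Delta> b''. \<Sum>(c2, c3)\<in>#\<Delta> c'.
        F a1 b1 * F (a2 * b2) c1 * F' a3 (b3 * c2) * F' b4 c3)"
      unfolding conv_def[of \<Delta>2] conv_def[of \<Delta>3 "leg_12_3 f"] sum_prod_coact_pairs prod.case last
      by (simp add: leg_12_3_def sum_mset_distrib_left case_prod_unfold mult.assoc)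
    also have "\<dots> = (\<Sum>(a1, a')\<in>#\<Delta> a. \<Sum>(a2, a3)\<in>#\<Delta> a'. \<Sum>(b1, b')\<in>#\<Delta> b.
      \<Sum>(b2, b'')\<in>#\<Delta> b'. \<Sum>(b3, b4)\<in>#\<Delta> b''. \<Sum>(c1, c')\<in>#\<Delta> c. \<Sum>(c2, c3)\<in>#\<Delta> c'.
        F a1 b1 * F (a2 * b2) c1 * F' a3 (b3 * c2) * F' b4 c3)"
      by (rule sum_reorder_assoc_inv)
    also have "\<dots> = \<Phi>' a b c"
      by (simp add: twist_assoc_inv_def sum_cop3 sum_cop4)
    finally show ?thesis by simp
  qed
  then have "(\<lambda>(a, b, c). \<Phi>' a b c) =
      conv \<Delta>3 (leg_12 f) (conv \<Delta>3 (leg_12_3 f) (conv \<Delta>3 (leg_1_23 f') (leg_23 f')))" by auto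
  then show ?thesis by (simp add: H3.convL_assoc)
qed

lemma conv_cancel:
  assumes "p \<in> H3" "p' \<in> H3" "q \<in> H3" "q' \<in> H3"
    and "conv \<Delta>3 p p' = \<epsilon>3" "conv \<Delta>3 q q' = \<epsilon>3"
  shows "conv \<Delta>3 (conv \<Delta>3 p q) (conv \<Delta>3 q' p') = \<epsilon>3"
proof -
  have "conv \<Delta>3 (conv \<Delta>3 p q) (conv \<Delta>3 q' p') = conv \<Delta>3 p (conv \<Delta>3 (conv \<Delta>3 q q') p')"
    using assms(1-4) by (simp add: H3.convL_assoc H3.convL_form)
  then show ?thesis using assms by (simp add: H3.convL_counit)
qed

lemma leg_inverses:
  "conv \<Delta>3 (leg_23 f) (leg_23 f') = \<epsilon>3" "conv \<Delta>3 (leg_23 f') (leg_23 f) = \<epsilon>3"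
  "conv \<Delta>3 (leg_12 f) (leg_12 f') = \<epsilon>3" "conv \<Delta>3 (leg_12 f') (leg_12 f) = \<epsilon>3"
  "conv \<Delta>3 (leg_1_23 f) (leg_1_23 f') = \<epsilon>3" "conv \<Delta>3 (leg_1_23 f') (leg_1_23 f) = \<epsilon>3"
  "conv \<Delta>3 (leg_12_3 f) (leg_12_3 f') = \<epsilon>3" "conv \<Delta>3 (leg_12_3 f') (leg_12_3 f) = \<epsilon>3"
  by (simp_all add: conv_legs f_form f'_form f_inverse leg_counit)

lemma assoc_forms: "(\<lambda>(a, b, c). \<Phi> a b c) \<in> H3" "(\<lambda>(a, b, c). \<Phi>' a b c) \<in> H3"
  unfolding twist_assoc_eq twist_assoc_inv_eq
  by (intro H3.convL_form leg_forms f_form f'_form)+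

lemma assoc_inverse:
  "conv \<Delta>3 (\<lambda>(a, b, c). \<Phi> a b c) (\<lambda>(a, b, c). \<Phi>' a b c) = \<epsilon>3"
  "conv \<Delta>3 (\<lambda>(a, b, c). \<Phi>' a b c) (\<lambda>(a, b, c). \<Phi> a b c) = \<epsilon>3"
proof -
  note [simp] = leg_forms[OF f_form] leg_forms[OF f'_form] H3.convL_form
  show "conv \<Delta>3 (\<lambda>(a, b, c). \<Phi> a b c) (\<lambda>(a, b, c). \<Phi>' a b c) = \<epsilon>3"
    unfolding twist_assoc_eq twist_assoc_inv_eq
    by (intro conv_cancel) (simp_all add: conv_cancel leg_inverses)
  show "conv \<Delta>3 (\<lambda>(a, b, c). \<Phi>' a b c) (\<lambda>(a, b, c). \<Phi> a b c) = \<epsilon>3"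
    unfolding twist_assoc_eq twist_assoc_inv_eq
    by (intro conv_cancel) (simp_all add: conv_cancel leg_inverses)
qed

text \<open>
  Both bracketings are conjugates of the same untwisted product, and \<open>\<Phi>\<close> is the quotient of the
  conjugating factors; \<open>conv_conjugate\<close> puts this together.
\<close>

theorem twist_pairing_quasi_assoc:
  assumes M: "bicomodule scale \<Delta> \<epsilon> sM LM RM" and N: "bicomodule scale \<Delta> \<epsilon> sN LN RN"
    and P: "bicomodule scale \<Delta> \<epsilon> sP LP RP"
    and MN: "bicomodule scale \<Delta> \<epsilon> sMN LMN RMN" and NP: "bicomodule scale \<Delta> \<epsilon> sNP LNP RNP"
    and V: "bicomodule scale \<Delta> \<epsilon> sV LV RV"
    and \<mu>: "pairing sN LN RN sP LP RP sNP LNP RNP \<mu>"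
    and \<nu>: "pairing sM LM RM sNP LNP RNP sV LV RV \<nu>"
    and \<mu>': "pairing sM LM RM sN LN RN sMN LMN RMN \<mu>'"
    and \<nu>': "pairing sMN LMN RMN sP LP RP sV LV RV \<nu>'"
    and assoc: "\<And>m n p. \<nu> m (\<mu> n p) = \<nu>' (\<mu>' m n) p"
  shows "twist_pairing sV LM RM LNP RNP F F' \<nu> m (twist_pairing sNP LN RN LP RP F F' \<mu> n p) =
    (\<Sum>(m1, m2, m3)\<in>#bicoact LM RM m. \<Sum>(n1, n2, n3)\<in>#bicoact LN RN n.
     \<Sum>(p1, p2, p3)\<in>#bicoact LP RP p. sV (\<Phi> m1 n1 p1 * \<Phi>' m3 n3 p3)
       (twist_pairing sV LMN RMN LP RP F F' \<nu>' (twist_pairing sMN LM RM LN RN F F' \<mu>' m2 n2) p2))"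
proof (rule vector_eqI_functionals)
  interpret V: bicomodule scale \<Delta> \<epsilon> sV LV RV by fact
  show "vector_space sV" by (rule V.Omega.vector_space_axioms)
  fix g assume g: "g \<in> forms sV"
  define L3 where "L3 = prod_coact LM (prod_coact LN LP)"
  define R3 where "R3 = prod_coact RM (prod_coact RN RP)"
  interpret MNP: form_bicomodule H3 \<Delta>3 \<epsilon>3 "forms sM \<boxtimes> forms sN \<boxtimes> forms sP" L3 R3
    unfolding L3_def R3_def by (intro form_bicomodule_prod bicomodule_imp_form_bicomodule M N P)
  define X where "X = (\<lambda>(m, n, p). g (\<nu> m (\<mu> n p)))"
  have X: "X \<in> forms sM \<boxtimes> forms sN \<boxtimes> forms sP"
  proof -
    have "(\<lambda>(m, q). g (\<nu> m q)) \<in> forms sM \<boxtimes> forms sNP"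
      using form_mapD(2)[OF \<nu> g] by (simp add: case_prod_unfold)
    from form_mapD(2)[OF form_map_second[OF \<mu>] this] show ?thesis
      by (simp add: X_def case_prod_unfold)
  qed
  note [simp] = leg_forms[OF f_form] leg_forms[OF f'_form] H3.convL_form X
  have left: "(\<lambda>(m, n, p). g (twist_pairing sV LMN RMN LP RP F F' \<nu>'
        (twist_pairing sMN LM RM LN RN F F' \<mu>' m n) p)) =
      conv L3 (conv \<Delta>3 (leg_12 f) (leg_12_3 f)) (conv R3 X (conv \<Delta>3 (leg_12_3 f') (leg_12 f')))"
    unfolding X_def assoc L3_def R3_def by (rule twist_pairing_nested_left[OF M N P MN \<mu>' \<nu>' g])
  have "g (twist_pairing sV LM RM LNP RNP F F' \<nu> m (twist_pairing sNP LN RN LP RP F F' \<mu> n p)) =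
      conv L3 (conv \<Delta>3 (leg_23 f) (leg_1_23 f))
        (conv R3 X (conv \<Delta>3 (leg_1_23 f') (leg_23 f'))) (m, n, p)"
    using twist_pairing_nested_right[OF M N P NP \<mu> \<nu> g]
    by (simp add: fun_eq_iff X_def L3_def R3_def)
  also have "\<dots> = conv L3 (\<lambda>(a, b, c). \<Phi> a b c) (conv R3 (\<lambda>(m, n, p). g (twist_pairing sV LMN RMN LP RP F F' \<nu>'
        (twist_pairing sMN LM RM LN RN F F' \<mu>' m n) p)) (\<lambda>(a, b, c). \<Phi>' a b c)) (m, n, p)"
    unfolding twist_assoc_eq twist_assoc_inv_eq left
    by (subst MNP.conv_conjugate[OF H3.form_bicomodule_axioms])
      (simp_all add: conv_cancel leg_inverses)
  also have "\<dots> = g (\<Sum>(m1, m2, m3)\<in>#bicoact LM RM m. \<Sum>(n1, n2, n3)\<in>#bicoact LN RN n.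
     \<Sum>(p1, p2, p3)\<in>#bicoact LP RP p. sV (\<Phi> m1 n1 p1 * \<Phi>' m3 n3 p3)
       (twist_pairing sV LMN RMN LP RP F F' \<nu>' (twist_pairing sMN LM RM LN RN F F' \<mu>' m2 n2) p2))"
    unfolding functional_bicoact3[OF g] L3_def R3_def ..
  finally show "g (twist_pairing sV LM RM LNP RNP F F' \<nu> m (twist_pairing sNP LN RN LP RP F F' \<mu> n p)) = \<dots>" .
qed

section \<open>The 3-cocycle identity\<close>

abbreviation "H4 \<equiv> H1 \<boxtimes> H3"
abbreviation "\<Delta>4 \<equiv> prod_coact \<Delta> \<Delta>3"
abbreviation "\<epsilon>4 \<equiv> tens \<epsilon> \<epsilon>3"

sublocale H4: form_bicomodule H4 \<Delta>4 \<epsilon>4 H4 \<Delta>4 \<Delta>4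
  by (intro form_bicomodule_prod H1.form_bicomodule_axioms H3.form_bicomodule_axioms)

text \<open>
  The corresponding algebra maps from three to four arguments.  With three groups of digits, those of one
  group are multiplied; \<open>leg_234\<close> and \<open>leg_123\<close> leave the argument they omit to the counit.
\<close>

definition "leg_234 g = tens \<epsilon> g" for g :: "'h \<times> 'h \<times> 'h \<Rightarrow> 'k"
definition "leg_123 g = (\<lambda>(a, b, c, d). g (a, b, c) * \<epsilon> d)" for g :: "'h \<times> 'h \<times> 'h \<Rightarrow> 'k"
definition "leg_12_3_4 g = (\<lambda>(a, b, c, d). g (a * b, c, d))" for g :: "'h \<times> 'h \<times> 'h \<Rightarrow> 'k"
definition "leg_1_23_4 g = (\<lambda>(a, b, c, d). g (a, b * c, d))" for g :: "'h \<times> 'h \<times> 'h \<Rightarrow> 'k"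
definition "leg_1_2_34 g = (\<lambda>(a, b, c, d). g (a, b, c * d))" for g :: "'h \<times> 'h \<times> 'h \<Rightarrow> 'k"

lemma form_map_12_3_4: "form_map H4 H4 \<Delta>4 \<Delta>4 (\<lambda>(a, b, c, d). (a * b, c, d)) (\<lambda>(a, b, c, d). (a * b, c, d)) H3 H3 \<Delta>3 \<Delta>3"
  using form_map_leading_pair[OF mult_form_map H1.A_space H1.A_space] by (simp add: case_prod_unfold)

lemma form_map_1_23_4: "form_map H4 H4 \<Delta>4 \<Delta>4 (\<lambda>(a, b, c, d). (a, b * c, d)) (\<lambda>(a, b, c, d). (a, b * c, d)) H3 H3 \<Delta>3 \<Delta>3"
  using form_map_second[OF form_map_12_3] by (simp add: case_prod_unfold)

lemma form_map_1_2_34: "form_map H4 H4 \<Delta>4 \<Delta>4 (\<lambda>(a, b, c, d). (a, b, c * d)) (\<lambda>(a, b, c, d). (a, b, c * d)) H3 H3 \<Delta>3 \<Delta>3"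
  using form_map_second[OF form_map_1_23] by (simp add: case_prod_unfold)

lemma leg4_forms:
  assumes "g \<in> H3"
  shows "leg_234 g \<in> H4" "leg_123 g \<in> H4" "leg_12_3_4 g \<in> H4" "leg_1_23_4 g \<in> H4" "leg_1_2_34 g \<in> H4"
proof -
  show "leg_234 g \<in> H4"
    unfolding leg_234_def by (intro tens_form assms H1.A_space H3.A_space H1.counit_form)
  show "leg_123 g \<in> H4"
    using assms H1.counit_form
    by (simp add: leg_123_def pair_forms_iff form_space_scale[OF H1.A_space])
  show "leg_12_3_4 g \<in> H4" "leg_1_23_4 g \<in> H4" "leg_1_2_34 g \<in> H4"
    using form_mapD(1)[OF form_map_12_3_4 assms] form_mapD(1)[OF form_map_1_23_4 assms]
      form_mapD(1)[OF form_map_1_2_34 assms]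
    by (simp_all add: leg_12_3_4_def leg_1_23_4_def leg_1_2_34_def case_prod_unfold)
qed

lemma conv_leg_234:
  assumes "\<phi> \<in> H4"
  shows "conv \<Delta>4 (leg_234 g) \<phi> (a, q) = conv \<Delta>3 g (\<lambda>q. \<phi> (a, q)) q"
    and "conv \<Delta>4 \<phi> (leg_234 g) (a, q) = conv \<Delta>3 (\<lambda>q. \<phi> (a, q)) g q"
  unfolding leg_234_def using assms
  by (intro H1.conv_counit_first; simp add: pair_forms_iff split_paired_all)+

lemma conv_leg_123:
  assumes "\<phi> \<in> H4"
  shows "conv \<Delta>4 (leg_123 g) \<phi> (a, b, c, d) = conv \<Delta>3 g (\<lambda>(a, b, c). \<phi> (a, b, c, d)) (a, b, c)"
    and "conv \<Delta>4 \<phi> (leg_123 g) (a, b, c, d) = conv \<Delta>3 (\<lambda>(a, b, c). \<phi> (a, b, c, d)) g (a, b, c)"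
proof -
  have form: "(\<lambda>d. \<phi> (a, b, c, d)) \<in> H1" for a b c using assms by (simp add: pair_forms_iff)
  have "conv \<Delta>4 (leg_123 g) \<phi> (a, b, c, d) =
    (\<Sum>(a1, a2)\<in>#\<Delta> a. \<Sum>(b1, b2)\<in>#\<Delta> b. \<Sum>(c1, c2)\<in>#\<Delta> c. g (a1, b1, c1) *
      (\<Sum>(d1, d2)\<in>#\<Delta> d. \<epsilon> d1 * \<phi> (a2, b2, c2, d2)))"
    unfolding conv_def sum_prod_coact_pairs
    by (simp add: leg_123_def sum_mset_distrib_left case_prod_unfold mult.assoc)
  then show "conv \<Delta>4 (leg_123 g) \<phi> (a, b, c, d) = conv \<Delta>3 g (\<lambda>(a, b, c). \<phi> (a, b, c, d)) (a, b, c)"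
    by (simp add: H1.counitL[OF form] conv_def sum_prod_coact_pairs)
  have "conv \<Delta>4 \<phi> (leg_123 g) (a, b, c, d) =
    (\<Sum>(a1, a2)\<in>#\<Delta> a. \<Sum>(b1, b2)\<in>#\<Delta> b. \<Sum>(c1, c2)\<in>#\<Delta> c.
      (\<Sum>(d1, d2)\<in>#\<Delta> d. \<phi> (a1, b1, c1, d1) * \<epsilon> d2) * g (a2, b2, c2))"
    unfolding conv_def sum_prod_coact_pairs
    by (simp add: leg_123_def sum_mset_distrib_left case_prod_unfold ac_simps)
  then show "conv \<Delta>4 \<phi> (leg_123 g) (a, b, c, d) = conv \<Delta>3 (\<lambda>(a, b, c). \<phi> (a, b, c, d)) g (a, b, c)"
    by (simp add: H1.counitR[OF form] conv_def sum_prod_coact_pairs)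
qed

lemma conv_legs4:
  assumes "g \<in> H3" "k \<in> H3"
  shows "conv \<Delta>4 (leg_234 g) (leg_234 k) = leg_234 (conv \<Delta>3 g k)"
    and "conv \<Delta>4 (leg_123 g) (leg_123 k) = leg_123 (conv \<Delta>3 g k)"
    and "conv \<Delta>4 (leg_12_3_4 g) (leg_12_3_4 k) = leg_12_3_4 (conv \<Delta>3 g k)"
    and "conv \<Delta>4 (leg_1_23_4 g) (leg_1_23_4 k) = leg_1_23_4 (conv \<Delta>3 g k)"
    and "conv \<Delta>4 (leg_1_2_34 g) (leg_1_2_34 k) = leg_1_2_34 (conv \<Delta>3 g k)"
proof -
  have "conv \<Delta>4 (leg_234 g) (leg_234 k) (a, b, c, d) = leg_234 (conv \<Delta>3 g k) (a, b, c, d)" for a b c d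
    unfolding conv_leg_234[OF leg4_forms(1)[OF assms(2)]]
    by (simp add: leg_234_def tens_def conv_scale)
  then show "conv \<Delta>4 (leg_234 g) (leg_234 k) = leg_234 (conv \<Delta>3 g k)" by auto
  have "conv \<Delta>4 (leg_123 g) (leg_123 k) (a, b, c, d) = leg_123 (conv \<Delta>3 g k) (a, b, c, d)" for a b c d
    unfolding conv_leg_123[OF leg4_forms(2)[OF assms(2)]]
    by (simp add: leg_123_def case_prod_unfold conv_scale)
  then show "conv \<Delta>4 (leg_123 g) (leg_123 k) = leg_123 (conv \<Delta>3 g k)" by auto
  show "conv \<Delta>4 (leg_12_3_4 g) (leg_12_3_4 k) = leg_12_3_4 (conv \<Delta>3 g k)"
    using conv_form_map(1)[OF form_map_12_3_4 H3.A_space H3.A_space assms]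
    by (simp add: leg_12_3_4_def fun_eq_iff case_prod_unfold)
  show "conv \<Delta>4 (leg_1_23_4 g) (leg_1_23_4 k) = leg_1_23_4 (conv \<Delta>3 g k)"
    using conv_form_map(1)[OF form_map_1_23_4 H3.A_space H3.A_space assms]
    by (simp add: leg_1_23_4_def fun_eq_iff case_prod_unfold)
  show "conv \<Delta>4 (leg_1_2_34 g) (leg_1_2_34 k) = leg_1_2_34 (conv \<Delta>3 g k)"
    using conv_form_map(1)[OF form_map_1_2_34 H3.A_space H3.A_space assms]
    by (simp add: leg_1_2_34_def fun_eq_iff case_prod_unfold)
qed

lemma leg4_counit: "leg_234 \<epsilon>3 = \<epsilon>4" "leg_123 \<epsilon>3 = \<epsilon>4" "leg_12_3_4 \<epsilon>3 = \<epsilon>4" "leg_1_23_4 \<epsilon>3 = \<epsilon>4" "leg_1_2_34 \<epsilon>3 = \<epsilon>4"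
  by (auto simp: leg_234_def leg_123_def leg_12_3_4_def leg_1_23_4_def leg_1_2_34_def tens_def counit_mult)

lemmas leg_defs = leg_23_def leg_12_def leg_1_23_def leg_12_3_def
  leg_234_def leg_123_def leg_12_3_4_def leg_1_23_4_def leg_1_2_34_def tens_def

text \<open>
  Different routes from two to four arguments agree because the multiplication is associative and the
  counit is multiplicative.  These are the identities behind the telescoping in the cocycle identity.
\<close>

lemma leg_coincidences:
  "leg_123 (leg_23 g) = leg_234 (leg_12 g)"
  "leg_1_23_4 (leg_23 g) = leg_234 (leg_12_3 g)"
  "leg_1_2_34 (leg_23 g) = leg_234 (leg_1_23 g)"
  "leg_12_3_4 (leg_23 g) = leg_234 (leg_23 g)"
  "leg_1_23_4 (leg_12 g) = leg_123 (leg_1_23 g)"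
  "leg_1_2_34 (leg_12 g) = leg_123 (leg_12 g)"
  "leg_12_3_4 (leg_12 g) = leg_123 (leg_12_3 g)"
  "leg_1_2_34 (leg_1_23 g) = leg_1_23_4 (leg_1_23 g)"
  "leg_12_3_4 (leg_12_3 g) = leg_1_23_4 (leg_12_3 g)"
  "leg_12_3_4 (leg_1_23 g) = leg_1_2_34 (leg_12_3 g)"
  by (auto simp: leg_defs counit_mult mult.assoc mult.commute mult.left_commute fun_eq_iff)


abbreviation twisted_product (infixl "\<bullet>" 70) where "(\<bullet>) \<equiv> twist_mult scale \<Delta> F F'"

lemma twist_mult_eq_pairing: "(\<bullet>) = twist_pairing scale \<Delta> \<Delta> \<Delta> \<Delta> F F' (*)"
  by (simp add: fun_eq_iff twist_mult_def twist_pairing_def cop3_eq_bicoact)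

lemma functional_twisted_product:
  "k \<in> H1 \<Longrightarrow> k (a \<bullet> b) = conv \<Delta>2 f (conv \<Delta>2 (\<lambda>(a, b). k (a * b)) f') (a, b)"
  unfolding twist_mult_eq_pairing by (rule functional_twist_pairing)

lemma conv_leg_pair:
  assumes "\<phi> \<in> H4"
  shows "conv \<Delta>4 (leg_123 (leg_12 g)) \<phi> (a, b, c, d) = conv \<Delta>2 g (\<lambda>(a, b). \<phi> (a, b, c, d)) (a, b)"
    and "conv \<Delta>4 \<phi> (leg_123 (leg_12 g)) (a, b, c, d) = conv \<Delta>2 (\<lambda>(a, b). \<phi> (a, b, c, d)) g (a, b)"
    and "conv \<Delta>4 (leg_234 (leg_12 g)) \<phi> (a, b, c, d) = conv \<Delta>2 g (\<lambda>(b, c). \<phi> (a, b, c, d)) (b, c)"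
    and "conv \<Delta>4 \<phi> (leg_234 (leg_12 g)) (a, b, c, d) = conv \<Delta>2 (\<lambda>(b, c). \<phi> (a, b, c, d)) g (b, c)"
    and "conv \<Delta>4 (leg_234 (leg_23 g)) \<phi> (a, b, c, d) = conv \<Delta>2 g (\<lambda>(c, d). \<phi> (a, b, c, d)) (c, d)"
    and "conv \<Delta>4 \<phi> (leg_234 (leg_23 g)) (a, b, c, d) = conv \<Delta>2 (\<lambda>(c, d). \<phi> (a, b, c, d)) g (c, d)"
  unfolding conv_leg_123[OF assms] conv_leg_234[OF assms] leg_12_def leg_23_def using assms
  by (subst H1.conv_counit_last H1.conv_counit_first; simp add: pair_forms_iff split_paired_all case_prod_unfold)+

text \<open>
  Either product reduces to \<open>k (a, b) * g (c, d)\<close>, each factor being a counit where the other one acts.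
\<close>

lemma disjoint_legs_commute:
  assumes "g \<in> H2" "k \<in> H2"
  shows "conv \<Delta>4 (leg_234 (leg_23 g)) (leg_123 (leg_12 k)) =
    conv \<Delta>4 (leg_123 (leg_12 k)) (leg_234 (leg_23 g))"
proof -
  have "conv \<Delta>4 (leg_234 (leg_23 g)) (leg_123 (leg_12 k)) (a, b, c, d) =
    conv \<Delta>4 (leg_123 (leg_12 k)) (leg_234 (leg_23 g)) (a, b, c, d)" for a b c d
  proof -
    have "conv \<Delta>4 (leg_234 (leg_23 g)) (leg_123 (leg_12 k)) (a, b, c, d) =
        conv \<Delta>2 g (\<lambda>q. k (a, b) * \<epsilon>2 q) (c, d)"
      by (subst conv_leg_pair(5)) (simp_all add: leg_forms leg4_forms assms,
        simp add: leg_defs case_prod_unfold mult.assoc)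
    also have "\<dots> = k (a, b) * g (c, d)"
      by (simp add: conv_scale H2.convR_counit assms)
    also have "\<dots> = conv \<Delta>2 k (\<lambda>q. \<epsilon>2 q * g (c, d)) (a, b)"
      by (simp add: conv_scale H2.convR_counit assms)
    also have "\<dots> = conv \<Delta>4 (leg_123 (leg_12 k)) (leg_234 (leg_23 g)) (a, b, c, d)"
      by (subst conv_leg_pair(1)) (simp_all add: leg_forms leg4_forms assms,
        simp add: leg_defs case_prod_unfold mult.assoc)
    finally show ?thesis .
  qed
  then show ?thesis by auto
qed

abbreviation "\<phi> \<equiv> (\<lambda>(a, b, c). \<Phi> a b c)"

text \<open>
  \<open>\<Phi>\<close> is linear in each argument, so a twisted product in one of them amounts to conjugation by \<open>F\<close> in
  the two arguments that are multiplied.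
\<close>

lemma assoc_twisted_product:
  "(\<lambda>(a, b, c, d). \<Phi> (a \<bullet> b) c d) =
    conv \<Delta>4 (leg_123 (leg_12 f)) (conv \<Delta>4 (leg_12_3_4 \<phi>) (leg_123 (leg_12 f')))"
  "(\<lambda>(a, b, c, d). \<Phi> a (b \<bullet> c) d) =
    conv \<Delta>4 (leg_234 (leg_12 f)) (conv \<Delta>4 (leg_1_23_4 \<phi>) (leg_234 (leg_12 f')))"
  "(\<lambda>(a, b, c, d). \<Phi> a b (c \<bullet> d)) =
    conv \<Delta>4 (leg_234 (leg_23 f)) (conv \<Delta>4 (leg_1_2_34 \<phi>) (leg_234 (leg_23 f')))"
proof -
  have lin: "(\<lambda>x. \<Phi> x c d) \<in> H1" "(\<lambda>x. \<Phi> a x d) \<in> H1" "(\<lambda>x. \<Phi> a b x) \<in> H1" for a b c d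
    using assoc_forms(1) by (simp_all add: pair_forms_iff)
  note [simp] = leg4_forms leg_forms f_form f'_form assoc_forms H4.convL_form
  have "\<Phi> (a \<bullet> b) c d = conv \<Delta>4 (leg_123 (leg_12 f)) (conv \<Delta>4 (leg_12_3_4 \<phi>) (leg_123 (leg_12 f'))) (a, b, c, d)" for a b c d
    by (simp add: functional_twisted_product[OF lin(1)] conv_leg_pair(1,2) case_prod_eta)
      (simp add: leg_12_3_4_def)
  then show "(\<lambda>(a, b, c, d). \<Phi> (a \<bullet> b) c d) =
      conv \<Delta>4 (leg_123 (leg_12 f)) (conv \<Delta>4 (leg_12_3_4 \<phi>) (leg_123 (leg_12 f')))" by auto
  have "\<Phi> a (b \<bullet> c) d = conv \<Delta>4 (leg_234 (leg_12 f)) (conv \<Delta>4 (leg_1_23_4 \<phi>) (leg_234 (leg_12 f'))) (a, b, c, d)" for a b c d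
    by (simp add: functional_twisted_product[OF lin(2)] conv_leg_pair(3,4) case_prod_eta)
      (simp add: leg_1_23_4_def)
  then show "(\<lambda>(a, b, c, d). \<Phi> a (b \<bullet> c) d) =
      conv \<Delta>4 (leg_234 (leg_12 f)) (conv \<Delta>4 (leg_1_23_4 \<phi>) (leg_234 (leg_12 f')))" by auto
  have "\<Phi> a b (c \<bullet> d) = conv \<Delta>4 (leg_234 (leg_23 f)) (conv \<Delta>4 (leg_1_2_34 \<phi>) (leg_234 (leg_23 f'))) (a, b, c, d)" for a b c d
    by (simp add: functional_twisted_product[OF lin(3)] conv_leg_pair(5,6) case_prod_eta)
      (simp add: leg_1_2_34_def)
  then show "(\<lambda>(a, b, c, d). \<Phi> a b (c \<bullet> d)) =
      conv \<Delta>4 (leg_234 (leg_23 f)) (conv \<Delta>4 (leg_1_2_34 \<phi>) (leg_234 (leg_23 f')))" by auto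
qed

text \<open>
  With \<open>F'\<close> for the inverse factors, the left side is
  \<open>F\<^sub>3\<^sub>4 F\<^sub>2\<^sub>,\<^sub>3\<^sub>4 F'\<^sub>2\<^sub>3\<^sub>,\<^sub>4 F'\<^sub>2\<^sub>3 \<cdot> F\<^sub>2\<^sub>3 F\<^sub>2\<^sub>3\<^sub>,\<^sub>4 F\<^sub>1\<^sub>,\<^sub>2\<^sub>3\<^sub>4 F'\<^sub>1\<^sub>2\<^sub>3\<^sub>,\<^sub>4 F'\<^sub>1\<^sub>,\<^sub>2\<^sub>3 F'\<^sub>2\<^sub>3 \<cdot> F\<^sub>2\<^sub>3 F\<^sub>1\<^sub>,\<^sub>2\<^sub>3 F'\<^sub>1\<^sub>2\<^sub>,\<^sub>3 F'\<^sub>1\<^sub>2\<close>, and the right side is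
  \<open>F\<^sub>3\<^sub>4 F\<^sub>2\<^sub>,\<^sub>3\<^sub>4 F\<^sub>1\<^sub>,\<^sub>2\<^sub>3\<^sub>4 F'\<^sub>1\<^sub>2\<^sub>,\<^sub>3\<^sub>4 F'\<^sub>1\<^sub>2 F'\<^sub>3\<^sub>4 \<cdot> F\<^sub>1\<^sub>2 F\<^sub>3\<^sub>4 F\<^sub>1\<^sub>2\<^sub>,\<^sub>3\<^sub>4 F'\<^sub>1\<^sub>2\<^sub>3\<^sub>,\<^sub>4 F'\<^sub>1\<^sub>2\<^sub>,\<^sub>3 F'\<^sub>1\<^sub>2\<close>.  Once \<open>F'\<^sub>3\<^sub>4\<close> has been moved past \<open>F\<^sub>1\<^sub>2\<close>, both
  collapse to \<open>F\<^sub>3\<^sub>4 F\<^sub>2\<^sub>,\<^sub>3\<^sub>4 F\<^sub>1\<^sub>,\<^sub>2\<^sub>3\<^sub>4 F'\<^sub>1\<^sub>2\<^sub>3\<^sub>,\<^sub>4 F'\<^sub>1\<^sub>2\<^sub>,\<^sub>3 F'\<^sub>1\<^sub>2\<close>.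
\<close>

lemma assoc_cocycle_conv:
  "conv \<Delta>4 (leg_234 \<phi>) (conv \<Delta>4 (\<lambda>(a, b, c, d). \<Phi> a (b \<bullet> c) d) (leg_123 \<phi>)) =
   conv \<Delta>4 (\<lambda>(a, b, c, d). \<Phi> a b (c \<bullet> d)) (\<lambda>(a, b, c, d). \<Phi> (a \<bullet> b) c d)"
proof -
  note [simp] = leg_forms[OF f_form] leg_forms[OF f'_form] leg4_forms f_form f'_form
    H3.convL_form H4.convL_form
  have inverse: "conv \<Delta>4 (leg_234 (leg_12 f')) (leg_234 (leg_12 f)) = \<epsilon>4"
    "conv \<Delta>4 (leg_234 (leg_12_3 f')) (leg_234 (leg_12_3 f)) = \<epsilon>4"
    "conv \<Delta>4 (leg_123 (leg_1_23 f')) (leg_123 (leg_1_23 f)) = \<epsilon>4"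
    "conv \<Delta>4 (leg_123 (leg_12 f')) (leg_123 (leg_12 f)) = \<epsilon>4"
    "conv \<Delta>4 (leg_234 (leg_23 f')) (leg_234 (leg_23 f)) = \<epsilon>4"
    "conv \<Delta>4 (leg_1_2_34 (leg_12_3 f')) (leg_1_2_34 (leg_12_3 f)) = \<epsilon>4"
    by (simp_all add: conv_legs4 leg_inverses leg4_counit)
  have cancel: "conv \<Delta>4 p (conv \<Delta>4 q r) = r"
    if "conv \<Delta>4 p q = \<epsilon>4" "p \<in> H4" "q \<in> H4" "r \<in> H4" for p q r
    using that H4.convL_assoc[of p q r] by (simp add: H4.convL_counit)
  have swap: "conv \<Delta>4 (leg_234 (leg_23 f')) (conv \<Delta>4 (leg_123 (leg_12 f)) r) =
    conv \<Delta>4 (leg_123 (leg_12 f)) (conv \<Delta>4 (leg_234 (leg_23 f')) r)" if "r \<in> H4" for r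
    using that by (simp add: H4.convL_assoc[symmetric] disjoint_legs_commute)
  show ?thesis
    unfolding assoc_twisted_product twist_assoc_eq
    by (simp add: conv_legs4[symmetric] leg_coincidences H4.convL_assoc swap
        cancel[OF inverse(1)] cancel[OF inverse(2)] cancel[OF inverse(3)]
        cancel[OF inverse(4)] cancel[OF inverse(5)] cancel[OF inverse(6)])
qed

lemma assoc_cocycle_sums:
  "(\<Sum>(a1, a2)\<in>#\<Delta> a. \<Sum>(b1, b2, b3)\<in>#cop3 \<Delta> b.
     \<Sum>(c1, c2, c3)\<in>#cop3 \<Delta> c. \<Sum>(e1, e2)\<in>#\<Delta> e.
       \<Phi> b1 c1 e1 * \<Phi> a1 (b2 \<bullet> c2) e2 * \<Phi> a2 b3 c3) =
   (\<Sum>(a1, a2)\<in>#\<Delta> a. \<Sum>(b1, b2)\<in>#\<Delta> b. \<Sum>(c1, c2)\<in>#\<Delta> c. \<Sum>(e1, e2)\<in>#\<Delta> e.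
       \<Phi> a1 b1 (c1 \<bullet> e1) * \<Phi> (a2 \<bullet> b2) c2 e2)"
proof -
  define \<psi> where "\<psi> = (\<lambda>(a, b, c, d). \<Phi> a (b \<bullet> c) d)"
  have \<psi>: "\<psi> \<in> H4" unfolding \<psi>_def assoc_twisted_product
    by (intro H4.convL_form leg4_forms leg_forms assoc_forms f_form f'_form)
  have in_H4: "conv \<Delta>4 \<psi> (leg_123 \<phi>) \<in> H4"
    by (intro H4.convL_form leg4_forms assoc_forms \<psi>)
  have "(\<Sum>(a1, a2)\<in>#\<Delta> a. \<Sum>(b1, b2, b3)\<in>#cop3 \<Delta> b.
     \<Sum>(c1, c2, c3)\<in>#cop3 \<Delta> c. \<Sum>(e1, e2)\<in>#\<Delta> e.
       \<Phi> b1 c1 e1 * \<Phi> a1 (b2 \<bullet> c2) e2 * \<Phi> a2 b3 c3) =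
    (\<Sum>(b1, b')\<in>#\<Delta> b. \<Sum>(c1, c')\<in>#\<Delta> c. \<Sum>(e1, e2)\<in>#\<Delta> e. \<Sum>(a1, a2)\<in>#\<Delta> a.
      \<Sum>(b2, b3)\<in>#\<Delta> b'. \<Sum>(c2, c3)\<in>#\<Delta> c'. \<Phi> b1 c1 e1 * \<Phi> a1 (b2 \<bullet> c2) e2 * \<Phi> a2 b3 c3)"
    by (simp only: sum_cop3) (rule sum_reorder_cocycle[symmetric])
  also have "\<dots> = conv \<Delta>4 (leg_234 \<phi>) (conv \<Delta>4 \<psi> (leg_123 \<phi>)) (a, b, c, e)"
    unfolding conv_leg_234(1)[OF in_H4] conv_def[of \<Delta>3 \<phi>] sum_prod_coact_pairs conv_leg_123(2)[OF \<psi>]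
    unfolding conv_def sum_prod_coact_pairs
    by (simp add: \<psi>_def sum_mset_distrib_left case_prod_unfold mult.assoc)
  also have "\<dots> = (\<Sum>(a1, a2)\<in>#\<Delta> a. \<Sum>(b1, b2)\<in>#\<Delta> b. \<Sum>(c1, c2)\<in>#\<Delta> c. \<Sum>(e1, e2)\<in>#\<Delta> e.
       \<Phi> a1 b1 (c1 \<bullet> e1) * \<Phi> (a2 \<bullet> b2) c2 e2)"
    unfolding \<psi>_def assoc_cocycle_conv unfolding conv_def sum_prod_coact_pairs by simp
  finally show ?thesis .
qed

section \<open>The twisted coquasi-bialgebra\<close>

lemma twist_pairing_bilinear:
  assumes M: "bicomodule scale \<Delta> \<epsilon> sM LM RM" and N: "bicomodule scale \<Delta> \<epsilon> sN LN RN"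
    and V: "bicomodule scale \<Delta> \<epsilon> sV LV RV"
    and \<mu>: "pairing sM LM RM sN LN RN sV LV RV \<mu>"
  shows "bilinear_map sM sN sV (twist_pairing sV LM RM LN RN F F' \<mu>)"
proof -
  interpret M: bicomodule scale \<Delta> \<epsilon> sM LM RM by fact
  interpret N: bicomodule scale \<Delta> \<epsilon> sN LN RN by fact
  interpret V: bicomodule scale \<Delta> \<epsilon> sV LV RV by fact
  show ?thesis
    unfolding bilinear_map_def
    using twist_pairing_form[OF M N \<mu>]
    by (auto intro!: linearI_functionals M.Omega.vector_space_axioms N.Omega.vector_space_axioms
        V.Omega.vector_space_axioms simp: pair_forms_iff)
qed

lemma self_bicomodule: "bicomodule scale \<Delta> \<epsilon> scale \<Delta> \<Delta>"
  by (intro bicomodule_self coalgebra_axioms)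

text \<open>
  Tested on \<open>g \<otimes> k\<close>, the claim is that conjugation by \<open>F\<close> is multiplicative: the conjugate of
  \<open>(g \<circ> (*)) * (k \<circ> (*))\<close> is the product of the conjugates.
\<close>

lemma comult_twisted_product:
  "tensor_eq scale scale (\<Delta> (a \<bullet> b))
     (\<Sum>(a1, a2)\<in>#\<Delta> a. {#(a1 \<bullet> b1, a2 \<bullet> b2). (b1, b2)\<in>#\<Delta> b#})"
proof (rule tensor_eqI_functionals[OF vector_space_axioms vector_space_axioms])
  fix g k assume g: "g \<in> H1" and k: "k \<in> H1"
  have m: "(\<lambda>(a, b). g (a * b)) \<in> H2" "(\<lambda>(a, b). k (a * b)) \<in> H2"
    using form_mapD(1)[OF mult_form_map g] form_mapD(1)[OF mult_form_map k]
    by (simp_all add: case_prod_unfold)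
  note [simp] = m f_form f'_form H2.convL_form
  have cancel: "conv \<Delta>2 f' (conv \<Delta>2 f r) = r" if "r \<in> H2" for r
    using that H2.convL_assoc[of f' f r] by (simp add: f_inverse H2.convL_counit)
  have product: "conv \<Delta>2 f (conv \<Delta>2 (\<lambda>(a, b). g (a * b)) f') = (\<lambda>(a, b). g (a \<bullet> b))" if "g \<in> H1" for g
    using functional_twisted_product[OF that] by auto
  have "(\<Sum>(x, y)\<in>#\<Delta> (a \<bullet> b). g x * k y) = conv \<Delta> g k (a \<bullet> b)"
    by (simp add: conv_def)
  also have "\<dots> = conv \<Delta>2 f (conv \<Delta>2 (\<lambda>(a, b). conv \<Delta> g k (a * b)) f') (a, b)"
    by (intro functional_twisted_product H1.convL_form g k)
  also have "(\<lambda>(a, b). conv \<Delta> g k (a * b)) = conv \<Delta>2 (\<lambda>(a, b). g (a * b)) (\<lambda>(a, b). k (a * b))"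
    using conv_form_map(1)[OF mult_form_map H1.A_space H1.A_space g k]
    by (auto simp: case_prod_unfold)
  also have "conv \<Delta>2 f (conv \<Delta>2 \<dots> f') =
      conv \<Delta>2 (conv \<Delta>2 f (conv \<Delta>2 (\<lambda>(a, b). g (a * b)) f'))
        (conv \<Delta>2 f (conv \<Delta>2 (\<lambda>(a, b). k (a * b)) f'))"
    by (simp add: H2.convL_assoc cancel)
  also have "\<dots> (a, b) = (\<Sum>(x, y)\<in>#(\<Sum>(a1, a2)\<in>#\<Delta> a. {#(a1 \<bullet> b1, a2 \<bullet> b2). (b1, b2)\<in>#\<Delta> b#}). g x * k y)"
    unfolding product[OF g] product[OF k] unfolding conv_def sum_prod_coact_pairs
    by (simp add: sum_mset_Union case_prod_unfold multiset.map_comp o_def)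
  finally show "(\<Sum>(x, y)\<in>#\<Delta> (a \<bullet> b). g x * k y) = \<dots>" .
qed

lemma counit_twisted_product: "\<epsilon> (a \<bullet> b) = \<epsilon> a * \<epsilon> b"
proof -
  have "(\<lambda>(a, b). \<epsilon> (a * b)) = \<epsilon>2" by (auto simp: tens_def counit_mult)
  then show ?thesis
    unfolding functional_twisted_product[OF H1.counit_form]
    by (simp add: H2.convL_counit f'_form f_inverse) (simp add: tens_def)
qed

lemma trilinear_form_iff: "trilinear_form scale g \<longleftrightarrow> (\<lambda>(a, b, c). g a b c) \<in> H3"
  by (auto simp: trilinear_form_def pair_forms_iff linear_functional_iff[OF vector_space_axioms])

theorem twisted_coquasi_bialgebra: "coquasi_bialgebra scale \<Delta> \<epsilon> (\<bullet>) \<Phi> \<Phi>'"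
proof
  show "bilinear_map scale scale scale (\<bullet>)"
    unfolding twist_mult_eq_pairing by (rule twist_pairing_bilinear[OF self_bicomodule self_bicomodule self_bicomodule mult_form_map])
  show "trilinear_form scale \<Phi>" "trilinear_form scale \<Phi>'"
    by (simp_all add: trilinear_form_iff assoc_forms)
  show "(\<Sum>(a1, a2)\<in>#\<Delta> a. \<Sum>(b1, b2)\<in>#\<Delta> b. \<Sum>(c1, c2)\<in>#\<Delta> c. \<Phi> a1 b1 c1 * \<Phi>' a2 b2 c2)
         = \<epsilon> a * \<epsilon> b * \<epsilon> c" for a b c
    using fun_cong[OF assoc_inverse(1), of "(a, b, c)"]
    by (simp add: conv_def sum_prod_coact_pairs tens_def mult.assoc)
  show "(\<Sum>(a1, a2)\<in>#\<Delta> a. \<Sum>(b1, b2)\<in>#\<Delta> b. \<Sum>(c1, c2)\<in>#\<Delta> c. \<Phi>' a1 b1 c1 * \<Phi> a2 b2 c2)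
         = \<epsilon> a * \<epsilon> b * \<epsilon> c" for a b c
    using fun_cong[OF assoc_inverse(2), of "(a, b, c)"]
    by (simp add: conv_def sum_prod_coact_pairs tens_def mult.assoc)
  show "a \<bullet> (b \<bullet> c) =
       (\<Sum>(a1, a2, a3)\<in>#cop3 \<Delta> a. \<Sum>(b1, b2, b3)\<in>#cop3 \<Delta> b. \<Sum>(c1, c2, c3)\<in>#cop3 \<Delta> c.
          scale (\<Phi> a1 b1 c1 * \<Phi>' a3 b3 c3) ((a2 \<bullet> b2) \<bullet> c2))" for a b c
    unfolding twist_mult_eq_pairing cop3_eq_bicoact
    by (rule twist_pairing_quasi_assoc[OF self_bicomodule self_bicomodule self_bicomodule self_bicomodule self_bicomodule self_bicomodule
          mult_form_map mult_form_map mult_form_map mult_form_map]) (rule mult.assoc[symmetric])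
qed (rule comult_twisted_product counit_twisted_product assoc_cocycle_sums)+

end

section \<open>The twisted calculus\<close>

locale twisted_calculus =
  twisting scale comult counit antipode F F' +
  bicovariant_calculus scale comult counit antipode scaleO coactL coactR actL actR d
  for scale :: "'k::field \<Rightarrow> 'h::ring_1 \<Rightarrow> 'h"
    and comult :: "'h \<Rightarrow> ('h \<times> 'h) multiset" ("\<Delta>")
    and counit :: "'h \<Rightarrow> 'k" ("\<epsilon>")
    and antipode :: "'h \<Rightarrow> 'h" ("S")
    and F F' :: "'h \<Rightarrow> 'h \<Rightarrow> 'k"
    and scaleO :: "'k \<Rightarrow> 'o::ab_group_add \<Rightarrow> 'o"
    and coactL :: "'o \<Rightarrow> ('h \<times> 'o) multiset" ("\<Delta>L")
    and coactR :: "'o \<Rightarrow> ('o \<times> 'h) multiset" ("\<Delta>R")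
    and actL :: "'h \<Rightarrow> 'o \<Rightarrow> 'o" (infixr "\<rhd>" 75)
    and actR :: "'o \<Rightarrow> 'h \<Rightarrow> 'o" (infixl "\<lhd>" 75)
    and d :: "'h \<Rightarrow> 'o"
begin

lemma calculus_bicomodule: "bicomodule scale \<Delta> \<epsilon> scaleO \<Delta>L \<Delta>R" ..

abbreviation "\<Omega>1 \<equiv> forms scaleO"

lemma actL_pairing: "pairing scale \<Delta> \<Delta> scaleO \<Delta>L \<Delta>R scaleO \<Delta>L \<Delta>R (\<rhd>)"
proof -
  have "(\<lambda>(a, b). g (a * b)) \<in> H2" if "g \<in> H1" for g
    using form_mapD(1)[OF mult_form_map that] by (simp add: case_prod_unfold)
  moreover have "(\<lambda>(a, t). g (a \<rhd> t)) \<in> H1 \<boxtimes> \<Omega>1" if "g \<in> \<Omega>1" for g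
    by (rule bilinear_map_functional[OF actL_bilinear that])
  moreover have "(\<Sum>z\<in>#\<Delta>L (a \<rhd> t). T z) = (\<Sum>((c1, c2), a', t')\<in>#prod_coact \<Delta> \<Delta>L (a, t). T (c1 * c2, a' \<rhd> t'))"
    if "T \<in> H1 \<boxtimes> \<Omega>1" for T a t
    using tensor_eq_imp_sum_eq[OF coactL_actL that, of a t]
    by (simp add: sum_prod_coact sum_mset_Union multiset.map_comp o_def case_prod_unfold)
  moreover have "(\<Sum>z\<in>#\<Delta>R (a \<rhd> t). T z) = (\<Sum>((a', t'), c1, c2)\<in>#prod_coact \<Delta> \<Delta>R (a, t). T (a' \<rhd> t', c1 * c2))"
    if "T \<in> \<Omega>1 \<boxtimes> H1" for T a t
    using tensor_eq_imp_sum_eq[OF coactR_actL that, of a t]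
    by (simp add: sum_prod_coact sum_mset_Union multiset.map_comp o_def case_prod_unfold)
  ultimately show ?thesis
    unfolding form_map_def by (simp add: split_paired_all case_prod_unfold)
qed

lemma actR_pairing: "pairing scaleO \<Delta>L \<Delta>R scale \<Delta> \<Delta> scaleO \<Delta>L \<Delta>R (\<lhd>)"
proof -
  have "(\<lambda>(a, b). g (a * b)) \<in> H2" if "g \<in> H1" for g
    using form_mapD(1)[OF mult_form_map that] by (simp add: case_prod_unfold)
  moreover have "(\<lambda>(t, a). g (t \<lhd> a)) \<in> \<Omega>1 \<boxtimes> H1" if "g \<in> \<Omega>1" for g
    by (rule bilinear_map_functional[OF actR_bilinear that])
  moreover have "(\<Sum>z\<in>#\<Delta>L (t \<lhd> a). T z) = (\<Sum>((c1, c2), t', a')\<in>#prod_coact \<Delta>L \<Delta> (t, a). T (c1 * c2, t' \<lhd> a'))"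
    if "T \<in> H1 \<boxtimes> \<Omega>1" for T a t
    using tensor_eq_imp_sum_eq[OF coactL_actR that, of t a]
      sum_mset_swap_pairs[of "\<lambda>c1 t' c2 a'. T (c1 * c2, t' \<lhd> a')" "\<Delta> a" "\<Delta>L t"]
    by (simp add: sum_prod_coact sum_mset_Union multiset.map_comp o_def case_prod_unfold)
  moreover have "(\<Sum>z\<in>#\<Delta>R (t \<lhd> a). T z) = (\<Sum>((t', a'), c1, c2)\<in>#prod_coact \<Delta>R \<Delta> (t, a). T (t' \<lhd> a', c1 * c2))"
    if "T \<in> \<Omega>1 \<boxtimes> H1" for T a t
    using tensor_eq_imp_sum_eq[OF coactR_actR that, of t a]
      sum_mset_swap_pairs[of "\<lambda>t' c1 a' c2. T (t' \<lhd> a', c1 * c2)" "\<Delta> a" "\<Delta>R t"]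
    by (simp add: sum_prod_coact sum_mset_Union multiset.map_comp o_def case_prod_unfold)
  ultimately show ?thesis
    unfolding form_map_def by (simp add: split_paired_all case_prod_unfold)
qed

lemma d_form_map: "form_map H1 H1 \<Delta> \<Delta> (\<lambda>c. c) d H1 \<Omega>1 \<Delta>L \<Delta>R"
proof -
  have "(\<lambda>a. g (d a)) \<in> H1" if "g \<in> \<Omega>1" for g
    using linear_functional_comp[OF d_linear that] .
  moreover have "(\<Sum>z\<in>#\<Delta>L (d a). T z) = (\<Sum>(a1, a2)\<in>#\<Delta> a. T (a1, d a2))"
    if "T \<in> H1 \<boxtimes> \<Omega>1" for T a
    using tensor_eq_imp_sum_eq[OF coactL_d that, of a]
    by (simp add: multiset.map_comp o_def case_prod_unfold)
  moreover have "(\<Sum>z\<in>#\<Delta>R (d a). T z) = (\<Sum>(a1, a2)\<in>#\<Delta> a. T (d a1, a2))"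
    if "T \<in> \<Omega>1 \<boxtimes> H1" for T a
    using tensor_eq_imp_sum_eq[OF coactR_d that, of a]
    by (simp add: multiset.map_comp o_def case_prod_unfold)
  ultimately show ?thesis
    unfolding form_map_def by simp
qed

abbreviation twisted_actL (infixr "\<rhd>\<^sub>F" 75) where
  "(\<rhd>\<^sub>F) \<equiv> twist_actL \<Delta> scaleO \<Delta>L \<Delta>R (\<rhd>) F F'"
abbreviation twisted_actR (infixl "\<lhd>\<^sub>F" 75) where
  "(\<lhd>\<^sub>F) \<equiv> twist_actR \<Delta> scaleO \<Delta>L \<Delta>R (\<lhd>) F F'"

lemma twist_actL_eq_pairing: "(\<rhd>\<^sub>F) = twist_pairing scaleO \<Delta> \<Delta> \<Delta>L \<Delta>R F F' (\<rhd>)"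
  by (simp add: fun_eq_iff twist_actL_def twist_pairing_def cop3_eq_bicoact)

lemma twist_actR_eq_pairing: "(\<lhd>\<^sub>F) = twist_pairing scaleO \<Delta>L \<Delta>R \<Delta> \<Delta> F F' (\<lhd>)"
  by (simp add: fun_eq_iff twist_actR_def twist_pairing_def cop3_eq_bicoact)

sublocale H\<Omega>: form_bicomodule H2 \<Delta>2 \<epsilon>2 "H1 \<boxtimes> \<Omega>1" "prod_coact \<Delta> \<Delta>L" "prod_coact \<Delta> \<Delta>R"
  by (intro form_bicomodule_prod bicomodule_imp_form_bicomodule self_bicomodule calculus_bicomodule)
sublocale \<Omega>H: form_bicomodule H2 \<Delta>2 \<epsilon>2 "\<Omega>1 \<boxtimes> H1" "prod_coact \<Delta>L \<Delta>" "prod_coact \<Delta>R \<Delta>"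
  by (intro form_bicomodule_prod bicomodule_imp_form_bicomodule self_bicomodule calculus_bicomodule)

text \<open>
  Because \<open>d\<close> is a bicomodule map, the coactions on \<open>d b\<close> become coproducts of \<open>b\<close>, and the twist is again
  a conjugation by \<open>F\<close> among forms on \<open>H\<close>.
\<close>

lemma functional_actL_d:
  assumes g: "g \<in> \<Omega>1"
  shows "g (a \<rhd>\<^sub>F d b) = conv \<Delta>2 f (conv \<Delta>2 (\<lambda>(a, b). g (a \<rhd> d b)) f') (a, b)"
proof -
  have map: "form_map H2 H2 \<Delta>2 \<Delta>2 (\<lambda>c. c) (\<lambda>(a, b). (a, d b)) H2 (H1 \<boxtimes> \<Omega>1)
      (prod_coact \<Delta> \<Delta>L) (prod_coact \<Delta> \<Delta>R)"
    using form_map_second[OF d_form_map, of H1 H1 \<Delta> \<Delta>] by (simp add: id_def)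
  have act: "(\<lambda>(a, t). g (a \<rhd> t)) \<in> H1 \<boxtimes> \<Omega>1"
    using form_mapD(2)[OF actL_pairing g] by (simp add: case_prod_unfold)
  have "g (a \<rhd>\<^sub>F d b) = conv (prod_coact \<Delta> \<Delta>L) f
      (conv (prod_coact \<Delta> \<Delta>R) (\<lambda>(a, t). g (a \<rhd> t)) f') (a, d b)"
    unfolding twist_actL_eq_pairing by (rule functional_twist_pairing[OF g])
  also have "\<dots> = conv \<Delta>2 f (\<lambda>(a, b). conv (prod_coact \<Delta> \<Delta>R) (\<lambda>(a, t). g (a \<rhd> t)) f' (a, d b)) (a, b)"
    using conv_form_map(1)[OF map H2.A_space H\<Omega>.B_space f_form H\<Omega>.convR_form[OF f'_form act], of "(a, b)"]
    by (simp add: case_prod_unfold)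
  also have "(\<lambda>(a, b). conv (prod_coact \<Delta> \<Delta>R) (\<lambda>(a, t). g (a \<rhd> t)) f' (a, d b)) =
      conv \<Delta>2 (\<lambda>(a, b). g (a \<rhd> d b)) f'"
    using conv_form_map(2)[OF map H2.A_space H\<Omega>.B_space f'_form act]
    by (auto simp: case_prod_unfold)
  finally show ?thesis .
qed

lemma functional_actR_d:
  assumes g: "g \<in> \<Omega>1"
  shows "g (d a \<lhd>\<^sub>F b) = conv \<Delta>2 f (conv \<Delta>2 (\<lambda>(a, b). g (d a \<lhd> b)) f') (a, b)"
proof -
  have map: "form_map H2 H2 \<Delta>2 \<Delta>2 (\<lambda>c. c) (\<lambda>(a, b). (d a, b)) H2 (\<Omega>1 \<boxtimes> H1)
      (prod_coact \<Delta>L \<Delta>) (prod_coact \<Delta>R \<Delta>)"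
    using form_map_first[OF d_form_map H1.A_space form_space_forms, of H1 H1 \<Delta> \<Delta>] by (simp add: id_def)
  have act: "(\<lambda>(t, b). g (t \<lhd> b)) \<in> \<Omega>1 \<boxtimes> H1"
    using form_mapD(2)[OF actR_pairing g] by (simp add: case_prod_unfold)
  have "g (d a \<lhd>\<^sub>F b) = conv (prod_coact \<Delta>L \<Delta>) f
      (conv (prod_coact \<Delta>R \<Delta>) (\<lambda>(t, b). g (t \<lhd> b)) f') (d a, b)"
    unfolding twist_actR_eq_pairing by (rule functional_twist_pairing[OF g])
  also have "\<dots> = conv \<Delta>2 f (\<lambda>(a, b). conv (prod_coact \<Delta>R \<Delta>) (\<lambda>(t, b). g (t \<lhd> b)) f' (d a, b)) (a, b)"
    using conv_form_map(1)[OF map H2.A_space \<Omega>H.B_space f_form \<Omega>H.convR_form[OF f'_form act], of "(a, b)"]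
    by (simp add: case_prod_unfold)
  also have "(\<lambda>(a, b). conv (prod_coact \<Delta>R \<Delta>) (\<lambda>(t, b). g (t \<lhd> b)) f' (d a, b)) =
      conv \<Delta>2 (\<lambda>(a, b). g (d a \<lhd> b)) f'"
    using conv_form_map(2)[OF map H2.A_space \<Omega>H.B_space f'_form act]
    by (auto simp: case_prod_unfold)
  finally show ?thesis .
qed

lemma twisted_Leibniz: "d (a \<bullet> b) = a \<rhd>\<^sub>F d b + d a \<lhd>\<^sub>F b"
proof (rule vector_eqI_functionals[OF Omega.vector_space_axioms])
  fix g assume g: "g \<in> \<Omega>1"
  have "(\<lambda>x. g (d x)) \<in> H1" by (rule form_mapD(2)[OF d_form_map g])
  then have "g (d (a \<bullet> b)) = conv \<Delta>2 f (conv \<Delta>2 (\<lambda>(a, b). g (d (a * b))) f') (a, b)"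
    by (rule functional_twisted_product)
  also have "(\<lambda>(a, b). g (d (a * b))) = (\<lambda>z. (\<lambda>(a, b). g (a \<rhd> d b)) z + (\<lambda>(a, b). g (d a \<lhd> b)) z)"
    by (auto simp: Leibniz forms_add[OF g])
  also have "conv \<Delta>2 f (conv \<Delta>2 \<dots> f') (a, b) = g (a \<rhd>\<^sub>F d b) + g (d a \<lhd>\<^sub>F b)"
    unfolding functional_actL_d[OF g] functional_actR_d[OF g] conv_add(2)[abs_def] conv_add(1) ..
  also have "\<dots> = g (a \<rhd>\<^sub>F d b + d a \<lhd>\<^sub>F b)" by (simp add: forms_add[OF g])
  finally show "g (d (a \<bullet> b)) = g (a \<rhd>\<^sub>F d b + d a \<lhd>\<^sub>F b)" .
qed

text \<open>
  A functional vanishing on all \<open>a \<bullet> d b\<close> gives a form on \<open>H \<otimes> H\<close> whose conjugate by \<open>F\<close> is zero.  The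
  conjugation is invertible, so the form itself is zero and the functional vanishes on all \<open>a d b\<close>.
\<close>

lemma twisted_span: "module.span scaleO {a \<rhd>\<^sub>F d b | a b. True} = UNIV"
proof (rule ccontr)
  assume "Omega.span {a \<rhd>\<^sub>F d b | a b. True} \<noteq> UNIV"
  then obtain v where "v \<notin> Omega.span {a \<rhd>\<^sub>F d b | a b. True}" by blast
  then obtain g where g: "g \<in> \<Omega>1" "g v = 1" and zero: "\<And>a b. g (a \<rhd>\<^sub>F d b) = 0"
    using functional_vanishing_on_span[OF Omega.vector_space_axioms] by (smt (verit) mem_Collect_eq)
  define k where "k = (\<lambda>(a, b). g (a \<rhd> d b))"
  have "form_map H2 H2 \<Delta>2 \<Delta>2 (\<lambda>c. c) (\<lambda>(a, b). (a, d b)) H2 (H1 \<boxtimes> \<Omega>1)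
      (prod_coact \<Delta> \<Delta>L) (prod_coact \<Delta> \<Delta>R)"
    using form_map_second[OF d_form_map, of H1 H1 \<Delta> \<Delta>] by (simp add: id_def)
  then have k: "k \<in> H2"
    using form_mapD(2)[OF _ form_mapD(2)[OF actL_pairing g(1)]] by (fastforce simp: k_def case_prod_unfold)
  have vanish: "conv \<Delta>2 f (conv \<Delta>2 k f') = (\<lambda>z. 0)"
    using functional_actL_d[OF g(1)] zero by (auto simp: k_def)
  \<comment> \<open>Conjugating back recovers the form.\<close>
  have "k = conv \<Delta>2 (conv \<Delta>2 f' (conv \<Delta>2 f (conv \<Delta>2 k f'))) f"
    using k by (simp add: H2.convL_assoc[symmetric] f_inverse f_form f'_form H2.convL_form H2.convL_counit)
      (simp add: H2.convL_assoc f_inverse f_form f'_form H2.convR_counit)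
  also have "\<dots> = (\<lambda>z. 0)"
    unfolding vanish by (simp add: conv_def[abs_def] case_prod_unfold)
  finally have "g (a \<rhd> d b) = 0" for a b by (simp add: k_def fun_eq_iff)
  moreover have "v \<in> Omega.span {a \<rhd> d b | a b. True}" using span_d by simp
  moreover have "Omega.subspace {x. g x = 0}"
    by (simp add: Omega.subspace_def forms_zero[OF g(1)] forms_add[OF g(1)] forms_scale[OF g(1)])
  ultimately have "g v = 0"
    using Omega.span_induct[of v "{a \<rhd> d b | a b. True}" "\<lambda>x. g x = 0"] by blast
  with g(2) show False by simp
qed

theorem twisted_first_order_quasi_calculus:
  "first_order_quasi_calculus scale \<Delta> \<epsilon> (\<bullet>) \<Phi> \<Phi>' scaleO \<Delta>L \<Delta>R (\<rhd>\<^sub>F) (\<lhd>\<^sub>F) d"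
proof (intro first_order_quasi_calculus.intro twisted_coquasi_bialgebra calculus_bicomodule
    first_order_quasi_calculus_axioms.intro)
  note C = calculus_bicomodule
  show "bilinear_map scale scaleO scaleO (\<rhd>\<^sub>F)"
    unfolding twist_actL_eq_pairing by (rule twist_pairing_bilinear[OF self_bicomodule C C actL_pairing])
  show "bilinear_map scaleO scale scaleO (\<lhd>\<^sub>F)"
    unfolding twist_actR_eq_pairing by (rule twist_pairing_bilinear[OF C self_bicomodule C actR_pairing])
  show "a \<rhd>\<^sub>F b \<rhd>\<^sub>F \<tau> = (\<Sum>(a1, a2, a3)\<in>#cop3 \<Delta> a. \<Sum>(b1, b2, b3)\<in>#cop3 \<Delta> b.
      \<Sum>(t1, t2, t3)\<in>#bicoact \<Delta>L \<Delta>R \<tau>. scaleO (\<Phi> a1 b1 t1 * \<Phi>' a3 b3 t3) ((a2 \<bullet> b2) \<rhd>\<^sub>F t2))" for a b \<tau>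
    unfolding twist_actL_eq_pairing twist_mult_eq_pairing cop3_eq_bicoact
    by (rule twist_pairing_quasi_assoc[OF self_bicomodule self_bicomodule C self_bicomodule C C
          actL_pairing actL_pairing mult_form_map actL_pairing]) (rule actL_mult[symmetric])
  show "\<tau> \<lhd>\<^sub>F (b \<bullet> c) = (\<Sum>(t1, t2, t3)\<in>#bicoact \<Delta>L \<Delta>R \<tau>. \<Sum>(b1, b2, b3)\<in>#cop3 \<Delta> b.
      \<Sum>(c1, c2, c3)\<in>#cop3 \<Delta> c. scaleO (\<Phi> t1 b1 c1 * \<Phi>' t3 b3 c3) (t2 \<lhd>\<^sub>F b2 \<lhd>\<^sub>F c2))" for \<tau> b c
    unfolding twist_actR_eq_pairing twist_mult_eq_pairing cop3_eq_bicoact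
    by (rule twist_pairing_quasi_assoc[OF C self_bicomodule self_bicomodule C self_bicomodule C
          mult_form_map actR_pairing actR_pairing actR_pairing]) (rule actR_mult)
  show "a \<rhd>\<^sub>F (\<tau> \<lhd>\<^sub>F c) = (\<Sum>(a1, a2, a3)\<in>#cop3 \<Delta> a. \<Sum>(t1, t2, t3)\<in>#bicoact \<Delta>L \<Delta>R \<tau>.
      \<Sum>(c1, c2, c3)\<in>#cop3 \<Delta> c. scaleO (\<Phi> a1 t1 c1 * \<Phi>' a3 t3 c3) ((a2 \<rhd>\<^sub>F t2) \<lhd>\<^sub>F c2))" for a \<tau> c
    unfolding twist_actL_eq_pairing twist_actR_eq_pairing cop3_eq_bicoact
    by (rule twist_pairing_quasi_assoc[OF self_bicomodule C self_bicomodule C C C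
          actR_pairing actL_pairing actL_pairing actR_pairing]) (rule act_commute)
qed (rule d_linear twisted_Leibniz twisted_span)+

end

theorem proposition5p2:
  fixes scaleH :: "'k::field \<Rightarrow> 'h::ring_1 \<Rightarrow> 'h"
    and scaleO :: "'k \<Rightarrow> 'o::ab_group_add \<Rightarrow> 'o"
    and F Finv :: "'h \<Rightarrow> 'h \<Rightarrow> 'k"
  assumes "bicovariant_calculus scaleH \<Delta> \<epsilon> S scaleO \<Delta>L \<Delta>R actL actR d"
    and "two_cochain scaleH \<Delta> \<epsilon> F Finv"
  shows "first_order_quasi_calculus scaleH \<Delta> \<epsilon>
           (twist_mult scaleH \<Delta> F Finv) (twist_assoc \<Delta> F Finv) (twist_assoc_inv \<Delta> F Finv)
           scaleO \<Delta>L \<Delta>R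
           (twist_actL \<Delta> scaleO \<Delta>L \<Delta>R actL F Finv)
           (twist_actR \<Delta> scaleO \<Delta>L \<Delta>R actR F Finv) d"
proof -
  interpret C: bicovariant_calculus scaleH \<Delta> \<epsilon> S scaleO \<Delta>L \<Delta>R actL actR d by fact
  interpret twisted_calculus scaleH \<Delta> \<epsilon> S F Finv scaleO \<Delta>L \<Delta>R actL actR d
    by unfold_locales (fact assms(2))
  show ?thesis by (rule twisted_first_order_quasi_calculus)
qed

end
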